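(* Let $k\ge1$ and let $\Lambda$ be a row-finite locally convex $k$-graph. The following are equivalent. (1) $\Lambda$ is cofinal. (2) If $I$ is an ideal of $C^*(\Lambda)$ and $s_v\in I$ for some $v\in\Lambda^0$, then $I=C^*(\Lambda)$. (3) If $I$ is an ideal of $C^*(\Lambda)$ and $I\cap C^*(\Lambda)^\gamma\ne\{0\}$, then $I=C^*(\Lambda)$.
   Context: **Conventions.** $\mathbb N=\{0,1,2,\dots\}$. $\mathbb N^k$ is an additive monoid with canonical generators $e_1,\dots,e_k$ and coordinatewise order $\le$ (also used on $(\mathbb N\cup\{\infty\})^k$). **$k$-graphs.** A $k$-graph is a countable small category $\Lambda$ with a functor $d:\Lambda\to\mathbb N^k$ ($\mathbb N^k$ viewed as a one-object category under addition), called the degree, with the factorisation property: if $\lambda\in\Lambda$ is a morphism and $d(\lambda)=m+n$, there are unique $\mu,\nu\in\Lambda$ with $d(\mu)=m$, $d(\nu)=n$ and $\lambda=\mu\nu$. Elements of $\Lambda$ are its morphisms (paths); objects are identified with identity morphisms, and the set of these is $\Lambda^0=d^{-1}(0)$ (vertices). $r(\lambda)$ and $s(\lambda)$ denote the codomain and domain of $\lambda$; $\lambda\mu=\lambda\circ\mu$ is defined when $s(\lambda)=r(\mu)$. $\Lambda^n=d^{-1}(n)$. For $E\subseteq\Lambda$ and $v\in\Lambda^0$, $vE=\{\lambda\in E:r(\lambda)=v\}$ and $Ev=\{\lambda\in E:s(\lambda)=v\}$; $v\Lambda w=v\Lambda\cap\Lambda w$. $\Lambda$ is row-finite if $v\Lambda^n$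 is finite for all $v\in\Lambda^0$, $n\in\mathbb N^k$. $\Lambda$ is locally convex if for distinct $i,j\in\{1,\dots,k\}$ and $\lambda\in\Lambda^{e_i}$, $\mu\in\Lambda^{e_j}$ with $r(\lambda)=r(\mu)$, the sets $s(\lambda)\Lambda^{e_j}$ and $s(\mu)\Lambda^{e_i}$ are non-empty. For $n\in\mathbb N^k$, $\Lambda^{\le n}=\{\lambda\in\Lambda: d(\lambda)\le n$, and $s(\lambda)\Lambda^{e_i}=\emptyset$ whenever $d(\lambda)+e_i\le n\}$. **Boundary paths.** For $m\in(\mathbb N\cup\{\infty\})^k$, $\Omega_{k,m}$ is the $k$-graph with objects $\{p\in\mathbb N^k:p\le m\}$, morphisms $\{(p,q):p\le q\le m,\ p,q\in\mathbb N^k\}$ with $r(p,q)=p$, $s(p,q)=q$, $(p,q)(q,t)=(p,t)$, and $d(p,q)=q-p$. A boundary path of $\Lambda$ is a degree-preserving functor $x:\Omega_{k,m}\to\Lambda$ such that for all $p\in\mathbb N^k$ with $p\le m$ and all $i$, $p_i=m_i$ implies $x(p)\Lambda^{e_i}=\emptyset$, where $x(p)$ is the image of the object $p$. Its degree is $d(x)=m$. $\Lambda^{\le\infty}$ is the set of boundary paths. **Cofinality.** $\Lambda$ is cofinal if for each $x\in\Lambda^{\le\infty}$ and $v\in\Lambda^0$ there is $n\in\mathbb N^k$ with $n\le d(x)$ and $v\Lambda x(n)\ne\emptyset$. **$C^*(\Lambda)$.** A Cuntz–Krieger $\Lambda$-family in a $C^*$-algebra $A$ is a collection of partial isometries $\{t_\lambda:\lambda\in\Lambda\}\subseteq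 A$ such that (i) $\{t_v:v\in\Lambda^0\}$ are mutually orthogonal projections; (ii) $t_\lambda t_\mu=t_{\lambda\mu}$ whenever $s(\lambda)=r(\mu)$; (iii) $t_\mu^*t_\mu=t_{s(\mu)}$ for all $\mu$; (iv) $t_v=\sum_{\lambda\in v\Lambda^{\le n}}t_\lambda t_\lambda^*$ for all $v\in\Lambda^0$, $n\in\mathbb N^k$. $C^*(\Lambda)$ is the universal $C^*$-algebra generated by a Cuntz–Krieger $\Lambda$-family $\{s_\lambda\}$: for any Cuntz–Krieger $\Lambda$-family $\{t_\lambda\}$ in $A$ there is a homomorphism $\pi_t:C^*(\Lambda)\to A$ with $\pi_t(s_\lambda)=t_\lambda$. "Ideal" means closed two-sided ideal. **Gauge action.** For $z\in\mathbb T^k$ and $n\in\mathbb N^k$, $z^n=\prod_i z_i^{n_i}$. $\gamma$ is the strongly continuous action of $\mathbb T^k$ on $C^*(\Lambda)$ with $\gamma_z(s_\lambda)=z^{d(\lambda)}s_\lambda$. $C^*(\Lambda)^\gamma$ is its fixed-point algebra (equal to $\overline{\operatorname{span}}\{s_\mu s_\nu^*:d(\mu)=d(\nu)\}$). *)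

theory Defs
  imports "HOL-Analysis.Analysis" "HOL-Algebra.Module"
begin

section \<open>Higher-rank graphs\<close>

text \<open>The rank is \<open>k = CARD('k) \<ge> 1\<close> and \<open>\<nat>\<^sup>k\<close> is \<^typ>\<open>nat ^ 'k\<close>, with its coordinatewise addition and
  order. A small category is given by its set of morphisms; an object is identified with its identity
  morphism, so \<open>rng\<close> and \<open>src\<close> (codomain and domain) are morphisms again, and \<open>cmp \<eta> \<mu>\<close> is
  \<open>\<eta>\<mu> = \<eta> \<circ> \<mu>\<close>, meaningful when \<open>src \<eta> = rng \<mu>\<close>.\<close>

record ('a, 'k) kgraph =
  paths :: "'a set"
  rng :: "'a \<Rightarrow> 'a"
  src :: "'a \<Rightarrow> 'a"
  cmp :: "'a \<Rightarrow> 'a \<Rightarrow> 'a"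
  deg :: "'a \<Rightarrow> nat ^ 'k"

abbreviation unit_vec :: "'k \<Rightarrow> nat ^ 'k::finite" where
  "unit_vec i \<equiv> axis i 1"

locale kgraph =
  fixes \<Lambda> :: "('a, 'k::finite) kgraph"
  assumes countable_paths: "countable (paths \<Lambda>)"
    and rng_in_paths: "\<eta> \<in> paths \<Lambda> \<Longrightarrow> rng \<Lambda> \<eta> \<in> paths \<Lambda>"
    and src_in_paths: "\<eta> \<in> paths \<Lambda> \<Longrightarrow> src \<Lambda> \<eta> \<in> paths \<Lambda>"
    and rng_rng: "\<eta> \<in> paths \<Lambda> \<Longrightarrow> rng \<Lambda> (rng \<Lambda> \<eta>) = rng \<Lambda> \<eta>"
    and src_rng: "\<eta> \<in> paths \<Lambda> \<Longrightarrow> src \<Lambda> (rng \<Lambda> \<eta>) = rng \<Lambda> \<eta>"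
    and rng_src: "\<eta> \<in> paths \<Lambda> \<Longrightarrow> rng \<Lambda> (src \<Lambda> \<eta>) = src \<Lambda> \<eta>"
    and src_src: "\<eta> \<in> paths \<Lambda> \<Longrightarrow> src \<Lambda> (src \<Lambda> \<eta>) = src \<Lambda> \<eta>"
    and cmp_in_paths:
      "\<lbrakk>\<eta> \<in> paths \<Lambda>; \<mu> \<in> paths \<Lambda>; src \<Lambda> \<eta> = rng \<Lambda> \<mu>\<rbrakk> \<Longrightarrow> cmp \<Lambda> \<eta> \<mu> \<in> paths \<Lambda>"
    and rng_cmp:
      "\<lbrakk>\<eta> \<in> paths \<Lambda>; \<mu> \<in> paths \<Lambda>; src \<Lambda> \<eta> = rng \<Lambda> \<mu>\<rbrakk> \<Longrightarrow> rng \<Lambda> (cmp \<Lambda> \<eta> \<mu>) = rng \<Lambda> \<eta>"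
    and src_cmp:
      "\<lbrakk>\<eta> \<in> paths \<Lambda>; \<mu> \<in> paths \<Lambda>; src \<Lambda> \<eta> = rng \<Lambda> \<mu>\<rbrakk> \<Longrightarrow> src \<Lambda> (cmp \<Lambda> \<eta> \<mu>) = src \<Lambda> \<mu>"
    and cmp_assoc:
      "\<lbrakk>\<eta> \<in> paths \<Lambda>; \<mu> \<in> paths \<Lambda>; \<nu> \<in> paths \<Lambda>; src \<Lambda> \<eta> = rng \<Lambda> \<mu>; src \<Lambda> \<mu> = rng \<Lambda> \<nu>\<rbrakk>
        \<Longrightarrow> cmp \<Lambda> (cmp \<Lambda> \<eta> \<mu>) \<nu> = cmp \<Lambda> \<eta> (cmp \<Lambda> \<mu> \<nu>)"
    and cmp_rng: "\<eta> \<in> paths \<Lambda> \<Longrightarrow> cmp \<Lambda> (rng \<Lambda> \<eta>) \<eta> = \<eta>"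
    and cmp_src: "\<eta> \<in> paths \<Lambda> \<Longrightarrow> cmp \<Lambda> \<eta> (src \<Lambda> \<eta>) = \<eta>"
    and deg_cmp:
      "\<lbrakk>\<eta> \<in> paths \<Lambda>; \<mu> \<in> paths \<Lambda>; src \<Lambda> \<eta> = rng \<Lambda> \<mu>\<rbrakk> \<Longrightarrow> deg \<Lambda> (cmp \<Lambda> \<eta> \<mu>) = deg \<Lambda> \<eta> + deg \<Lambda> \<mu>"
    and deg_rng: "\<eta> \<in> paths \<Lambda> \<Longrightarrow> deg \<Lambda> (rng \<Lambda> \<eta>) = 0"
    and deg_src: "\<eta> \<in> paths \<Lambda> \<Longrightarrow> deg \<Lambda> (src \<Lambda> \<eta>) = 0"
    and factorisation:
      "\<lbrakk>\<eta> \<in> paths \<Lambda>; deg \<Lambda> \<eta> = m + n\<rbrakk> \<Longrightarrow>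
        \<exists>!(\<mu>, \<nu>). \<mu> \<in> paths \<Lambda> \<and> \<nu> \<in> paths \<Lambda> \<and> deg \<Lambda> \<mu> = m \<and> deg \<Lambda> \<nu> = n \<and>
          src \<Lambda> \<mu> = rng \<Lambda> \<nu> \<and> \<eta> = cmp \<Lambda> \<mu> \<nu>"

definition deg_paths :: "('a, 'k::finite) kgraph \<Rightarrow> nat ^ 'k \<Rightarrow> 'a set" where
  "deg_paths \<Lambda> n = {\<eta> \<in> paths \<Lambda>. deg \<Lambda> \<eta> = n}"

definition vertices :: "('a, 'k::finite) kgraph \<Rightarrow> 'a set" where
  "vertices \<Lambda> = deg_paths \<Lambda> 0"

definition from_range :: "('a, 'k::finite) kgraph \<Rightarrow> 'a \<Rightarrow> 'a set \<Rightarrow> 'a set" where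
  "from_range \<Lambda> v E = {\<eta> \<in> E. rng \<Lambda> \<eta> = v}"  \<comment> \<open>this is \<open>vE\<close>\<close>

definition to_source :: "('a, 'k::finite) kgraph \<Rightarrow> 'a set \<Rightarrow> 'a \<Rightarrow> 'a set" where
  "to_source \<Lambda> E v = {\<eta> \<in> E. src \<Lambda> \<eta> = v}"  \<comment> \<open>this is \<open>Ev\<close>\<close>

definition row_finite :: "('a, 'k::finite) kgraph \<Rightarrow> bool" where
  "row_finite \<Lambda> \<longleftrightarrow> (\<forall>v \<in> vertices \<Lambda>. \<forall>n. finite (from_range \<Lambda> v (deg_paths \<Lambda> n)))"

definition locally_convex :: "('a, 'k::finite) kgraph \<Rightarrow> bool" where
  "locally_convex \<Lambda> \<longleftrightarrow>
    (\<forall>i j. i \<noteq> j \<longrightarrow>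
      (\<forall>\<eta> \<in> deg_paths \<Lambda> (unit_vec i). \<forall>\<mu> \<in> deg_paths \<Lambda> (unit_vec j). rng \<Lambda> \<eta> = rng \<Lambda> \<mu> \<longrightarrow>
        from_range \<Lambda> (src \<Lambda> \<eta>) (deg_paths \<Lambda> (unit_vec j)) \<noteq> {} \<and>
        from_range \<Lambda> (src \<Lambda> \<mu>) (deg_paths \<Lambda> (unit_vec i)) \<noteq> {}))"

definition le_paths :: "('a, 'k::finite) kgraph \<Rightarrow> nat ^ 'k \<Rightarrow> 'a set" where
  "le_paths \<Lambda> n =
    {\<eta> \<in> paths \<Lambda>. deg \<Lambda> \<eta> \<le> n \<and>
      (\<forall>i. deg \<Lambda> \<eta> + unit_vec i \<le> n \<longrightarrow> from_range \<Lambda> (src \<Lambda> \<eta>) (deg_paths \<Lambda> (unit_vec i)) = {})}"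

subsection \<open>Boundary paths and cofinality\<close>

definition enat_vec :: "nat ^ 'k \<Rightarrow> enat ^ 'k::finite" where
  "enat_vec p = (\<chi> i. enat (p $ i))"

text \<open>The object \<open>p\<close> of \<open>\<Omega>\<^bsub>k,m\<^esub>\<close> is the identity morphism \<open>(p, p)\<close>.\<close>

definition Omega :: "enat ^ 'k \<Rightarrow> ((nat ^ 'k) \<times> (nat ^ 'k), 'k::finite) kgraph" where
  "Omega m =
    \<lparr>paths = {(p, q). p \<le> q \<and> enat_vec q \<le> m},
     rng = (\<lambda>(p, q). (p, p)),
     src = (\<lambda>(p, q). (q, q)),
     cmp = (\<lambda>(p, q) (q', t). (p, t)),
     deg = (\<lambda>(p, q). q - p)\<rparr>"

definition degree_functor ::
    "('a, 'k::finite) kgraph \<Rightarrow> ('b, 'k) kgraph \<Rightarrow> ('a \<Rightarrow> 'b) \<Rightarrow> bool" where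
  "degree_functor \<Gamma> \<Lambda> x \<longleftrightarrow>
    (\<forall>\<eta> \<in> paths \<Gamma>. x \<eta> \<in> paths \<Lambda> \<and> x (rng \<Gamma> \<eta>) = rng \<Lambda> (x \<eta>) \<and> x (src \<Gamma> \<eta>) = src \<Lambda> (x \<eta>) \<and>
      deg \<Lambda> (x \<eta>) = deg \<Gamma> \<eta>) \<and>
    (\<forall>\<eta> \<in> paths \<Gamma>. \<forall>\<mu> \<in> paths \<Gamma>. src \<Gamma> \<eta> = rng \<Gamma> \<mu> \<longrightarrow> x (cmp \<Gamma> \<eta> \<mu>) = cmp \<Lambda> (x \<eta>) (x \<mu>))"

text \<open>\<open>boundary_path \<Lambda> m x\<close>: \<open>x\<close> is a boundary path of degree \<open>m\<close>.\<close>

definition boundary_path ::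
    "('a, 'k::finite) kgraph \<Rightarrow> enat ^ 'k \<Rightarrow> ((nat ^ 'k) \<times> (nat ^ 'k) \<Rightarrow> 'a) \<Rightarrow> bool" where
  "boundary_path \<Lambda> m x \<longleftrightarrow>
    degree_functor (Omega m) \<Lambda> x \<and>
    (\<forall>p. enat_vec p \<le> m \<longrightarrow>
      (\<forall>i. enat (p $ i) = m $ i \<longrightarrow> from_range \<Lambda> (x (p, p)) (deg_paths \<Lambda> (unit_vec i)) = {}))"

definition cofinal_kgraph :: "('a, 'k::finite) kgraph \<Rightarrow> bool" where
  "cofinal_kgraph \<Lambda> \<longleftrightarrow>
    (\<forall>m x. boundary_path \<Lambda> m x \<longrightarrow>
      (\<forall>v \<in> vertices \<Lambda>. \<exists>n. enat_vec n \<le> m \<and>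
        from_range \<Lambda> v (paths \<Lambda>) \<inter> to_source \<Lambda> (paths \<Lambda>) (x (n, n)) \<noteq> {}))"


section \<open>C*-algebras\<close>

text \<open>The structure extends the module record of HOL-Algebra by an involution and a norm, so that sums
  are \<open>\<Oplus>\<close>, scalar multiplication is \<open>\<odot>\<close>, and so on. C*-algebras need not be unital: the inherited field
  \<open>one\<close> is left unconstrained and is never used.\<close>

record 'b cstar = "(complex, 'b) module" +
  adj :: "'b \<Rightarrow> 'b"
  nrm :: "'b \<Rightarrow> real"

definition complex_ring :: "complex ring" where
  "complex_ring = \<lparr>carrier = UNIV, mult = (*), one = 1, zero = 0, add = (+)\<rparr>"

text \<open>The case distinction is there because \<^locale>\<open>Metric_space\<close> wants a nonnegative symmetric
  function also outside the carrier.\<close>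

definition cstar_dist :: "'b cstar \<Rightarrow> 'b \<Rightarrow> 'b \<Rightarrow> real" where
  "cstar_dist A x y = (if x \<in> carrier A \<and> y \<in> carrier A then nrm A (x \<ominus>\<^bsub>A\<^esub> y) else 0)"

abbreviation cstar_topology :: "'b cstar \<Rightarrow> 'b topology" where
  "cstar_topology A \<equiv> Metric_space.mtopology (carrier A) (cstar_dist A)"

locale cstar_algebra = module complex_ring A for A :: "'b cstar" +
  assumes mult_closed: "\<lbrakk>x \<in> carrier A; y \<in> carrier A\<rbrakk> \<Longrightarrow> x \<otimes>\<^bsub>A\<^esub> y \<in> carrier A"
    and mult_assoc:
      "\<lbrakk>x \<in> carrier A; y \<in> carrier A; z \<in> carrier A\<rbrakk> \<Longrightarrow> (x \<otimes>\<^bsub>A\<^esub> y) \<otimes>\<^bsub>A\<^esub> z = x \<otimes>\<^bsub>A\<^esub> (y \<otimes>\<^bsub>A\<^esub> z)"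
    and distrib_right:
      "\<lbrakk>x \<in> carrier A; y \<in> carrier A; z \<in> carrier A\<rbrakk> \<Longrightarrow>
        (x \<oplus>\<^bsub>A\<^esub> y) \<otimes>\<^bsub>A\<^esub> z = (x \<otimes>\<^bsub>A\<^esub> z) \<oplus>\<^bsub>A\<^esub> (y \<otimes>\<^bsub>A\<^esub> z)"
    and distrib_left:
      "\<lbrakk>x \<in> carrier A; y \<in> carrier A; z \<in> carrier A\<rbrakk> \<Longrightarrow>
        x \<otimes>\<^bsub>A\<^esub> (y \<oplus>\<^bsub>A\<^esub> z) = (x \<otimes>\<^bsub>A\<^esub> y) \<oplus>\<^bsub>A\<^esub> (x \<otimes>\<^bsub>A\<^esub> z)"
    and smult_mult_left:
      "\<lbrakk>x \<in> carrier A; y \<in> carrier A\<rbrakk> \<Longrightarrow> (c \<odot>\<^bsub>A\<^esub> x) \<otimes>\<^bsub>A\<^esub> y = c \<odot>\<^bsub>A\<^esub> (x \<otimes>\<^bsub>A\<^esub> y)"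
    and smult_mult_right:
      "\<lbrakk>x \<in> carrier A; y \<in> carrier A\<rbrakk> \<Longrightarrow> x \<otimes>\<^bsub>A\<^esub> (c \<odot>\<^bsub>A\<^esub> y) = c \<odot>\<^bsub>A\<^esub> (x \<otimes>\<^bsub>A\<^esub> y)"
    and adj_closed: "x \<in> carrier A \<Longrightarrow> adj A x \<in> carrier A"
    and adj_adj: "x \<in> carrier A \<Longrightarrow> adj A (adj A x) = x"
    and adj_add: "\<lbrakk>x \<in> carrier A; y \<in> carrier A\<rbrakk> \<Longrightarrow> adj A (x \<oplus>\<^bsub>A\<^esub> y) = adj A x \<oplus>\<^bsub>A\<^esub> adj A y"
    and adj_smult: "x \<in> carrier A \<Longrightarrow> adj A (c \<odot>\<^bsub>A\<^esub> x) = cnj c \<odot>\<^bsub>A\<^esub> adj A x"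
    and adj_mult: "\<lbrakk>x \<in> carrier A; y \<in> carrier A\<rbrakk> \<Longrightarrow> adj A (x \<otimes>\<^bsub>A\<^esub> y) = adj A y \<otimes>\<^bsub>A\<^esub> adj A x"
    and nrm_nonneg: "x \<in> carrier A \<Longrightarrow> 0 \<le> nrm A x"
    and nrm_eq_0: "x \<in> carrier A \<Longrightarrow> nrm A x = 0 \<longleftrightarrow> x = \<zero>\<^bsub>A\<^esub>"
    and nrm_add: "\<lbrakk>x \<in> carrier A; y \<in> carrier A\<rbrakk> \<Longrightarrow> nrm A (x \<oplus>\<^bsub>A\<^esub> y) \<le> nrm A x + nrm A y"
    and nrm_smult: "x \<in> carrier A \<Longrightarrow> nrm A (c \<odot>\<^bsub>A\<^esub> x) = cmod c * nrm A x"
    and nrm_mult: "\<lbrakk>x \<in> carrier A; y \<in> carrier A\<rbrakk> \<Longrightarrow> nrm A (x \<otimes>\<^bsub>A\<^esub> y) \<le> nrm A x * nrm A y"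
    and nrm_adj_mult: "x \<in> carrier A \<Longrightarrow> nrm A (adj A x \<otimes>\<^bsub>A\<^esub> x) = (nrm A x)\<^sup>2"
    and complete: "Metric_space.mcomplete (carrier A) (cstar_dist A)"

definition cstar_hom :: "'b cstar \<Rightarrow> 'c cstar \<Rightarrow> ('b \<Rightarrow> 'c) \<Rightarrow> bool" where
  "cstar_hom A B f \<longleftrightarrow>
    (\<forall>x \<in> carrier A. f x \<in> carrier B) \<and>
    (\<forall>x \<in> carrier A. \<forall>y \<in> carrier A. f (x \<oplus>\<^bsub>A\<^esub> y) = f x \<oplus>\<^bsub>B\<^esub> f y) \<and>
    (\<forall>c. \<forall>x \<in> carrier A. f (c \<odot>\<^bsub>A\<^esub> x) = c \<odot>\<^bsub>B\<^esub> f x) \<and>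
    (\<forall>x \<in> carrier A. \<forall>y \<in> carrier A. f (x \<otimes>\<^bsub>A\<^esub> y) = f x \<otimes>\<^bsub>B\<^esub> f y) \<and>
    (\<forall>x \<in> carrier A. f (adj A x) = adj B (f x))"

definition closed_subspace :: "'b cstar \<Rightarrow> 'b set \<Rightarrow> bool" where
  "closed_subspace A S \<longleftrightarrow>
    S \<subseteq> carrier A \<and> \<zero>\<^bsub>A\<^esub> \<in> S \<and>
    (\<forall>x \<in> S. \<forall>y \<in> S. x \<oplus>\<^bsub>A\<^esub> y \<in> S) \<and> (\<forall>c. \<forall>x \<in> S. c \<odot>\<^bsub>A\<^esub> x \<in> S) \<and>
    closedin (cstar_topology A) S"

definition cstar_subalgebra :: "'b cstar \<Rightarrow> 'b set \<Rightarrow> bool" where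
  "cstar_subalgebra A S \<longleftrightarrow>
    closed_subspace A S \<and> (\<forall>x \<in> S. \<forall>y \<in> S. x \<otimes>\<^bsub>A\<^esub> y \<in> S) \<and> (\<forall>x \<in> S. adj A x \<in> S)"

definition cstar_ideal :: "'b cstar \<Rightarrow> 'b set \<Rightarrow> bool" where
  "cstar_ideal A I \<longleftrightarrow>
    closed_subspace A I \<and> (\<forall>a \<in> carrier A. \<forall>x \<in> I. a \<otimes>\<^bsub>A\<^esub> x \<in> I \<and> x \<otimes>\<^bsub>A\<^esub> a \<in> I)"


section \<open>The C*-algebra of a higher-rank graph\<close>

definition CK_family :: "('a, 'k::finite) kgraph \<Rightarrow> 'b cstar \<Rightarrow> ('a \<Rightarrow> 'b) \<Rightarrow> bool" where
  "CK_family \<Lambda> A t \<longleftrightarrow>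
    (\<forall>\<eta> \<in> paths \<Lambda>. t \<eta> \<in> carrier A \<and> t \<eta> \<otimes>\<^bsub>A\<^esub> adj A (t \<eta>) \<otimes>\<^bsub>A\<^esub> t \<eta> = t \<eta>) \<and>
    (\<forall>v \<in> vertices \<Lambda>. adj A (t v) = t v \<and> t v \<otimes>\<^bsub>A\<^esub> t v = t v) \<and>
    (\<forall>v \<in> vertices \<Lambda>. \<forall>w \<in> vertices \<Lambda>. v \<noteq> w \<longrightarrow> t v \<otimes>\<^bsub>A\<^esub> t w = \<zero>\<^bsub>A\<^esub>) \<and>
    (\<forall>\<eta> \<in> paths \<Lambda>. \<forall>\<mu> \<in> paths \<Lambda>. src \<Lambda> \<eta> = rng \<Lambda> \<mu> \<longrightarrow> t \<eta> \<otimes>\<^bsub>A\<^esub> t \<mu> = t (cmp \<Lambda> \<eta> \<mu>)) \<and>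
    (\<forall>\<mu> \<in> paths \<Lambda>. adj A (t \<mu>) \<otimes>\<^bsub>A\<^esub> t \<mu> = t (src \<Lambda> \<mu>)) \<and>
    (\<forall>v \<in> vertices \<Lambda>. \<forall>n.
      t v = (\<Oplus>\<^bsub>A\<^esub>\<eta> \<in> from_range \<Lambda> v (le_paths \<Lambda> n). t \<eta> \<otimes>\<^bsub>A\<^esub> adj A (t \<eta>)))"

text \<open>\<open>B\<close> is the universal C*-algebra \<open>C*(\<Lambda>)\<close>, generated by the Cuntz--Krieger family \<open>s\<close>.
  A definition in HOL cannot quantify over the carrier type of the test algebra \<open>A\<close>, so \<open>A\<close> ranges over
  the C*-algebras whose elements are real numbers. This is no restriction: a C*-algebra generated by
  countably many elements has at most continuum many elements, hence an isomorphic copy on a set of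
  reals. \<open>universal_CK_algebra_hom\<close> below derives the universal property for arbitrary carrier types.\<close>

definition universal_CK_algebra ::
    "('a, 'k::finite) kgraph \<Rightarrow> 'b cstar \<Rightarrow> ('a \<Rightarrow> 'b) \<Rightarrow> bool" where
  "universal_CK_algebra \<Lambda> B s \<longleftrightarrow>
    cstar_algebra B \<and> CK_family \<Lambda> B s \<and>
    (\<forall>S. cstar_subalgebra B S \<and> s ` paths \<Lambda> \<subseteq> S \<longrightarrow> S = carrier B) \<and>
    (\<forall>(A :: real cstar) t. cstar_algebra A \<and> CK_family \<Lambda> A t \<longrightarrow>
      (\<exists>\<pi>. cstar_hom B A \<pi> \<and> (\<forall>\<eta> \<in> paths \<Lambda>. \<pi> (s \<eta>) = t \<eta>)))"

subsection \<open>The gauge action\<close>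

text \<open>The product on \<^typ>\<open>complex ^ 'k\<close> is coordinatewise, so it is the group law of the torus.\<close>

definition torus :: "(complex ^ 'k::finite) set" where
  "torus = {z. \<forall>i. cmod (z $ i) = 1}"

definition torus_power :: "complex ^ 'k \<Rightarrow> nat ^ 'k::finite \<Rightarrow> complex" where
  "torus_power z n = (\<Prod>i\<in>UNIV. z $ i ^ n $ i)"

definition gauge_action ::
    "('a, 'k::finite) kgraph \<Rightarrow> 'b cstar \<Rightarrow> ('a \<Rightarrow> 'b) \<Rightarrow> (complex ^ 'k \<Rightarrow> 'b \<Rightarrow> 'b) \<Rightarrow> bool" where
  "gauge_action \<Lambda> B s \<gamma> \<longleftrightarrow>
    (\<forall>z \<in> torus. cstar_hom B B (\<gamma> z)) \<and>
    (\<forall>a \<in> carrier B. \<gamma> 1 a = a) \<and>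
    (\<forall>z \<in> torus. \<forall>w \<in> torus. \<forall>a \<in> carrier B. \<gamma> (z * w) a = \<gamma> z (\<gamma> w a)) \<and>
    (\<forall>a \<in> carrier B. continuous_map (top_of_set torus) (cstar_topology B) (\<lambda>z. \<gamma> z a)) \<and>
    (\<forall>z \<in> torus. \<forall>\<eta> \<in> paths \<Lambda>. \<gamma> z (s \<eta>) = torus_power z (deg \<Lambda> \<eta>) \<odot>\<^bsub>B\<^esub> s \<eta>)"

definition fixed_algebra :: "'b cstar \<Rightarrow> (complex ^ 'k::finite \<Rightarrow> 'b \<Rightarrow> 'b) \<Rightarrow> 'b set" where
  "fixed_algebra B \<gamma> = {a \<in> carrier B. \<forall>z \<in> torus. \<gamma> z a = a}"


section \<open>The universal property for arbitrary carrier types\<close>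

lemma complex_ring_simps [simp]:
  "carrier complex_ring = UNIV" "mult complex_ring = (*)" "one complex_ring = 1"
  "zero complex_ring = 0" "add complex_ring = (+)"
  by (simp_all add: complex_ring_def)

context cstar_algebra
begin

lemma scale_closed: "x \<in> carrier A \<Longrightarrow> c \<odot>\<^bsub>A\<^esub> x \<in> carrier A"
  using smult_closed by simp

lemma scale_zero: "x \<in> carrier A \<Longrightarrow> 0 \<odot>\<^bsub>A\<^esub> x = \<zero>\<^bsub>A\<^esub>"
  using smult_l_null by simp

lemma scale_minus: 
  assumes "x \<in> carrier A" shows "\<ominus>\<^bsub>A\<^esub> x = (-1) \<odot>\<^bsub>A\<^esub> x"
proof -
  have "(-1) \<odot>\<^bsub>A\<^esub> x \<oplus>\<^bsub>A\<^esub> x = ((-1) + 1) \<odot>\<^bsub>A\<^esub> x"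
    using smult_l_distr[of "-1" 1 x] smult_one[of x] assms by simp
  then show ?thesis
    using assms by (intro minus_equality) (auto simp: scale_zero scale_closed)
qed

lemma nrm_minus: "x \<in> carrier A \<Longrightarrow> nrm A (\<ominus>\<^bsub>A\<^esub> x) = nrm A x"
  by (simp add: scale_minus nrm_smult)

lemma dist_eq: "\<lbrakk>x \<in> carrier A; y \<in> carrier A\<rbrakk> \<Longrightarrow> cstar_dist A x y = nrm A (x \<ominus>\<^bsub>A\<^esub> y)"
  by (simp add: cstar_dist_def)

lemma nrm_minus_commute: 
  assumes "x \<in> carrier A" "y \<in> carrier A" shows "nrm A (x \<ominus>\<^bsub>A\<^esub> y) = nrm A (y \<ominus>\<^bsub>A\<^esub> x)"
proof -
  have "y \<ominus>\<^bsub>A\<^esub> x = \<ominus>\<^bsub>A\<^esub> (x \<ominus>\<^bsub>A\<^esub> y)"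
    using assms by (simp add: a_minus_def minus_add a_comm)
  then show ?thesis using assms nrm_minus[of "x \<ominus>\<^bsub>A\<^esub> y"] by simp
qed

lemma minus_split:
  assumes "x \<in> carrier A" "y \<in> carrier A" "z \<in> carrier A"
  shows "x \<ominus>\<^bsub>A\<^esub> z = (x \<ominus>\<^bsub>A\<^esub> y) \<oplus>\<^bsub>A\<^esub> (y \<ominus>\<^bsub>A\<^esub> z)"
proof -
  have "(x \<ominus>\<^bsub>A\<^esub> y) \<oplus>\<^bsub>A\<^esub> (y \<ominus>\<^bsub>A\<^esub> z) = x \<oplus>\<^bsub>A\<^esub> (\<ominus>\<^bsub>A\<^esub> y \<oplus>\<^bsub>A\<^esub> (y \<oplus>\<^bsub>A\<^esub> \<ominus>\<^bsub>A\<^esub> z))"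
    using assms by (simp add: a_minus_def a_assoc)
  also have "\<ominus>\<^bsub>A\<^esub> y \<oplus>\<^bsub>A\<^esub> (y \<oplus>\<^bsub>A\<^esub> \<ominus>\<^bsub>A\<^esub> z) = \<ominus>\<^bsub>A\<^esub> z"
    using assms by (simp add: r_neg1)
  finally show ?thesis by (simp add: a_minus_def)
qed

lemma Metric_space: "Metric_space (carrier A) (cstar_dist A)"
proof
  show "0 \<le> cstar_dist A x y" for x y by (simp add: cstar_dist_def nrm_nonneg)
  show "cstar_dist A x y = cstar_dist A y x" for x y
    by (simp add: cstar_dist_def nrm_minus_commute)
  show "x \<in> carrier A \<Longrightarrow> y \<in> carrier A \<Longrightarrow> (cstar_dist A x y = 0) = (x = y)" for x y
    by (simp add: cstar_dist_def nrm_eq_0) (metis a_minus_def a_inv_closed minus_equality minus_minus r_neg)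
  show "cstar_dist A x z \<le> cstar_dist A x y + cstar_dist A y z"
    if "x \<in> carrier A" "y \<in> carrier A" "z \<in> carrier A" for x y z
    using that nrm_add[of "x \<ominus>\<^bsub>A\<^esub> y" "y \<ominus>\<^bsub>A\<^esub> z"] by (simp add: dist_eq flip: minus_split)
qed

lemma closure_iff:
  assumes "D \<subseteq> carrier A"
  shows "x \<in> cstar_topology A closure_of D \<longleftrightarrow>
    x \<in> carrier A \<and> (\<forall>r>0. \<exists>y\<in>D. nrm A (x \<ominus>\<^bsub>A\<^esub> y) < r)"
proof -
  interpret Metric_space "carrier A" "cstar_dist A" by (rule Metric_space)
  show ?thesis using assms by (fastforce simp: metric_closure_of dist_eq subset_eq)
qed

lemma nrm_zero: "nrm A \<zero>\<^bsub>A\<^esub> = 0" by (simp add: nrm_eq_0)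

lemma adj_zero: "adj A \<zero>\<^bsub>A\<^esub> = \<zero>\<^bsub>A\<^esub>"
  using adj_smult[of "\<zero>\<^bsub>A\<^esub>" 0] by (simp add: scale_zero adj_closed)

lemma nrm_adj: "x \<in> carrier A \<Longrightarrow> nrm A (adj A x) = nrm A x"
proof -
  have le: "nrm A x \<le> nrm A (adj A x)" if x: "x \<in> carrier A" for x
  proof (cases "nrm A x = 0")
    case True then show ?thesis using x by (simp add: nrm_nonneg adj_closed)
  next
    case False
    have "(nrm A x)\<^sup>2 \<le> nrm A (adj A x) * nrm A x"
      using x nrm_mult[of "adj A x" x] by (simp add: nrm_adj_mult adj_closed)
    then show ?thesis using False x nrm_nonneg[of x] by (simp add: power2_eq_square)
  qed
  assume "x \<in> carrier A" then show ?thesis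
    using le[of x] le[of "adj A x"] by (simp add: adj_adj adj_closed)
qed

lemma adj_minus: "\<lbrakk>x \<in> carrier A; y \<in> carrier A\<rbrakk> \<Longrightarrow> adj A (x \<ominus>\<^bsub>A\<^esub> y) = adj A x \<ominus>\<^bsub>A\<^esub> adj A y"
  by (simp add: a_minus_def scale_minus adj_add adj_smult scale_closed adj_closed)

lemma minus_add_add:
  assumes "x \<in> carrier A" "y \<in> carrier A" "x' \<in> carrier A" "y' \<in> carrier A"
  shows "(x \<oplus>\<^bsub>A\<^esub> y) \<ominus>\<^bsub>A\<^esub> (x' \<oplus>\<^bsub>A\<^esub> y') = (x \<ominus>\<^bsub>A\<^esub> x') \<oplus>\<^bsub>A\<^esub> (y \<ominus>\<^bsub>A\<^esub> y')"
  using assms by (simp add: a_minus_def minus_add a_ac)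

lemma minus_mult_mult:
  assumes "x \<in> carrier A" "y \<in> carrier A" "x' \<in> carrier A" "y' \<in> carrier A"
  shows "(x \<otimes>\<^bsub>A\<^esub> y) \<ominus>\<^bsub>A\<^esub> (x' \<otimes>\<^bsub>A\<^esub> y') = (x \<otimes>\<^bsub>A\<^esub> (y \<ominus>\<^bsub>A\<^esub> y')) \<oplus>\<^bsub>A\<^esub> ((x \<ominus>\<^bsub>A\<^esub> x') \<otimes>\<^bsub>A\<^esub> y')"
proof -
  have "x \<otimes>\<^bsub>A\<^esub> (y \<ominus>\<^bsub>A\<^esub> y') = (x \<otimes>\<^bsub>A\<^esub> y) \<ominus>\<^bsub>A\<^esub> (x \<otimes>\<^bsub>A\<^esub> y')"
    using assms by (simp add: a_minus_def scale_minus distrib_left smult_mult_right scale_closed mult_closed)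
  moreover have "(x \<ominus>\<^bsub>A\<^esub> x') \<otimes>\<^bsub>A\<^esub> y' = (x \<otimes>\<^bsub>A\<^esub> y') \<ominus>\<^bsub>A\<^esub> (x' \<otimes>\<^bsub>A\<^esub> y')"
    using assms by (simp add: a_minus_def scale_minus distrib_right smult_mult_left scale_closed mult_closed)
  ultimately show ?thesis using assms by (simp add: mult_closed flip: minus_split)
qed

lemma minus_scale_scale:
  assumes "x \<in> carrier A" "x' \<in> carrier A"
  shows "(c \<odot>\<^bsub>A\<^esub> x) \<ominus>\<^bsub>A\<^esub> (c' \<odot>\<^bsub>A\<^esub> x') = (c \<odot>\<^bsub>A\<^esub> (x \<ominus>\<^bsub>A\<^esub> x')) \<oplus>\<^bsub>A\<^esub> ((c - c') \<odot>\<^bsub>A\<^esub> x')"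
proof -
  have "c \<odot>\<^bsub>A\<^esub> (x \<ominus>\<^bsub>A\<^esub> x') = (c \<odot>\<^bsub>A\<^esub> x) \<ominus>\<^bsub>A\<^esub> (c \<odot>\<^bsub>A\<^esub> x')"
    using assms smult_r_distr[of c x "(-1) \<odot>\<^bsub>A\<^esub> x'"] smult_assoc1[of c "-1" x'] smult_assoc1[of "-1" c x']
    by (simp add: a_minus_def scale_minus scale_closed)
  moreover have "(c - c') \<odot>\<^bsub>A\<^esub> x' = (c \<odot>\<^bsub>A\<^esub> x') \<ominus>\<^bsub>A\<^esub> (c' \<odot>\<^bsub>A\<^esub> x')"
    using assms smult_l_distr[of c "-c'" x'] smult_assoc1[of "-1" c' x']
    by (simp add: a_minus_def scale_minus scale_closed)
  ultimately show ?thesis using assms by (simp add: scale_closed flip: minus_split)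
qed

end

text \<open>The closed *-subalgebra \<open>S\<close> of \<open>A\<close>, transported along the injection \<open>f\<close>.\<close>

definition cstar_copy :: "('b \<Rightarrow> 'c) \<Rightarrow> 'b set \<Rightarrow> 'b cstar \<Rightarrow> 'c cstar" where
  "cstar_copy f S A =
    (let g = inv_into S f in
     \<lparr>carrier = f ` S,
      mult = (\<lambda>x y. f (g x \<otimes>\<^bsub>A\<^esub> g y)),
      one = undefined,
      zero = f \<zero>\<^bsub>A\<^esub>,
      add = (\<lambda>x y. f (g x \<oplus>\<^bsub>A\<^esub> g y)),
      smult = (\<lambda>c x. f (c \<odot>\<^bsub>A\<^esub> g x)),
      adj = (\<lambda>x. f (adj A (g x))),
      nrm = (\<lambda>x. nrm A (g x))\<rparr>)"

locale cstar_copying = cstar_algebra A for A :: "'b cstar" +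
  fixes S :: "'b set" and f :: "'b \<Rightarrow> 'c"
  assumes sub: "cstar_subalgebra A S" and inj: "inj_on f S"
begin

abbreviation "A' \<equiv> cstar_copy f S A"

lemma S_carrier: "x \<in> S \<Longrightarrow> x \<in> carrier A"
  and S_zero: "\<zero>\<^bsub>A\<^esub> \<in> S"
  and S_add: "\<lbrakk>x \<in> S; y \<in> S\<rbrakk> \<Longrightarrow> x \<oplus>\<^bsub>A\<^esub> y \<in> S"
  and S_scale: "x \<in> S \<Longrightarrow> c \<odot>\<^bsub>A\<^esub> x \<in> S"
  and S_mult: "\<lbrakk>x \<in> S; y \<in> S\<rbrakk> \<Longrightarrow> x \<otimes>\<^bsub>A\<^esub> y \<in> S"
  and S_adj: "x \<in> S \<Longrightarrow> adj A x \<in> S"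
  and S_closed: "closedin (cstar_topology A) S"
  using sub by (auto simp: cstar_subalgebra_def closed_subspace_def)

lemma S_uminus: "x \<in> S \<Longrightarrow> \<ominus>\<^bsub>A\<^esub> x \<in> S"
  by (simp add: scale_minus S_carrier S_scale)

lemmas S_simps = S_carrier S_zero S_add S_scale S_mult S_adj S_uminus

lemma copy_simps:
  "carrier A' = f ` S"
  "zero A' = f \<zero>\<^bsub>A\<^esub>"
  "\<lbrakk>x \<in> S; y \<in> S\<rbrakk> \<Longrightarrow> f x \<oplus>\<^bsub>A'\<^esub> f y = f (x \<oplus>\<^bsub>A\<^esub> y)"
  "\<lbrakk>x \<in> S; y \<in> S\<rbrakk> \<Longrightarrow> f x \<otimes>\<^bsub>A'\<^esub> f y = f (x \<otimes>\<^bsub>A\<^esub> y)"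
  "x \<in> S \<Longrightarrow> c \<odot>\<^bsub>A'\<^esub> f x = f (c \<odot>\<^bsub>A\<^esub> x)"
  "x \<in> S \<Longrightarrow> adj A' (f x) = f (adj A x)"
  "x \<in> S \<Longrightarrow> nrm A' (f x) = nrm A x"
  using inj by (simp_all add: cstar_copy_def Let_def inv_into_f_f)

lemma f_eq: "\<lbrakk>x \<in> S; y \<in> S\<rbrakk> \<Longrightarrow> f x = f y \<longleftrightarrow> x = y"
  using inj by (auto dest: inj_onD)

lemma abelian_group_copy: "abelian_group A'"
proof (rule abelian_groupI)
  show "\<exists>y\<in>carrier A'. y \<oplus>\<^bsub>A'\<^esub> x = \<zero>\<^bsub>A'\<^esub>" if "x \<in> carrier A'" for x
  proof -
    from that obtain a where a: "a \<in> S" "x = f a" by (auto simp: copy_simps)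
    have "f (\<ominus>\<^bsub>A\<^esub> a) \<oplus>\<^bsub>A'\<^esub> x = \<zero>\<^bsub>A'\<^esub>"
      using a by (simp add: copy_simps S_simps l_neg)
    then show ?thesis using a S_uminus by (auto simp: copy_simps)
  qed
qed (auto simp: copy_simps S_simps a_ac)

lemma minus_copy: "\<lbrakk>x \<in> S; y \<in> S\<rbrakk> \<Longrightarrow> f x \<ominus>\<^bsub>A'\<^esub> f y = f (x \<ominus>\<^bsub>A\<^esub> y)"
proof -
  interpret A': abelian_group A' by (rule abelian_group_copy)
  assume xy: "x \<in> S" "y \<in> S"
  have "\<ominus>\<^bsub>A'\<^esub> f y = f (\<ominus>\<^bsub>A\<^esub> y)"
    by (rule A'.minus_equality) (use xy in \<open>auto simp: copy_simps S_simps l_neg\<close>)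
  then show ?thesis using xy by (simp add: a_minus_def copy_simps S_simps)
qed

lemma dist_copy: "\<lbrakk>x \<in> S; y \<in> S\<rbrakk> \<Longrightarrow> cstar_dist A' (f x) (f y) = cstar_dist A x y"
  by (simp add: cstar_dist_def copy_simps(1) minus_copy S_carrier)
    (simp add: a_minus_def copy_simps S_simps)

lemma cstar_algebra_copy: "cstar_algebra A'"
proof -
  have mod: "module complex_ring A'"
    by (rule moduleI)
      (auto simp: abelian_group_copy copy_simps S_simps smult_l_distr[simplified]
        smult_r_distr[simplified] smult_assoc1[simplified] smult_one[simplified] R.is_cring)
  interpret A': module complex_ring A' by (rule mod)
  have Met: "Metric_space (f ` S) (cstar_dist A')"
  proof -
    interpret M: Metric_space "carrier A" "cstar_dist A" by (rule Metric_space)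
    have *: "cstar_dist A' x y = 0" if "x \<notin> f ` S \<or> y \<notin> f ` S" for x y
      using that by (auto simp: cstar_dist_def copy_simps)
    show ?thesis
    proof
      show "0 \<le> cstar_dist A' x y" for x y
        using *[of x y] by (cases "x \<in> f ` S \<and> y \<in> f ` S") (auto simp: dist_copy)
      show "cstar_dist A' x y = cstar_dist A' y x" for x y
        using *[of x y] *[of y x] M.commute
        by (cases "x \<in> f ` S \<and> y \<in> f ` S") (auto simp: dist_copy)
    qed (auto simp: dist_copy f_eq S_carrier M.triangle)
  qed
  show ?thesis
  proof
    interpret M: Metric_space "carrier A" "cstar_dist A" by (rule Metric_space)
    interpret M': Metric_space "f ` S" "cstar_dist A'" by (rule Met)
    have "\<exists>x. limitin M'.mtopology \<sigma> x sequentially" if \<sigma>: "M'.MCauchy \<sigma>" for \<sigma>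
    proof -
      define \<tau> where "\<tau> = (\<lambda>n. inv_into S f (\<sigma> n))"
      have \<sigma>S: "\<sigma> n \<in> f ` S" for n using \<sigma> by (auto simp: M'.MCauchy_def)
      have \<tau>S: "\<tau> n \<in> S" "f (\<tau> n) = \<sigma> n" for n
        using \<sigma>S[of n] by (simp_all add: \<tau>_def inv_into_into f_inv_into_f)
      have d: "cstar_dist A' (\<sigma> m) (\<sigma> n) = cstar_dist A (\<tau> m) (\<tau> n)" for m n
        using dist_copy[of "\<tau> m" "\<tau> n"] \<tau>S by simp
      have "M.MCauchy \<tau>" using \<sigma> \<tau>S S_carrier by (auto simp: M.MCauchy_def M'.MCauchy_def d)
      then obtain x where x: "limitin M.mtopology \<tau> x sequentially"
        using complete by (auto simp: M.mcomplete_def)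
      have xS: "x \<in> S"
        using limitin_closedin[OF x S_closed] \<tau>S by simp
      have "cstar_dist A' (\<sigma> n) (f x) = cstar_dist A (\<tau> n) x" for n
        using dist_copy[of "\<tau> n" x] \<tau>S xS by simp
      then have "limitin M'.mtopology \<sigma> (f x) sequentially"
        using x xS \<sigma>S by (auto simp: M.limitin_metric M'.limitin_metric elim!: eventually_mono)
      then show ?thesis ..
    qed
    then show "Metric_space.mcomplete (carrier A') (cstar_dist A')"
      by (simp add: M'.mcomplete_def copy_simps)
  qed (auto simp: copy_simps S_simps mult_assoc distrib_left distrib_right smult_mult_left
     smult_mult_right adj_adj adj_add adj_smult adj_mult nrm_nonneg nrm_eq_0 f_eq nrm_add
     nrm_smult nrm_mult nrm_adj_mult)
qed

lemma hom_copy: "cstar_hom A' A (inv_into S f)"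
  using inj by (auto simp: cstar_hom_def copy_simps S_simps inv_into_f_f)

lemma finsum_copy:
  assumes "\<And>i. i \<in> F \<Longrightarrow> h i \<in> S"
  shows "finsum A' (\<lambda>i. f (h i)) F = f (finsum A h F) \<and> finsum A h F \<in> S"
proof -
  interpret A': abelian_group A' by (rule abelian_group_copy)
  show ?thesis
  proof (cases "finite F")
    case True
    then show ?thesis using assms
    proof (induction F)
      case (insert i F)
      then have "(\<lambda>i. f (h i)) \<in> F \<rightarrow> carrier A'" "h \<in> F \<rightarrow> carrier A"
        by (auto simp: copy_simps S_simps)
      with insert show ?case
        by (simp add: A'.finsum_insert finsum_insert copy_simps S_simps)
    qed (simp add: copy_simps S_simps)
  qed (simp add: copy_simps S_simps)
qed

lemma CK_family_copy:
  assumes CK: "CK_family \<Lambda> A t" and t: "t ` paths \<Lambda> \<subseteq> S"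
  shows "CK_family \<Lambda> A' (\<lambda>\<eta>. f (t \<eta>))"
proof -
  have tS: "t \<eta> \<in> S" if "\<eta> \<in> paths \<Lambda>" for \<eta> using t that by blast
  have vS: "t v \<in> S" if "v \<in> vertices \<Lambda>" for v
    using that by (auto simp: vertices_def deg_paths_def intro: tS)
  have "f (t v) = (\<Oplus>\<^bsub>A'\<^esub>\<eta> \<in> from_range \<Lambda> v (le_paths \<Lambda> n). f (t \<eta>) \<otimes>\<^bsub>A'\<^esub> adj A' (f (t \<eta>)))"
    if v: "v \<in> vertices \<Lambda>" for v n
  proof -
    let ?F = "from_range \<Lambda> v (le_paths \<Lambda> n)"
    interpret A': abelian_group A' by (rule abelian_group_copy)
    have F: "t \<eta> \<in> S" if "\<eta> \<in> ?F" for \<eta>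
      using that tS by (auto simp: from_range_def le_paths_def)
    have "(\<Oplus>\<^bsub>A'\<^esub>\<eta> \<in> ?F. f (t \<eta>) \<otimes>\<^bsub>A'\<^esub> adj A' (f (t \<eta>))) =
        (\<Oplus>\<^bsub>A'\<^esub>\<eta> \<in> ?F. f (t \<eta> \<otimes>\<^bsub>A\<^esub> adj A (t \<eta>)))"
      by (rule A'.finsum_cong') (auto simp: copy_simps S_simps F)
    also have "\<dots> = f (\<Oplus>\<^bsub>A\<^esub>\<eta> \<in> ?F. t \<eta> \<otimes>\<^bsub>A\<^esub> adj A (t \<eta>))"
      using finsum_copy[of ?F "\<lambda>\<eta>. t \<eta> \<otimes>\<^bsub>A\<^esub> adj A (t \<eta>)"] F by (simp add: S_simps)
    also have "(\<Oplus>\<^bsub>A\<^esub>\<eta> \<in> ?F. t \<eta> \<otimes>\<^bsub>A\<^esub> adj A (t \<eta>)) = t v"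
      using CK v by (auto simp: CK_family_def)
    finally show ?thesis ..
  qed
  moreover have "\<forall>\<eta> \<in> paths \<Lambda>. \<forall>\<mu> \<in> paths \<Lambda>. src \<Lambda> \<eta> = rng \<Lambda> \<mu> \<longrightarrow>
      f (t \<eta>) \<otimes>\<^bsub>A'\<^esub> f (t \<mu>) = f (t (cmp \<Lambda> \<eta> \<mu>))"
    using CK by (simp add: CK_family_def copy_simps tS)
  moreover have "\<forall>\<mu> \<in> paths \<Lambda>. adj A' (f (t \<mu>)) \<otimes>\<^bsub>A'\<^esub> f (t \<mu>) = f (t (src \<Lambda> \<mu>))"
    using CK by (simp add: CK_family_def copy_simps tS S_simps)
  ultimately show ?thesis
    using CK by (simp add: CK_family_def copy_simps tS vS S_simps)
qed

end

context cstar_algebra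
begin

lemma countable_subset_subalgebra:
  assumes E: "countable E" "E \<subseteq> carrier A"
  shows "\<exists>S. cstar_subalgebra A S \<and> E \<subseteq> S \<and> S \<lesssim> (UNIV :: real set)"
proof -
  obtain Q :: "complex set" where Q: "countable Q" and dense: "\<And>X. open X \<Longrightarrow> X \<noteq> {} \<Longrightarrow> \<exists>q\<in>Q. q \<in> X"
    using countable_dense_exists by blast
  define step where "step = (\<lambda>S. S \<union> (\<lambda>(x, y). x \<oplus>\<^bsub>A\<^esub> y) ` (S \<times> S) \<union> (\<lambda>(x, y). x \<otimes>\<^bsub>A\<^esub> y) ` (S \<times> S)
    \<union> adj A ` S \<union> (\<lambda>(c, x). c \<odot>\<^bsub>A\<^esub> x) ` (Q \<times> S))"
  define T where "T = (\<lambda>n. (step ^^ n) (insert \<zero>\<^bsub>A\<^esub> E))"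
  have T_Suc: "T (Suc n) = step (T n)" for n by (simp add: T_def)
  have T_0: "T 0 = insert \<zero>\<^bsub>A\<^esub> E" by (simp add: T_def)
  have T_countable: "countable (T n)" for n
    by (induction n) (auto simp: T_0 T_Suc E step_def Q)
  have T_carrier: "T n \<subseteq> carrier A" for n
  proof (induction n)
    case (Suc n)
    then have "x \<in> carrier A" if "x \<in> T n" for x using that by blast
    then show ?case
      by (auto simp: T_Suc step_def intro: mult_closed adj_closed scale_closed)
  qed (use E in \<open>simp add: T_0\<close>)
  have T_le: "T m \<subseteq> T n" if "m \<le> n" for m n
    by (rule lift_Suc_mono_le[OF _ that]) (auto simp: T_Suc step_def)
  define D where "D = (\<Union>n. T n)"
  have D: "countable D" "D \<subseteq> carrier A" "E \<subseteq> D" "\<zero>\<^bsub>A\<^esub> \<in> D"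
    using T_countable T_carrier T_0 by (auto simp: D_def)
  have D_pair: "\<exists>n. x \<in> T n \<and> y \<in> T n" if xy: "x \<in> D" "y \<in> D" for x y
  proof -
    obtain m n where "x \<in> T m" "y \<in> T n" using xy unfolding D_def by blast
    then have "x \<in> T (max m n)" "y \<in> T (max m n)"
      using T_le[of m "max m n"] T_le[of n "max m n"] by auto
    then show ?thesis by blast
  qed
  have D_add: "x \<oplus>\<^bsub>A\<^esub> y \<in> D" and D_mult: "x \<otimes>\<^bsub>A\<^esub> y \<in> D" if xy: "x \<in> D" "y \<in> D" for x y
  proof -
    obtain n where "x \<in> T n" "y \<in> T n" using D_pair[OF xy] by blast
    then have "x \<oplus>\<^bsub>A\<^esub> y \<in> T (Suc n)" "x \<otimes>\<^bsub>A\<^esub> y \<in> T (Suc n)"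
      by (auto simp: T_Suc step_def)
    then show "x \<oplus>\<^bsub>A\<^esub> y \<in> D" "x \<otimes>\<^bsub>A\<^esub> y \<in> D" unfolding D_def by blast+
  qed
  have D_adj: "adj A x \<in> D" if x: "x \<in> D" for x
  proof -
    obtain n where "x \<in> T n" using D_pair[OF x x] by blast
    then have "adj A x \<in> T (Suc n)" by (auto simp: T_Suc step_def)
    then show ?thesis unfolding D_def by blast
  qed
  have D_scale: "c \<odot>\<^bsub>A\<^esub> x \<in> D" if x: "x \<in> D" and c: "c \<in> Q" for x c
  proof -
    obtain n where "x \<in> T n" using D_pair[OF x x] by blast
    then have "c \<odot>\<^bsub>A\<^esub> x \<in> T (Suc n)" using c by (auto simp: T_Suc step_def)
    then show ?thesis unfolding D_def by blast
  qed
  define S where "S = cstar_topology A closure_of D"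
  note S_iff = closure_iff[OF D(2), folded S_def]
  have S_carrier: "x \<in> carrier A" if "x \<in> S" for x using that S_iff by blast
  have S_near: "\<exists>y\<in>D. y \<in> carrier A \<and> nrm A (x \<ominus>\<^bsub>A\<^esub> y) < r" if "x \<in> S" "r > 0" for x r
    using that S_iff D(2) by blast
  have DS: "D \<subseteq> S"
  proof
    fix x assume x: "x \<in> D"
    then have "x \<in> carrier A" using D by blast
    moreover from this have "x \<ominus>\<^bsub>A\<^esub> x = \<zero>\<^bsub>A\<^esub>" by (simp add: a_minus_def r_neg)
    ultimately show "x \<in> S" using x nrm_zero unfolding S_iff by (metis)
  qed
  interpret M: Metric_space "carrier A" "cstar_dist A" by (rule Metric_space)
  have "cstar_subalgebra A S"
    unfolding cstar_subalgebra_def closed_subspace_def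
  proof (intro conjI ballI allI)
    show "S \<subseteq> carrier A" using S_carrier by blast
    show "\<zero>\<^bsub>A\<^esub> \<in> S" using D DS by blast
    show "closedin (cstar_topology A) S" unfolding S_def by simp
    fix x assume x: "x \<in> S"
    note xc = S_carrier[OF x]
    show "adj A x \<in> S" unfolding S_iff
    proof (intro conjI allI impI)
      fix r :: real assume "r > 0"
      then obtain x' where x': "x' \<in> D" "x' \<in> carrier A" "nrm A (x \<ominus>\<^bsub>A\<^esub> x') < r" using S_near x by blast
      have "nrm A (adj A x \<ominus>\<^bsub>A\<^esub> adj A x') = nrm A (x \<ominus>\<^bsub>A\<^esub> x')"
        using x' xc nrm_adj[of "x \<ominus>\<^bsub>A\<^esub> x'"] by (simp add: adj_minus)
      then show "\<exists>y\<in>D. nrm A (adj A x \<ominus>\<^bsub>A\<^esub> y) < r" using x' D_adj by (intro bexI[of _ "adj A x'"]) auto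
    qed (simp add: adj_closed xc)
    show "c \<odot>\<^bsub>A\<^esub> x \<in> S" for c unfolding S_iff
    proof (intro conjI allI impI)
      fix r :: real assume r: "r > 0"
      define e where "e = r / (2 * (cmod c + 1))"
      have e: "e > 0" "cmod c * e < r / 2"
        using r by (simp_all add: e_def field_simps add_pos_nonneg add_nonneg_pos)
      obtain x' where x': "x' \<in> D" "x' \<in> carrier A" "nrm A (x \<ominus>\<^bsub>A\<^esub> x') < e" using S_near x e by blast
      define e' where "e' = r / (2 * (nrm A x' + 1))"
      have nx: "nrm A x' \<ge> 0" using x' nrm_nonneg by blast
      have e': "e' > 0" "e' * nrm A x' < r / 2"
        using r nx by (simp_all add: e'_def field_simps add_pos_nonneg add_nonneg_pos)
      obtain q where q: "q \<in> Q" "q \<in> ball c e'" using dense[of "ball c e'"] e' by auto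
      have cq: "cmod (c - q) < e'" using q by (simp add: dist_norm)
      have "nrm A (c \<odot>\<^bsub>A\<^esub> x \<ominus>\<^bsub>A\<^esub> q \<odot>\<^bsub>A\<^esub> x') \<le> cmod c * nrm A (x \<ominus>\<^bsub>A\<^esub> x') + cmod (c - q) * nrm A x'"
        using x' xc nrm_add[of "c \<odot>\<^bsub>A\<^esub> (x \<ominus>\<^bsub>A\<^esub> x')" "(c - q) \<odot>\<^bsub>A\<^esub> x'"]
        by (simp add: minus_scale_scale nrm_smult scale_closed)
      also have "\<dots> \<le> cmod c * e + e' * nrm A x'"
        using x' cq nx e e' by (intro add_mono mult_mono) (auto simp: nrm_nonneg xc)
      also have "\<dots> < r" using e e' by linarith
      finally show "\<exists>y\<in>D. nrm A (c \<odot>\<^bsub>A\<^esub> x \<ominus>\<^bsub>A\<^esub> y) < r" using x' q D_scale by blast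
    qed (simp add: scale_closed xc)
    fix y assume y: "y \<in> S"
    note yc = S_carrier[OF y]
    show "x \<oplus>\<^bsub>A\<^esub> y \<in> S" unfolding S_iff
    proof (intro conjI allI impI)
      fix r :: real assume r: "r > 0"
      obtain x' where x': "x' \<in> D" "x' \<in> carrier A" "nrm A (x \<ominus>\<^bsub>A\<^esub> x') < r / 2"
        using S_near[OF x, of "r/2"] r by auto
      obtain y' where y': "y' \<in> D" "y' \<in> carrier A" "nrm A (y \<ominus>\<^bsub>A\<^esub> y') < r / 2"
        using S_near[OF y, of "r/2"] r by auto
      have "nrm A ((x \<oplus>\<^bsub>A\<^esub> y) \<ominus>\<^bsub>A\<^esub> (x' \<oplus>\<^bsub>A\<^esub> y')) \<le> nrm A (x \<ominus>\<^bsub>A\<^esub> x') + nrm A (y \<ominus>\<^bsub>A\<^esub> y')"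
        using x' y' xc yc nrm_add[of "x \<ominus>\<^bsub>A\<^esub> x'" "y \<ominus>\<^bsub>A\<^esub> y'"] by (simp add: minus_add_add)
      then have "nrm A ((x \<oplus>\<^bsub>A\<^esub> y) \<ominus>\<^bsub>A\<^esub> (x' \<oplus>\<^bsub>A\<^esub> y')) < r" using x' y' by linarith
      then show "\<exists>z\<in>D. nrm A (x \<oplus>\<^bsub>A\<^esub> y \<ominus>\<^bsub>A\<^esub> z) < r" using x' y' D_add by blast
    qed (simp add: xc yc)
    show "x \<otimes>\<^bsub>A\<^esub> y \<in> S" unfolding S_iff
    proof (intro conjI allI impI)
      fix r :: real assume r: "r > 0"
      have nx: "nrm A x \<ge> 0" using xc nrm_nonneg by blast
      define e where "e = r / (2 * (nrm A x + 1))"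
      have e: "e > 0" "nrm A x * e < r / 2"
        using r nx by (simp_all add: e_def field_simps add_pos_nonneg add_nonneg_pos)
      obtain y' where y': "y' \<in> D" "y' \<in> carrier A" "nrm A (y \<ominus>\<^bsub>A\<^esub> y') < e"
        using S_near[OF y] e by auto
      have ny: "nrm A y' \<ge> 0" using y' nrm_nonneg by blast
      define e' where "e' = r / (2 * (nrm A y' + 1))"
      have e': "e' > 0" "e' * nrm A y' < r / 2"
        using r ny by (simp_all add: e'_def field_simps add_pos_nonneg add_nonneg_pos)
      obtain x' where x': "x' \<in> D" "x' \<in> carrier A" "nrm A (x \<ominus>\<^bsub>A\<^esub> x') < e'"
        using S_near[OF x] e' by auto
      have "nrm A ((x \<otimes>\<^bsub>A\<^esub> y) \<ominus>\<^bsub>A\<^esub> (x' \<otimes>\<^bsub>A\<^esub> y')) \<le>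
          nrm A (x \<otimes>\<^bsub>A\<^esub> (y \<ominus>\<^bsub>A\<^esub> y')) + nrm A ((x \<ominus>\<^bsub>A\<^esub> x') \<otimes>\<^bsub>A\<^esub> y')"
        using x' y' xc yc nrm_add[of "x \<otimes>\<^bsub>A\<^esub> (y \<ominus>\<^bsub>A\<^esub> y')" "(x \<ominus>\<^bsub>A\<^esub> x') \<otimes>\<^bsub>A\<^esub> y'"]
        by (simp add: minus_mult_mult mult_closed)
      also have "\<dots> \<le> nrm A x * nrm A (y \<ominus>\<^bsub>A\<^esub> y') + nrm A (x \<ominus>\<^bsub>A\<^esub> x') * nrm A y'"
        using x' y' xc yc by (intro add_mono nrm_mult) auto
      also have "\<dots> \<le> nrm A x * e + e' * nrm A y'"
        using x' y' nx ny e e' by (intro add_mono mult_mono) (auto simp: nrm_nonneg xc yc)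
      also have "\<dots> < r" using e e' by linarith
      finally show "\<exists>z\<in>D. nrm A (x \<otimes>\<^bsub>A\<^esub> y \<ominus>\<^bsub>A\<^esub> z) < r" using x' y' D_mult by blast
    qed (simp add: xc yc mult_closed)
  qed
  moreover have "S \<lesssim> (UNIV :: real set)"
  proof -
    define N where "N = (\<lambda>x. {p. nrm A (x \<ominus>\<^bsub>A\<^esub> from_nat_into D (snd (prod_decode p)))
        < inverse (real (Suc (fst (prod_decode p))))})"
    have "inj_on N S"
    proof (rule inj_onI)
      fix x y assume x: "x \<in> S" and y: "y \<in> S" and eq: "N x = N y"
      note xy = S_carrier[OF x] S_carrier[OF y]
      have le: "nrm A (x \<ominus>\<^bsub>A\<^esub> y) \<le> 2 * inverse (real (Suc m))" for m
      proof -
        obtain d where d: "d \<in> D" "d \<in> carrier A" "nrm A (x \<ominus>\<^bsub>A\<^esub> d) < inverse (real (Suc m))"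
          using S_near[OF x, of "inverse (real (Suc m))"] by auto
        obtain n where n: "from_nat_into D n = d"
          using from_nat_into_surj[OF D(1)] d by blast
        have "prod_encode (m, n) \<in> N x" using d n by (simp add: N_def)
        then have "nrm A (y \<ominus>\<^bsub>A\<^esub> d) < inverse (real (Suc m))"
          using n unfolding eq by (simp add: N_def)
        then show ?thesis
          using d xy nrm_add[of "x \<ominus>\<^bsub>A\<^esub> d" "d \<ominus>\<^bsub>A\<^esub> y"] nrm_minus_commute[of d y]
          by (simp flip: minus_split)
      qed
      have "nrm A (x \<ominus>\<^bsub>A\<^esub> y) \<le> 0"
      proof (rule field_le_epsilon)
        fix e :: real assume "e > 0"
        then obtain m where "inverse (real (Suc m)) < e / 2"
          using reals_Archimedean[of "e / 2"] by auto
        then show "nrm A (x \<ominus>\<^bsub>A\<^esub> y) \<le> 0 + e" using le[of m] by linarith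
      qed
      then show "x = y" using xy M.zero[of x y] nrm_nonneg[of "x \<ominus>\<^bsub>A\<^esub> y"] by (simp add: dist_eq)
    qed
    then have "S \<lesssim> (UNIV :: nat set set)" unfolding lepoll_def by blast
    then show ?thesis using nat_sets_eqpoll_reals by (metis lepoll_trans2)
  qed
  ultimately show ?thesis using D DS by blast
qed

end

lemma cstar_hom_comp: "\<lbrakk>cstar_hom A B f; cstar_hom B C g\<rbrakk> \<Longrightarrow> cstar_hom A C (g \<circ> f)"
  by (auto simp: cstar_hom_def)

lemma universal_CK_algebra_hom:
  fixes A :: "'c cstar"
  assumes \<Lambda>: "kgraph \<Lambda>" and B: "universal_CK_algebra \<Lambda> B s"
    and A: "cstar_algebra A" and t: "CK_family \<Lambda> A t"
  shows "\<exists>\<pi>. cstar_hom B A \<pi> \<and> (\<forall>\<eta> \<in> paths \<Lambda>. \<pi> (s \<eta>) = t \<eta>)"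
proof -
  interpret cstar_algebra A by (rule A)
  have "countable (t ` paths \<Lambda>)" "t ` paths \<Lambda> \<subseteq> carrier A"
    using kgraph.countable_paths[OF \<Lambda>] t by (auto simp: CK_family_def)
  then obtain S where S: "cstar_subalgebra A S" "t ` paths \<Lambda> \<subseteq> S" "S \<lesssim> (UNIV :: real set)"
    using countable_subset_subalgebra by blast
  then obtain f :: "'c \<Rightarrow> real" where f: "inj_on f S" by (auto simp: lepoll_def)
  interpret cstar_copying A S f by unfold_locales (use S f in auto)
  obtain \<pi> where \<pi>: "cstar_hom B A' \<pi>" "\<forall>\<eta> \<in> paths \<Lambda>. \<pi> (s \<eta>) = f (t \<eta>)"
    using B cstar_algebra_copy CK_family_copy[OF t S(2)] unfolding universal_CK_algebra_def by blast
  have "cstar_hom B A (inv_into S f \<circ> \<pi>)" by (rule cstar_hom_comp[OF \<pi>(1) hom_copy])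
  moreover have "\<forall>\<eta> \<in> paths \<Lambda>. (inv_into S f \<circ> \<pi>) (s \<eta>) = t \<eta>"
    using \<pi> S f by (auto simp: inv_into_f_f)
  ultimately show ?thesis by blast
qed

end

theory Submission
  imports Defs
begin

text \<open>
Let \<open>I\<close> be an ideal of \<open>C*(\<Lambda>)\<close>. The vertices \<open>v\<close> with \<open>s\<^sub>v \<in> I\<close> form a set \<open>H\<close> that is hereditary and
saturated. A vertex outside \<open>H\<close> can, by saturation, be extended again and again without entering \<open>H\<close>,
and local convexity makes the limit a boundary path. If \<open>\<Lambda>\<close> is cofinal, a vertex of \<open>H\<close> connects
to this path, and heredity puts a vertex of the path into \<open>H\<close>, which is absurd. So an ideal that contains
one vertex projection contains all of them and is everything: this is \<open>cofinal_ideal\<close>.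

Conversely, let a boundary path \<open>x\<close> and a vertex \<open>v\<close> violate cofinality. The vertices that do not connect to
\<open>x\<close> form a hereditary set \<open>H\<close> containing \<open>v\<close>. The paths of \<open>\<Lambda>\<close> act by prepending on the boundary paths that
avoid \<open>H\<close>, and this gives a Cuntz--Krieger family on a Hilbert space (\<open>CK_family_path_op\<close>) in which the
projection of \<open>v\<close> vanishes and that of the range of \<open>x\<close> does not. The kernel of the resulting
representation is a proper ideal containing \<open>s\<^sub>v\<close>. Moreover \<open>s\<^sub>v \<noteq> 0\<close>, as one sees from the same family with
\<open>H\<close> empty (\<open>proper_ideal_of_not_cofinal\<close>). Since \<open>s\<^sub>v\<close> is fixed by the gauge action, both ideal properties fail.

What remains is that an ideal containing a nonzero gauge-fixed element contains a vertex projection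
(\<open>vertex_in_ideal\<close>). The linear span of the elements \<open>s\<^sub>\<mu> s\<^sub>\<nu>*\<close> is dense. If \<open>d(\<mu>) \<noteq> d(\<nu>)\<close>, some \<open>\<gamma>\<^sub>z\<close> reverses the
sign of \<open>s\<^sub>\<mu> s\<^sub>\<nu>*\<close>, and replacing \<open>b\<close> by \<open>(b + \<gamma>\<^sub>z b)/2\<close> removes this term without increasing the distance
to a fixed element. So a self-adjoint fixed element \<open>a\<close> is approximated by a self-adjoint combination \<open>c\<close> of
terms with \<open>d(\<mu>) = d(\<nu>)\<close> (\<open>core_approximation\<close>), and such a \<open>c\<close> lies in the span of finitely many matrix units
\<open>s\<^sub>\<alpha> s\<^sub>\<beta>*\<close> with \<open>\<alpha>, \<beta> \<in> \<Lambda>\<^bsup>\<le>n\<^esup>\<close> (\<open>core_in_matrix_algebra\<close>). In this matrix algebra there is a column \<open>u\<close>, with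
source \<open>w\<close>, on which \<open>c\<close> nearly attains its norm (\<open>near_maximal_vector\<close>). Then \<open>u* c\<^sup>2 u\<close> is a multiple of
\<open>s\<^sub>w\<close> to which the element \<open>u* a\<^sup>2 u\<close> of the ideal is so close that \<open>s\<^sub>w\<close> belongs to the ideal.

Three facts about abstract C*-algebras carry the analysis, and each is derived from the axioms by an algebraic
argument instead of spectral theory: homomorphisms are contractive (\<open>cstar_hom_contractive\<close>), projections
whose sum is a projection are mutually orthogonal (\<open>projections_orthogonal\<close>), and an ideal that
comes close enough to a projection contains it (\<open>projection_in_ideal\<close>).
\<close>

section \<open>Arithmetic and limits in a C*-algebra\<close>

text \<open>Declaring the algebra a structure lets \<open>\<otimes>\<close>, \<open>\<oplus>\<close>, \<open>\<odot>\<close> refer to it without an index.\<close>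

locale cstar = cstar_algebra A for A :: "'b cstar" (structure)
begin

declare mult_closed [simp, intro] adj_closed [simp, intro] scale_closed [simp, intro]
  nrm_nonneg [simp] adj_adj [simp]

lemma scale_add: "\<lbrakk>x \<in> carrier A; y \<in> carrier A\<rbrakk> \<Longrightarrow> c \<odot> (x \<oplus> y) = c \<odot> x \<oplus> c \<odot> y"
  using smult_r_distr by simp

lemma add_scale: "x \<in> carrier A \<Longrightarrow> (c + d) \<odot> x = c \<odot> x \<oplus> d \<odot> x"
  using smult_l_distr by simp

lemma scale_scale: "x \<in> carrier A \<Longrightarrow> c \<odot> (d \<odot> x) = (c * d) \<odot> x"
  using smult_assoc1 by simp

lemma scale_one [simp]: "x \<in> carrier A \<Longrightarrow> 1 \<odot> x = x"
  using smult_one by simp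

lemma scale_null [simp]: "c \<odot> \<zero> = \<zero>"
  using smult_r_null by simp

lemma minus_eq_scale: "\<lbrakk>x \<in> carrier A; y \<in> carrier A\<rbrakk> \<Longrightarrow> x \<ominus> y = x \<oplus> (-1) \<odot> y"
  by (simp add: a_minus_def scale_minus)

lemma scale_left_minus: "x \<in> carrier A \<Longrightarrow> (- c) \<odot> x = \<ominus> (c \<odot> x)"
  by (simp add: scale_minus scale_scale)

lemma mult_null_left [simp]: "x \<in> carrier A \<Longrightarrow> \<zero> \<otimes> x = \<zero>"
  using smult_mult_left[of "\<zero>" x 0] by (simp add: scale_zero)

lemma mult_null_right [simp]: "x \<in> carrier A \<Longrightarrow> x \<otimes> \<zero> = \<zero>"
  using smult_mult_right[of x "\<zero>" 0] by (simp add: scale_zero)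

lemma mult_minus_left: "\<lbrakk>x \<in> carrier A; y \<in> carrier A; z \<in> carrier A\<rbrakk> \<Longrightarrow> (x \<ominus> y) \<otimes> z = x \<otimes> z \<ominus> y \<otimes> z"
  by (simp add: minus_eq_scale distrib_right smult_mult_left)

lemma mult_minus_right: "\<lbrakk>x \<in> carrier A; y \<in> carrier A; z \<in> carrier A\<rbrakk> \<Longrightarrow> z \<otimes> (x \<ominus> y) = z \<otimes> x \<ominus> z \<otimes> y"
  by (simp add: minus_eq_scale distrib_left smult_mult_right)

lemma scale_minus_right: "\<lbrakk>x \<in> carrier A; y \<in> carrier A\<rbrakk> \<Longrightarrow> c \<odot> (x \<ominus> y) = c \<odot> x \<ominus> c \<odot> y"
  by (simp add: minus_eq_scale scale_add scale_scale)

lemma minus_add_cancel: "\<lbrakk>x \<in> carrier A; y \<in> carrier A\<rbrakk> \<Longrightarrow> (x \<ominus> y) \<oplus> y = x"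
  by (simp add: a_minus_def a_assoc l_neg)

lemma minus_self [simp]: "x \<in> carrier A \<Longrightarrow> x \<ominus> x = \<zero>"
  by (simp add: a_minus_def r_neg)

lemma neg_zero [simp]: "\<ominus> \<zero> = \<zero>"
  using minus_self[of "\<zero>"] by (simp add: a_minus_def)

lemma minus_eq_zero_iff: "\<lbrakk>x \<in> carrier A; y \<in> carrier A\<rbrakk> \<Longrightarrow> x \<ominus> y = \<zero> \<longleftrightarrow> x = y"
  by (metis l_zero minus_add_cancel minus_self)

lemma nrm_null [simp]: "nrm A \<zero> = 0" by (rule nrm_zero)

lemma nrm_diff: "\<lbrakk>x \<in> carrier A; y \<in> carrier A\<rbrakk> \<Longrightarrow> nrm A (x \<ominus> y) \<le> nrm A x + nrm A y"
  using nrm_add[of x "\<ominus> y"] by (simp add: a_minus_def nrm_minus)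

lemma nrm_triangle:
  "\<lbrakk>x \<in> carrier A; y \<in> carrier A; z \<in> carrier A\<rbrakk> \<Longrightarrow> nrm A (x \<ominus> z) \<le> nrm A (x \<ominus> y) + nrm A (y \<ominus> z)"
  using nrm_add[of "x \<ominus> y" "y \<ominus> z"] minus_split[of x y z] by simp

lemma nrm_le_diff: "\<lbrakk>x \<in> carrier A; y \<in> carrier A\<rbrakk> \<Longrightarrow> nrm A x \<le> nrm A (x \<ominus> y) + nrm A y"
  using nrm_add[of "x \<ominus> y" y] by (simp add: minus_add_cancel)

lemma double: "x \<in> carrier A \<Longrightarrow> x \<oplus> x = 2 \<odot> x"
  using add_scale[of x 1 1] by simp

lemma nrm_midpoint:
  assumes "x \<in> carrier A" "y \<in> carrier A" "z \<in> carrier A" "2 \<odot> z = x \<oplus> y"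
  shows "nrm A z \<le> (nrm A x + nrm A y) / 2"
  using nrm_add[of x y] nrm_smult[of z 2] assms by simp

lemma nrm_square_self_adjoint: "\<lbrakk>x \<in> carrier A; adj A x = x\<rbrakk> \<Longrightarrow> nrm A (x \<otimes> x) = (nrm A x)\<^sup>2"
  using nrm_adj_mult[of x] by simp

lemma nrm_projection:
  assumes "p \<in> carrier A" "adj A p = p" "p \<otimes> p = p"
  shows "nrm A p \<le> 1" "p \<noteq> \<zero> \<Longrightarrow> nrm A p = 1"
  using nrm_square_self_adjoint[of p] assms nrm_eq_0[of p] by (auto simp: power2_eq_square)

lemma finsum_mult_right:
  "\<lbrakk>finite F; f \<in> F \<rightarrow> carrier A; y \<in> carrier A\<rbrakk> \<Longrightarrow> finsum A f F \<otimes> y = (\<Oplus>i\<in>F. f i \<otimes> y)"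
proof (induction F rule: finite_induct)
  case (insert i F)
  then have "(\<lambda>i. f i \<otimes> y) \<in> F \<rightarrow> carrier A" "f \<in> F \<rightarrow> carrier A" "f i \<in> carrier A" by auto
  with insert show ?case by (simp add: distrib_right finsum_closed finsum_insert)
qed simp

lemma finsum_mult_left:
  "\<lbrakk>finite F; f \<in> F \<rightarrow> carrier A; y \<in> carrier A\<rbrakk> \<Longrightarrow> y \<otimes> finsum A f F = (\<Oplus>i\<in>F. y \<otimes> f i)"
proof (induction F rule: finite_induct)
  case (insert i F)
  then have "(\<lambda>i. y \<otimes> f i) \<in> F \<rightarrow> carrier A" "f \<in> F \<rightarrow> carrier A" "f i \<in> carrier A" by auto
  with insert show ?case by (simp add: distrib_left finsum_closed finsum_insert)
qed simp

lemma nrm_finsum_le: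
  "\<lbrakk>finite F; f \<in> F \<rightarrow> carrier A\<rbrakk> \<Longrightarrow> nrm A (finsum A f F) \<le> (\<Sum>i\<in>F. nrm A (f i))"
proof (induction F rule: finite_induct)
  case (insert i F)
  then have "f \<in> F \<rightarrow> carrier A" "f i \<in> carrier A" by auto
  with insert nrm_add[of "f i" "finsum A f F"] show ?case
    by (simp add: finsum_closed finsum_insert)
qed simp

definition tends :: "(nat \<Rightarrow> 'b) \<Rightarrow> 'b \<Rightarrow> bool" where
  "tends Y y \<longleftrightarrow> y \<in> carrier A \<and> (\<forall>n. Y n \<in> carrier A) \<and> (\<lambda>n. nrm A (Y n \<ominus> y)) \<longlonglongrightarrow> 0"

lemma tendsD: assumes "tends Y y"
  shows "y \<in> carrier A" "Y n \<in> carrier A" "(\<lambda>n. nrm A (Y n \<ominus> y)) \<longlonglongrightarrow> 0"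
  using assms by (auto simp: tends_def)

lemma tendsI:
  assumes "y \<in> carrier A" "\<And>n. Y n \<in> carrier A" "\<And>n. nrm A (Y n \<ominus> y) \<le> e n" "e \<longlonglongrightarrow> 0"
  shows "tends Y y"
  unfolding tends_def
proof (intro conjI allI)
  show "(\<lambda>n. nrm A (Y n \<ominus> y)) \<longlonglongrightarrow> 0"
    by (rule tendsto_sandwich[OF _ _ tendsto_const assms(4)]) (use assms in auto)
qed (use assms in auto)

lemma closed_iff_sequentially_closed:
  "closedin (cstar_topology A) S \<longleftrightarrow> S \<subseteq> carrier A \<and> (\<forall>Y y. (\<forall>n. Y n \<in> S) \<and> tends Y y \<longrightarrow> y \<in> S)"
proof -
  interpret M: Metric_space "carrier A" "cstar_dist A" by (rule Metric_space)
  have lim: "limitin M.mtopology Y y sequentially \<longleftrightarrow> tends Y y" if "S \<subseteq> carrier A" "\<And>n. Y n \<in> S" for Y y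
  proof -
    have "Y n \<in> carrier A" for n using that by blast
    then show ?thesis by (auto simp: M.limitin_metric_dist_null tends_def dist_eq)
  qed
  show ?thesis
    unfolding M.metric_closedin_iff_sequentially_closed image_subset_iff
    by (intro conj_cong refl all_cong) (use lim in blast)
qed

lemma tends_add:
  assumes "tends X x" "tends Y y" shows "tends (\<lambda>n. X n \<oplus> Y n) (x \<oplus> y)"
proof (rule tendsI)
  note c = tendsD(1,2)[OF assms(1)] tendsD(1,2)[OF assms(2)]
  show "nrm A ((X n \<oplus> Y n) \<ominus> (x \<oplus> y)) \<le> nrm A (X n \<ominus> x) + nrm A (Y n \<ominus> y)" for n
    using c by (simp add: minus_add_add nrm_add)
  show "(\<lambda>n. nrm A (X n \<ominus> x) + nrm A (Y n \<ominus> y)) \<longlonglongrightarrow> 0"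
    using tendsto_add[OF tendsD(3)[OF assms(1)] tendsD(3)[OF assms(2)]] by simp
qed (use assms tendsD in auto)

lemma tends_scale:
  assumes "tends X x" shows "tends (\<lambda>n. c \<odot> X n) (c \<odot> x)"
proof (rule tendsI)
  note cl = tendsD(1,2)[OF assms(1)]
  show "nrm A (c \<odot> X n \<ominus> c \<odot> x) \<le> cmod c * nrm A (X n \<ominus> x)" for n
    using cl by (simp flip: scale_minus_right nrm_smult)
  show "(\<lambda>n. cmod c * nrm A (X n \<ominus> x)) \<longlonglongrightarrow> 0"
    using tendsto_mult_left[OF tendsD(3)[OF assms(1)], of "cmod c"] by simp
qed (use assms tendsD in auto)

lemma tends_adj:
  assumes "tends X x" shows "tends (\<lambda>n. adj A (X n)) (adj A x)"
proof (rule tendsI)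
  note cl = tendsD(1,2)[OF assms(1)]
  show "nrm A (adj A (X n) \<ominus> adj A x) \<le> nrm A (X n \<ominus> x)" for n
    using cl by (simp add: nrm_adj flip: adj_minus)
  show "(\<lambda>n. nrm A (X n \<ominus> x)) \<longlonglongrightarrow> 0"
    using tendsD(3)[OF assms(1)] by simp
qed (use assms tendsD in auto)

lemma tends_const: "x \<in> carrier A \<Longrightarrow> tends (\<lambda>_. x) x"
  by (simp add: tends_def a_minus_def r_neg)

lemma tends_nrm:
  assumes "tends X x" shows "(\<lambda>n. nrm A (X n)) \<longlonglongrightarrow> nrm A x"
proof -
  note cl = tendsD(1,2)[OF assms(1)]
  have "norm (nrm A (X n) - nrm A x) \<le> nrm A (X n \<ominus> x)" for n
    using cl nrm_le_diff[of "X n" x] nrm_le_diff[of x "X n"] by (simp add: nrm_minus_commute[of x])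
  then show ?thesis
    using LIM_zero_cancel Lim_null_comparison tendsD(3)[OF assms] by (metis (mono_tags, lifting) eventuallyI)
qed

lemma tends_mult:
  assumes "tends X x" "tends Y y" shows "tends (\<lambda>n. X n \<otimes> Y n) (x \<otimes> y)"
proof (rule tendsI)
  note c = tendsD(1,2)[OF assms(1)] tendsD(1,2)[OF assms(2)]
  show "nrm A ((X n \<otimes> Y n) \<ominus> (x \<otimes> y)) \<le> nrm A (X n) * nrm A (Y n \<ominus> y) + nrm A (X n \<ominus> x) * nrm A y" for n
    using c nrm_add[of "X n \<otimes> (Y n \<ominus> y)" "(X n \<ominus> x) \<otimes> y"] nrm_mult[of "X n" "Y n \<ominus> y"] nrm_mult[of "X n \<ominus> x" y]
    by (simp add: minus_mult_mult)
  have "(\<lambda>n. nrm A (X n) * nrm A (Y n \<ominus> y) + nrm A (X n \<ominus> x) * nrm A y) \<longlonglongrightarrow> nrm A x * 0 + 0 * nrm A y"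
    by (intro tendsto_intros tends_nrm assms tendsD(3))
  then show "(\<lambda>n. nrm A (X n) * nrm A (Y n \<ominus> y) + nrm A (X n \<ominus> x) * nrm A y) \<longlonglongrightarrow> 0" by simp
qed (use assms tendsD in auto)

lemma tends_unique:
  assumes "tends X x" "tends X y" shows "x = y"
proof -
  note c = tendsD(1,2)[OF assms(1)] tendsD(1,2)[OF assms(2)]
  have "nrm A (x \<ominus> y) \<le> nrm A (X n \<ominus> x) + nrm A (X n \<ominus> y)" for n
    using c nrm_triangle[of x "X n" y] by (simp add: nrm_minus_commute[of x])
  moreover have "(\<lambda>n. nrm A (X n \<ominus> x) + nrm A (X n \<ominus> y)) \<longlonglongrightarrow> 0"
    using tendsto_add[OF tendsD(3)[OF assms(1)] tendsD(3)[OF assms(2)]] by simp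
  ultimately have "nrm A (x \<ominus> y) \<le> 0" by (intro LIMSEQ_le_const) auto
  then have "nrm A (x \<ominus> y) = 0" using c by (simp add: antisym)
  then show ?thesis using c by (simp add: nrm_eq_0 minus_eq_zero_iff)
qed

lemma tends_geometric:
  assumes Y: "\<And>n. Y n \<in> carrier A" and r: "0 \<le> r" "r < 1"
    and step: "\<And>n. nrm A (Y (Suc n) \<ominus> Y n) \<le> r ^ n"
  shows "\<exists>y. tends Y y"
proof -
  interpret M: Metric_space "carrier A" "cstar_dist A" by (rule Metric_space)
  have bound: "nrm A (Y (n + k) \<ominus> Y n) \<le> r ^ n * (1 - r ^ k) / (1 - r)" for n k
  proof (induction k)
    case 0 then show ?case using Y by (simp add: a_minus_def r_neg)
  next
    case (Suc k)
    have "nrm A (Y (n + Suc k) \<ominus> Y n) \<le> r ^ (n + k) + r ^ n * (1 - r ^ k) / (1 - r)"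
      using nrm_triangle[of "Y (n + Suc k)" "Y (n + k)" "Y n"] Y step[of "n + k"] Suc by simp
    also have "\<dots> = r ^ n * (1 - r ^ Suc k) / (1 - r)"
      using r by (simp add: field_simps power_add)
    finally show ?case .
  qed
  have bound': "nrm A (Y (n + k) \<ominus> Y n) \<le> r ^ n / (1 - r)" for n k
  proof -
    have "r ^ n * (1 - r ^ k) \<le> r ^ n * 1" using r by (intro mult_left_mono) auto
    then show ?thesis using bound[of n k] r by (smt (verit) divide_right_mono)
  qed
  have "(\<lambda>n. r ^ n / (1 - r)) \<longlonglongrightarrow> 0 / (1 - r)" using r by (intro tendsto_intros LIMSEQ_realpow_zero) auto
  then have lim: "(\<lambda>n. r ^ n / (1 - r)) \<longlonglongrightarrow> 0" by simp
  have "M.MCauchy Y"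
    unfolding M.MCauchy_def
  proof (intro conjI allI impI)
    fix e :: real assume "e > 0"
    then obtain N where N: "\<And>n. n \<ge> N \<Longrightarrow> r ^ n / (1 - r) < e"
      using order_tendstoD(2)[OF lim, of e] by (auto simp: eventually_sequentially)
    have "cstar_dist A (Y n) (Y n') < e" if "N \<le> n" "N \<le> n'" for n n'
    proof -
      have *: "nrm A (Y b \<ominus> Y a) < e" if "N \<le> a" "a \<le> b" for a b
        using bound'[of a "b - a"] N[of a] that by simp
      show ?thesis using that *[of n n'] *[of n' n] Y
        by (cases "n \<le> n'") (simp_all add: dist_eq nrm_minus_commute[of "Y n" "Y n'"])
    qed
    then show "\<exists>N. \<forall>n n'. N \<le> n \<longrightarrow> N \<le> n' \<longrightarrow> cstar_dist A (Y n) (Y n') < e" by blast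
  qed (use Y in auto)
  then obtain y where "limitin M.mtopology Y y sequentially"
    using complete by (auto simp: M.mcomplete_def)
  then have "tends Y y" using Y by (auto simp: M.limitin_metric_dist_null tends_def dist_eq)
  then show ?thesis by blast
qed

section \<open>Self-adjoint elements and projections\<close>

text \<open>Both \<open>P + iQ\<close> and \<open>P - iQ\<close> have squared norm \<open>\<parallel>P\<^sup>2 + Q\<^sup>2\<parallel>\<close>, and \<open>2iQ\<close> is their difference.\<close>

lemma nrm_sum_of_squares:
  assumes c: "P \<in> carrier A" "Q \<in> carrier A" and sa: "adj A P = P" "adj A Q = Q" and comm: "Q \<otimes> P = P \<otimes> Q"
  shows "(nrm A Q)\<^sup>2 \<le> nrm A (P \<otimes> P \<oplus> Q \<otimes> Q)"
proof -
  define E where "E = (\<lambda>z. P \<oplus> z \<odot> Q)"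
  have E: "E z \<in> carrier A" "adj A (E z) = E (cnj z)" for z using c sa by (auto simp: E_def adj_add adj_smult)
  have EE: "E (- z) \<otimes> E z = P \<otimes> P \<oplus> (- (z * z)) \<odot> (Q \<otimes> Q)" for z
  proof -
    have "E (- z) \<otimes> E z = (P \<otimes> P \<oplus> z \<odot> (P \<otimes> Q)) \<oplus> ((- z) \<odot> (P \<otimes> Q) \<oplus> (- (z * z)) \<odot> (Q \<otimes> Q))"
      using c comm by (simp add: E_def distrib_left distrib_right smult_mult_left smult_mult_right scale_add scale_scale)
        (simp add: a_ac)
    also have "\<dots> = P \<otimes> P \<oplus> ((z \<odot> (P \<otimes> Q)) \<oplus> ((- z) \<odot> (P \<otimes> Q))) \<oplus> (- (z * z)) \<odot> (Q \<otimes> Q)"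
      using c by (simp add: a_assoc)
    also have "(z \<odot> (P \<otimes> Q)) \<oplus> ((- z) \<odot> (P \<otimes> Q)) = \<zero>"
      using c by (simp add: scale_zero flip: add_scale)
    finally show ?thesis using c by simp
  qed
  have N: "(nrm A (E z))\<^sup>2 = nrm A (P \<otimes> P \<oplus> Q \<otimes> Q)" if "z = \<i> \<or> z = - \<i>" for z
    using that E(1)[of z] EE[of z] c by (auto simp: E(2) simp flip: nrm_adj_mult)
  have eq: "nrm A (E \<i>) = nrm A (E (- \<i>))"
    using N[of \<i>] N[of "- \<i>"] E by (metis nrm_nonneg power2_eq_imp_eq)
  have "E \<i> \<ominus> E (- \<i>) = (2 * \<i>) \<odot> Q"
  proof -
    have "E \<i> \<ominus> E (- \<i>) = (P \<ominus> P) \<oplus> (\<i> \<odot> Q \<ominus> (- \<i>) \<odot> Q)"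
      unfolding E_def using c by (simp add: minus_add_add)
    also have "\<dots> = (2 * \<i>) \<odot> Q"
      using c by (simp add: scale_left_minus a_minus_def r_neg) (simp flip: add_scale)
    finally show ?thesis .
  qed
  then have "2 * nrm A Q \<le> 2 * nrm A (E \<i>)"
    using nrm_diff[of "E \<i>" "E (- \<i>)"] E c by (simp add: nrm_smult norm_mult eq)
  then have "(nrm A Q)\<^sup>2 \<le> (nrm A (E \<i>))\<^sup>2" using c by (intro power_mono) auto
  then show ?thesis using N[of \<i>] by simp
qed

text \<open>The unit \<open>p\<close> is an extreme point of the unit ball. Write \<open>U\<close> for the set of scalars \<open>z\<close> with
\<open>\<parallel>p + zh\<parallel> \<le> 1\<close>. From \<open>\<plusminus>1 \<in> U\<close> follows \<open>\<plusminus>i \<in> U\<close>, because \<open>(p - ih)(p + ih) = p + h\<^sup>2\<close> is the mean of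
\<open>(p \<plusminus> h)\<^sup>2\<close>. The mean of \<open>(p + zh)\<^sup>2\<close> and \<open>(p + izh)\<^sup>2\<close> is \<open>p + (1 + i)zh\<close>, since the quadratic terms
cancel; so \<open>U\<close> contains all powers of \<open>1 + i\<close>, which are unbounded.\<close>

lemma zero_of_symmetric_unit_bounds:
  assumes c: "p \<in> carrier A" "h \<in> carrier A" and sa: "adj A p = p" "adj A h = h"
    and p: "p \<otimes> p = p" "p \<otimes> h = h" "h \<otimes> p = h"
    and b: "nrm A (p \<oplus> h) \<le> 1" "nrm A (p \<ominus> h) \<le> 1"
  shows "h = \<zero>"
proof -
  \<comment> \<open>The polynomials of degree at most two in \<open>h\<close> with constant term \<open>p\<close>; \<open>F \<alpha> 0\<close> is \<open>p + \<alpha>h\<close>.\<close>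
  define F where "F = (\<lambda>\<alpha> \<beta>. p \<oplus> \<alpha> \<odot> h \<oplus> \<beta> \<odot> (h \<otimes> h))"
  have F: "F \<alpha> \<beta> \<in> carrier A" for \<alpha> \<beta> using c by (simp add: F_def)
  have adjF: "adj A (F \<alpha> 0) = F (cnj \<alpha>) 0" for \<alpha> using c sa by (simp add: F_def adj_add adj_smult scale_zero)
  have F_mult: "F \<alpha> 0 \<otimes> F \<beta> 0 = F (\<alpha> + \<beta>) (\<alpha> * \<beta>)" for \<alpha> \<beta>
    using c p by (simp add: F_def distrib_left distrib_right smult_mult_left smult_mult_right scale_add
        scale_scale scale_zero add_scale) (simp add: a_ac mult.commute)
  have F_mid: "2 \<odot> F (a + a') (b + b') = F (2 * a) (2 * b) \<oplus> F (2 * a') (2 * b')" for a a' b b'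
  proof -
    have "F (2 * a) (2 * b) \<oplus> F (2 * a') (2 * b') = (p \<oplus> p) \<oplus> (2 * a + 2 * a') \<odot> h \<oplus> (2 * b + 2 * b') \<odot> (h \<otimes> h)"
      using c by (simp add: F_def add_scale) (simp add: a_ac)
    also have "\<dots> = 2 \<odot> F (a + a') (b + b')"
      using c by (simp add: F_def double scale_add scale_scale distrib_left)
    finally show ?thesis ..
  qed
  define U where "U = {z. nrm A (F z 0) \<le> 1}"
  have sq: "nrm A (F (z + w) (z * w)) \<le> 1" if "z \<in> U" "w \<in> U" for z w
    using that nrm_mult[of "F z 0" "F w 0"] F mult_mono[of "nrm A (F z 0)" 1 "nrm A (F w 0)" 1]
    by (auto simp: U_def F_mult)
  have mid: "nrm A (F (a + a') (b + b')) \<le> 1" if "nrm A (F (2 * a) (2 * b)) \<le> 1" "nrm A (F (2 * a') (2 * b')) \<le> 1" for a a' b b'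
    using nrm_midpoint[OF _ _ _ F_mid[of a a' b b']] F that by fastforce
  have 1: "1 \<in> U" "- 1 \<in> U" using b c by (auto simp: U_def F_def scale_zero minus_eq_scale)
  have "nrm A (F 0 1) \<le> 1"
    using mid[of 1 "1/2" "-1" "1/2"] sq[OF 1(1) 1(1)] sq[OF 1(2) 1(2)] by simp
  then have "z \<in> U" if "z = \<i> \<or> z = - \<i>" for z
  proof -
    have "(nrm A (F z 0))\<^sup>2 = nrm A (F 0 1)"
      using that F F_mult[of "cnj z" z] by (auto simp: adjF simp flip: nrm_adj_mult)
    then show ?thesis using \<open>nrm A (F 0 1) \<le> 1\<close> F unfolding U_def
      by (metis (mono_tags, lifting) mem_Collect_eq nrm_nonneg one_power2 power2_le_imp_le zero_le_one)
  qed
  with 1 have start: "\<forall>\<omega> \<in> {1, \<i>, -1, -\<i>}. \<omega> \<in> U" by auto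
  have step: "(1 + \<i>) * z \<in> U" if "z \<in> U" "\<i> * z \<in> U" for z
    using mid[of z "z * z / 2" "\<i> * z" "- (z * z / 2)"] sq[OF that(1) that(1)] sq[OF that(2) that(2)]
    by (simp add: U_def algebra_simps)
  have "\<forall>\<omega> \<in> {1, \<i>, -1, -\<i>}. \<omega> * (1 + \<i>) ^ n \<in> U" for n
  proof (induction n)
    case 0 then show ?case using start by simp
  next
    case (Suc n)
    show ?case
    proof
      fix \<omega> assume \<omega>: "\<omega> \<in> {1, \<i>, -1, -\<i>}"
      then have "\<i> * \<omega> \<in> {1, \<i>, -1, -\<i>}" by auto
      then have "\<i> * \<omega> * (1 + \<i>) ^ n \<in> U" using Suc by blast
      then have "(1 + \<i>) * (\<omega> * (1 + \<i>) ^ n) \<in> U" using Suc \<omega> by (intro step) (auto simp: mult.assoc)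
      then show "\<omega> * (1 + \<i>) ^ Suc n \<in> U" by (simp add: ac_simps)
    qed
  qed
  then have "nrm A (p \<oplus> (1 + \<i>) ^ n \<odot> h) \<le> 1" for n
    using c by (auto simp: U_def F_def scale_zero)
  moreover have "(1 + \<i>) ^ n \<odot> h = (p \<oplus> (1 + \<i>) ^ n \<odot> h) \<ominus> p" for n
    using c by (simp add: a_minus_def a_comm[of p] a_assoc r_neg)
  then have "nrm A ((1 + \<i>) ^ n \<odot> h) \<le> nrm A (p \<oplus> (1 + \<i>) ^ n \<odot> h) + nrm A p" for n
    using nrm_diff[of "p \<oplus> (1 + \<i>) ^ n \<odot> h" p] c by simp
  moreover have "nrm A p \<le> 1" using nrm_projection(1)[of p] c sa p by simp
  ultimately have "nrm A ((1 + \<i>) ^ n \<odot> h) \<le> 1 + 1" for n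
    by (smt (verit))
  moreover have "cmod (1 + \<i>) = sqrt 2" by (simp add: cmod_def)
  ultimately have le: "sqrt 2 ^ n * nrm A h \<le> 2" for n
    using c by (simp add: nrm_smult norm_power)
  have "nrm A h = 0"
  proof (rule ccontr)
    assume "nrm A h \<noteq> 0"
    then have pos: "nrm A h > 0" using c by (simp add: order_less_le)
    obtain n where "2 / nrm A h < sqrt 2 ^ n" using real_arch_pow[of "sqrt 2" "2 / nrm A h"] by auto
    then show False using le[of n] pos by (simp add: field_simps)
  qed
  then show ?thesis using c by (simp add: nrm_eq_0)
qed

text \<open>With \<open>m\<close> summands, \<open>p - q\<^sub>j/m\<close> is a mean of copies of \<open>p\<close> and \<open>p - q\<^sub>j\<close>, and, as \<open>-q\<^sub>j\<close> is the sum of the other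
\<open>q\<^sub>l\<close>, \<open>p + q\<^sub>j/m\<close> is a mean of \<open>p\<close> and the other \<open>p - q\<^sub>l\<close>. Both therefore lie in the unit ball.\<close>

lemma summands_of_zero_sum:
  assumes p: "p \<in> carrier A" "adj A p = p" "p \<otimes> p = p" and J: "finite J"
    and q: "\<And>l. l \<in> J \<Longrightarrow> q l \<in> carrier A \<and> adj A (q l) = q l \<and> p \<otimes> q l = q l \<and> q l \<otimes> p = q l"
    and bound: "\<And>l. l \<in> J \<Longrightarrow> nrm A (p \<ominus> q l) \<le> 1"
    and sum0: "(\<Oplus>l\<in>J. q l) = \<zero>" and j: "j \<in> J"
  shows "q j = \<zero>"
proof -
  have qJ: "q \<in> J \<rightarrow> carrier A" using q by auto
  define m where "m = card J"
  have m: "m > 0" using J j by (auto simp: m_def card_gt_0_iff)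
  define h where "h = complex_of_real (1 / m) \<odot> q j"
  have qj: "q j \<in> carrier A" using q j by simp
  have h: "h \<in> carrier A" "adj A h = h" "p \<otimes> h = h" "h \<otimes> p = h"
    using q[OF j] p by (simp_all add: h_def adj_smult smult_mult_right smult_mult_left)
  have mh: "complex_of_real m \<odot> h = q j" using m qj by (simp add: h_def scale_scale)
  have p1: "nrm A p \<le> 1" using nrm_projection[OF p] by simp
  have "nrm A (p \<ominus> h) \<le> 1"
  proof -
    have "complex_of_real m \<odot> (p \<ominus> h) = complex_of_real (real (m - 1)) \<odot> p \<oplus> (p \<ominus> q j)"
    proof -
      have "complex_of_real m \<odot> (p \<ominus> h) = complex_of_real m \<odot> p \<ominus> q j"
        using h(1) p(1) mh by (simp add: scale_minus_right)
      also have "complex_of_real m \<odot> p = complex_of_real (real (m - 1)) \<odot> p \<oplus> p"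
        using m p(1) add_scale[of p "complex_of_real (real (m - 1))" 1] by (simp add: of_nat_diff)
      finally show ?thesis using p(1) qj by (simp add: a_minus_def a_assoc)
    qed
    then have "m * nrm A (p \<ominus> h) \<le> real (m - 1) * nrm A p + nrm A (p \<ominus> q j)"
      using nrm_smult[of "p \<ominus> h" "complex_of_real m"] nrm_smult[of p "complex_of_real (real (m - 1))"]
        nrm_add[of "complex_of_real (real (m - 1)) \<odot> p" "p \<ominus> q j"] p(1) h qj by simp
    also have "\<dots> \<le> real (m - 1) * 1 + 1" using bound[OF j] p1 by (intro add_mono mult_left_mono) auto
    finally show ?thesis using m by (simp add: of_nat_diff)
  qed
  moreover have "nrm A (p \<oplus> h) \<le> 1"
  proof -
    define K where "K = J - {j}"
    have K: "finite K" "J = insert j K" "j \<notin> K" "m = Suc (card K)" using J j by (auto simp: K_def m_def simp del: card_Diff_insert intro: card_Suc_Diff1[symmetric])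
    have qK: "q \<in> K \<rightarrow> carrier A" using qJ K by auto
    have const: "complex_of_real (real (card K)) \<odot> p = (\<Oplus>l\<in>K. p)"
      using K(1) by (induction K rule: finite_induct) (use p(1) in \<open>auto simp: scale_zero finsum_insert add_scale\<close>)
    have neg: "q j \<oplus> (\<Oplus>l\<in>K. q l) = \<zero>"
      using sum0 K qj qK by (simp add: finsum_insert)
    have diff: "(\<Oplus>l\<in>K. p \<ominus> q l) = (\<Oplus>l\<in>K. p) \<ominus> (\<Oplus>l\<in>K. q l)"
      using K(1) qK
    proof (induction K rule: finite_induct)
      case (insert l K)
      then have "(\<lambda>l. p \<ominus> q l) \<in> K \<rightarrow> carrier A" "q \<in> K \<rightarrow> carrier A" "q l \<in> carrier A" using p(1) by auto
      with insert p(1) show ?case by (simp add: finsum_insert finsum_closed minus_add_add)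
    qed (simp add: a_minus_def)
    have "complex_of_real m \<odot> (p \<oplus> h) = (complex_of_real (real (card K)) \<odot> p \<oplus> p) \<oplus> q j"
      using h(1) p(1) K(4) mh add_scale[of p "complex_of_real (real (card K))" 1]
      by (simp add: scale_add add.commute)
    also have "q j = \<ominus> (\<Oplus>l\<in>K. q l)"
      using neg qj finsum_closed[OF qK] by (metis minus_equality)
    also have "(complex_of_real (real (card K)) \<odot> p \<oplus> p) \<oplus> \<ominus> (\<Oplus>l\<in>K. q l) = p \<oplus> (\<Oplus>l\<in>K. p \<ominus> q l)"
      unfolding diff const using p(1) finsum_closed[OF qK] finsum_closed[of "\<lambda>_. p" K] by (simp add: a_minus_def a_ac)
    finally have "m * nrm A (p \<oplus> h) = nrm A (p \<oplus> (\<Oplus>l\<in>K. p \<ominus> q l))"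
      using nrm_smult[of "p \<oplus> h" "complex_of_real m"] p(1) h by simp
    also have "\<dots> \<le> nrm A p + (\<Sum>l\<in>K. nrm A (p \<ominus> q l))"
    proof -
      have "(\<lambda>l. p \<ominus> q l) \<in> K \<rightarrow> carrier A" using qK p(1) by auto
      then show ?thesis
        using nrm_add[of p "\<Oplus>l\<in>K. p \<ominus> q l"] nrm_finsum_le[OF K(1), of "\<lambda>l. p \<ominus> q l"] p(1) finsum_closed[of "\<lambda>l. p \<ominus> q l" K]
        by linarith
    qed
    also have "\<dots> \<le> 1 + (\<Sum>l\<in>K. 1)" using p1 bound K by (intro add_mono sum_mono) auto
    finally show ?thesis using m K(4) by simp
  qed
  ultimately have "h = \<zero>" using zero_of_symmetric_unit_bounds[OF p(1) h(1) p(2) h(2) p(3) h(3,4)] by simp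
  then show "q j = \<zero>" using mh by simp
qed

text \<open>Compressing \<open>P = \<Sum> p\<^sub>l\<close> by \<open>p\<^sub>i\<close> gives \<open>\<Sum> p\<^sub>i p\<^sub>l p\<^sub>i = 0\<close> over the indices \<open>l \<noteq> i\<close>. These summands are
positive, which enters only in the form \<open>\<parallel>p\<^sub>i - p\<^sub>i p\<^sub>l p\<^sub>i\<parallel> \<le> 1\<close>, so each of them vanishes.\<close>

lemma projections_orthogonal:
  assumes F: "finite F" and c: "\<And>i. i \<in> F \<Longrightarrow> p i \<in> carrier A"
    and sa: "\<And>i. i \<in> F \<Longrightarrow> adj A (p i) = p i" and pp: "\<And>i. i \<in> F \<Longrightarrow> p i \<otimes> p i = p i"
    and P: "P \<in> carrier A" "P \<otimes> P = P" "P = (\<Oplus>i\<in>F. p i)"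
    and Pp: "\<And>i. i \<in> F \<Longrightarrow> P \<otimes> p i = p i"
    and ij: "i \<in> F" "j \<in> F" "i \<noteq> j"
  shows "p i \<otimes> p j = \<zero>"
proof -
  define q where "q = (\<lambda>l. p i \<otimes> p l \<otimes> p i)"
  have ci: "p i \<in> carrier A" and cj: "p j \<in> carrier A" using c ij by auto
  have q: "q l \<in> carrier A" "adj A (q l) = q l" "p i \<otimes> q l = q l" "q l \<otimes> p i = q l" if "l \<in> F" for l
    using that c sa pp ij by (auto simp: q_def adj_mult mult_assoc) (simp flip: mult_assoc add: pp)
  have bound: "nrm A (p i \<ominus> q l) \<le> 1" if l: "l \<in> F" for l
  proof -
    \<comment> \<open>\<open>y*y = p\<^sub>i y = p\<^sub>i - p\<^sub>i p\<^sub>l p\<^sub>i\<close>, so \<open>\<parallel>y\<parallel>\<^sup>2 \<le> \<parallel>y\<parallel>\<close>.\<close>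
    define y where "y = p i \<ominus> p l \<otimes> p i"
    have y: "y \<in> carrier A" using ci c l by (simp add: y_def)
    have "adj A y \<otimes> y = (p i \<ominus> q l) \<ominus> (q l \<ominus> q l)"
    proof -
      have pp': "p l \<otimes> (p l \<otimes> p i) = p l \<otimes> p i" using c l ci pp by (simp flip: mult_assoc)
      show ?thesis
      using ci c l sa pp ij by (simp add: y_def adj_minus adj_mult mult_minus_left mult_minus_right q_def mult_assoc pp')
    qed
    also have "\<dots> = p i \<ominus> q l" using ci q l by (simp add: a_minus_def r_neg)
    finally have eq: "adj A y \<otimes> y = p i \<ominus> q l" .
    have "p i \<otimes> y = p i \<ominus> q l"
      using ci c l pp ij by (simp add: y_def mult_minus_right q_def mult_assoc)
    then have "(nrm A y)\<^sup>2 \<le> nrm A (p i) * nrm A y"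
      using nrm_mult[of "p i" y] nrm_adj_mult[of y] y ci eq by simp
    also have "\<dots> \<le> 1 * nrm A y" using ci y sa pp ij by (intro mult_right_mono nrm_projection) auto
    finally have "nrm A y \<le> 1" using y by (cases "nrm A y = 0") (simp_all add: power2_eq_square order_less_le)
    then show ?thesis using eq y nrm_adj_mult[of y] by (metis nrm_nonneg power_le_one)
  qed
  define J where "J = F - {i}"
  have J: "finite J" "j \<in> J" "F = insert i J" "i \<notin> J" using F ij by (auto simp: J_def)
  have qJ: "q \<in> J \<rightarrow> carrier A" and pF: "p \<in> F \<rightarrow> carrier A" using q c J by auto
  have sum0: "(\<Oplus>l\<in>J. q l) = \<zero>"
  proof -
    have qF: "(\<Oplus>l\<in>F. q l) = p i"
    proof -
      have "p i \<otimes> P \<otimes> p i = (\<Oplus>l\<in>F. p i \<otimes> p l) \<otimes> p i"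
        unfolding P(3) using F pF ci by (simp add: finsum_mult_left)
      also have "\<dots> = (\<Oplus>l\<in>F. q l)" unfolding q_def by (rule finsum_mult_right[OF F _ ci]) (use c ci in auto)
      finally show ?thesis using Pp[OF ij(1)] ci P pp ij by (simp add: mult_assoc)
    qed
    have "(\<Oplus>l\<in>F. q l) = q i \<oplus> (\<Oplus>l\<in>J. q l)"
      unfolding J(3) using J q ij by (intro finsum_insert) auto
    moreover have "q i = p i" using pp ij by (simp add: q_def)
    ultimately have "p i = p i \<oplus> (\<Oplus>l\<in>J. q l)" using qF by simp
    then show ?thesis using ci finsum_closed[OF qJ] r_neg1[of "p i" "\<Oplus>l\<in>J. q l"] by (simp add: l_neg)
  qed
  have "q j = \<zero>"
    by (rule summands_of_zero_sum[OF ci sa[OF ij(1)] pp[OF ij(1)] J(1) _ bound sum0 J(2)]) (use q J in auto)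
  moreover have "adj A (p j \<otimes> p i) \<otimes> (p j \<otimes> p i) = q j"
  proof -
    have "p j \<otimes> (p j \<otimes> p i) = p j \<otimes> p i" using ci cj pp ij by (simp flip: mult_assoc)
    then show ?thesis using ci cj sa pp ij by (simp add: adj_mult q_def mult_assoc)
  qed
  ultimately have "p j \<otimes> p i = \<zero>"
    using nrm_adj_mult[of "p j \<otimes> p i"] ci cj by (simp add: nrm_eq_0)
  then have "adj A (p j \<otimes> p i) = \<zero>" by (simp add: adj_zero)
  then show ?thesis using ci cj sa ij by (simp add: adj_mult)
qed

section \<open>Square roots without a unit\<close>

text \<open>The equation says \<open>(1 - y)\<^sup>2 = 1 - a\<^sup>2\<close>, so \<open>y = 1 - \<surd>(1 - a\<^sup>2)\<close>, but it makes sense without a unit. The map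
\<open>y \<mapsto> (a\<^sup>2 + y\<^sup>2)/2\<close> preserves the ball of radius \<open>\<parallel>a\<parallel>\<close> and contracts it by the factor \<open>\<parallel>a\<parallel>\<close>; its iterates from
\<open>0\<close> converge to \<open>y\<close> and inherit self-adjointness and commutation with \<open>a\<close>.\<close>

lemma half_square_fixpoint:
  assumes a: "a \<in> carrier A" "adj A a = a" "nrm A a < 1"
  shows "\<exists>y \<in> carrier A. adj A y = y \<and> y \<otimes> a = a \<otimes> y \<and> 2 \<odot> y = a \<otimes> a \<oplus> y \<otimes> y"
proof -
  define r where "r = nrm A a"
  have r: "0 \<le> r" "r < 1" using a by (simp_all add: r_def)
  define Y where "Y = rec_nat \<zero> (\<lambda>_ y. (1/2) \<odot> (a \<otimes> a \<oplus> y \<otimes> y))"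
  have Y_Suc: "Y (Suc n) = (1/2) \<odot> (a \<otimes> a \<oplus> Y n \<otimes> Y n)" and Y_0: "Y 0 = \<zero>" for n
    by (simp_all add: Y_def)
  have Y: "Y n \<in> carrier A \<and> adj A (Y n) = Y n \<and> Y n \<otimes> a = a \<otimes> Y n \<and> nrm A (Y n) \<le> r" for n
  proof (induction n)
    case 0 then show ?case using a r by (simp add: Y_0 adj_zero)
  next
    case (Suc n)
    define y where "y = Y n"
    have y: "y \<in> carrier A" "adj A y = y" "y \<otimes> a = a \<otimes> y" "nrm A y \<le> r" using Suc by (auto simp: y_def)
    have "y \<otimes> (y \<otimes> a) = a \<otimes> (y \<otimes> y)" using y a mult_assoc[of a y y] mult_assoc[of y a y] by simp
    then have comm: "Y (Suc n) \<otimes> a = a \<otimes> Y (Suc n)"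
      using a y unfolding Y_Suc y_def[symmetric]
      by (simp add: distrib_left distrib_right smult_mult_left smult_mult_right mult_assoc)
    have "nrm A (a \<otimes> a) \<le> r * r" "nrm A (y \<otimes> y) \<le> r * r"
      using nrm_mult[of a a] nrm_mult[of y y] a y mult_mono[of "nrm A y" r "nrm A y" r] r
      by (auto simp: r_def)
    then have "nrm A (Y (Suc n)) \<le> 1/2 * (r * r + r * r)"
      using nrm_add[of "a \<otimes> a" "y \<otimes> y"] a y by (simp add: Y_Suc nrm_smult flip: y_def)
    also have "\<dots> \<le> r" using r by (simp add: mult_left_le)
    finally show ?case using comm a y unfolding Y_Suc y_def[symmetric]
      by (simp add: adj_add adj_smult adj_mult)
  qed
  have step: "nrm A (Y (Suc n) \<ominus> Y n) \<le> r ^ n" for n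
  proof (induction n)
    case 0 then show ?case using Y[of "Suc 0"] r by (simp add: Y_0 a_minus_def)
  next
    case (Suc n)
    define u v where "u = Y (Suc n)" and "v = Y n"
    have u: "u \<in> carrier A" "nrm A u \<le> r" and v: "v \<in> carrier A" "nrm A v \<le> r" using Y by (auto simp: u_def v_def)
    have "Y (Suc (Suc n)) \<ominus> Y (Suc n) = (1/2) \<odot> ((a \<otimes> a \<oplus> u \<otimes> u) \<ominus> (a \<otimes> a \<oplus> v \<otimes> v))"
    proof -
      have "Y (Suc (Suc n)) = (1/2) \<odot> (a \<otimes> a \<oplus> u \<otimes> u)" "Y (Suc n) = (1/2) \<odot> (a \<otimes> a \<oplus> v \<otimes> v)"
        by (simp_all only: Y_Suc u_def v_def)
      then show ?thesis using a u v by (simp add: scale_minus_right)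
    qed
    also have "(a \<otimes> a \<oplus> u \<otimes> u) \<ominus> (a \<otimes> a \<oplus> v \<otimes> v) = u \<otimes> (u \<ominus> v) \<oplus> (u \<ominus> v) \<otimes> v"
      using a u v by (simp add: minus_add_add minus_mult_mult)
    finally have "nrm A (Y (Suc (Suc n)) \<ominus> Y (Suc n)) = nrm A (u \<otimes> (u \<ominus> v) \<oplus> (u \<ominus> v) \<otimes> v) / 2"
      using u v by (simp add: nrm_smult)
    also have "\<dots> \<le> (nrm A u * nrm A (u \<ominus> v) + nrm A (u \<ominus> v) * nrm A v) / 2"
      using u v nrm_add[of "u \<otimes> (u \<ominus> v)" "(u \<ominus> v) \<otimes> v"] nrm_mult[of u "u \<ominus> v"] nrm_mult[of "u \<ominus> v" v] by simp
    also have "\<dots> \<le> (r * nrm A (u \<ominus> v) + nrm A (u \<ominus> v) * r) / 2"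
      using u v r by (intro divide_right_mono add_mono mult_mono) auto
    also have "\<dots> = r * nrm A (u \<ominus> v)" by simp
    also have "\<dots> \<le> r * r ^ n" using Suc r by (intro mult_left_mono) (auto simp: u_def v_def)
    finally show ?case by simp
  qed
  obtain y where y: "tends Y y" using tends_geometric[OF _ r step] Y by blast
  note yc = tendsD(1)[OF y]
  have "adj A y = y" using tends_unique[OF tends_adj[OF y]] Y y by simp
  moreover have "y \<otimes> a = a \<otimes> y"
    using tends_unique[OF tends_mult[OF y tends_const[OF a(1)]]] tends_mult[OF tends_const[OF a(1)] y] Y by simp
  moreover have "2 \<odot> y = a \<otimes> a \<oplus> y \<otimes> y"
  proof -
    have "tends (\<lambda>n. Y (Suc n)) ((1/2) \<odot> (a \<otimes> a \<oplus> y \<otimes> y))"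
      unfolding Y_Suc using a by (intro tends_scale tends_add tends_mult tends_const y) auto
    moreover have "tends (\<lambda>n. Y (Suc n)) y"
      using y unfolding tends_def by (auto intro: LIMSEQ_Suc)
    ultimately have "(1/2) \<odot> (a \<otimes> a \<oplus> y \<otimes> y) = y" by (rule tends_unique)
    then have "2 \<odot> y = 2 \<odot> ((1/2) \<odot> (a \<otimes> a \<oplus> y \<otimes> y))" by simp
    then show ?thesis using a yc by (simp add: scale_scale)
  qed
  ultimately show ?thesis using yc by blast
qed

text \<open>Here \<open>(1 - y)\<^sup>2 + b\<^sup>2 = 1\<close>. Multiplying by \<open>b\<close> makes this an identity \<open>P\<^sup>2 + Q\<^sup>2 = Q\<close> inside the algebra, with
\<open>P = b(1 - y)\<close> and \<open>Q = b\<^sup>2\<close>, and then \<open>\<parallel>Q\<parallel>\<^sup>2 \<le> \<parallel>Q\<parallel>\<close>.\<close>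

lemma nrm_le_one_of_square_identity:
  assumes c: "b \<in> carrier A" "y \<in> carrier A" and sa: "adj A b = b" "adj A y = y"
    and comm: "y \<otimes> b = b \<otimes> y" and eq: "2 \<odot> y = b \<otimes> b \<oplus> y \<otimes> y"
  shows "nrm A b \<le> 1"
proof -
  define P where "P = b \<ominus> b \<otimes> y"
  define Q where "Q = b \<otimes> b"
  have P: "P \<in> carrier A" "adj A P = P" and Q: "Q \<in> carrier A" "adj A Q = Q"
    using c sa comm by (simp_all add: P_def Q_def adj_minus adj_mult)
  have comm': "y \<otimes> (b \<otimes> z) = b \<otimes> (y \<otimes> z)" if "z \<in> carrier A" for z
    using that c comm by (simp flip: mult_assoc)
  have bP: "P \<otimes> b = b \<otimes> P"
    using c comm by (simp add: P_def mult_minus_left mult_minus_right mult_assoc comm')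
  have QP: "Q \<otimes> P = P \<otimes> Q" using c P bP mult_assoc[of b b P] mult_assoc[of b P b] mult_assoc[of P b b] by (simp add: Q_def)
  define G where "G = b \<otimes> (b \<otimes> y)"
  define H where "H = b \<otimes> (b \<otimes> (y \<otimes> y))"
  have G: "G \<in> carrier A" and H: "H \<in> carrier A" using c by (auto simp: G_def H_def)
  have "2 \<odot> G = (b \<otimes> b) \<otimes> (2 \<odot> y)" using c by (simp add: G_def smult_mult_right mult_assoc)
  also have "\<dots> = Q \<otimes> Q \<oplus> H" unfolding eq using c by (simp add: Q_def H_def distrib_left mult_assoc)
  finally have GG: "G \<oplus> G = Q \<otimes> Q \<oplus> H" using G by (simp add: double)
  have "P \<otimes> P = (Q \<ominus> G) \<ominus> (G \<ominus> H)"
    using c comm by (simp add: P_def Q_def G_def H_def mult_minus_left mult_minus_right mult_assoc comm')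
  then have "P \<otimes> P \<oplus> Q \<otimes> Q = Q \<ominus> (G \<oplus> G) \<oplus> (Q \<otimes> Q \<oplus> H)"
    using Q G H by (simp add: a_minus_def minus_add a_ac)
  also have "\<dots> = Q" unfolding GG using Q H by (simp add: minus_add_cancel)
  finally have "(nrm A Q)\<^sup>2 \<le> nrm A Q"
    using nrm_sum_of_squares[OF P(1) Q(1) P(2) Q(2) QP] by simp
  then have "nrm A Q \<le> 1" using Q by (cases "nrm A Q = 0") (simp_all add: power2_eq_square order_less_le)
  then show ?thesis
    using nrm_square_self_adjoint[OF c(1) sa(1)] c abs_le_square_iff[of "nrm A b" 1] by (simp add: Q_def)
qed

section \<open>Ideals and closures of subalgebras\<close>

fun iterated_square :: "'b \<Rightarrow> nat \<Rightarrow> 'b" where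
  "iterated_square x 0 = x"
| "iterated_square x (Suc n) = iterated_square x n \<otimes> iterated_square x n"

lemma ideal_closed:
  assumes "cstar_ideal A I"
  shows "I \<subseteq> carrier A" "\<zero> \<in> I" "x \<in> I \<Longrightarrow> y \<in> I \<Longrightarrow> x \<oplus> y \<in> I" "x \<in> I \<Longrightarrow> c \<odot> x \<in> I"
    "x \<in> I \<Longrightarrow> a \<in> carrier A \<Longrightarrow> a \<otimes> x \<in> I" "x \<in> I \<Longrightarrow> a \<in> carrier A \<Longrightarrow> x \<otimes> a \<in> I"
    "x \<in> I \<Longrightarrow> y \<in> I \<Longrightarrow> x \<ominus> y \<in> I" "(\<And>n. Y n \<in> I) \<Longrightarrow> tends Y y \<Longrightarrow> y \<in> I"
proof -
  show *: "I \<subseteq> carrier A" "\<zero> \<in> I" "x \<in> I \<Longrightarrow> y \<in> I \<Longrightarrow> x \<oplus> y \<in> I" "x \<in> I \<Longrightarrow> c \<odot> x \<in> I" for x y c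
    using assms by (auto simp: cstar_ideal_def closed_subspace_def)
  show "x \<in> I \<Longrightarrow> a \<in> carrier A \<Longrightarrow> a \<otimes> x \<in> I" "x \<in> I \<Longrightarrow> a \<in> carrier A \<Longrightarrow> x \<otimes> a \<in> I"
    using assms by (auto simp: cstar_ideal_def)
  have "closedin (cstar_topology A) I" using assms by (simp add: cstar_ideal_def closed_subspace_def)
  then show "(\<And>n. Y n \<in> I) \<Longrightarrow> tends Y y \<Longrightarrow> y \<in> I"
    unfolding closed_iff_sequentially_closed by blast
  show "x \<ominus> y \<in> I" if "x \<in> I" "y \<in> I"
    using that * by (simp add: minus_eq_scale subset_eq)
qed

text \<open>With \<open>e = p - x\<close>, all elements \<open>p - e\<^sup>N\<close> lie in the ideal, and \<open>e\<^sup>N\<close> tends to \<open>0\<close>. It suffices to follow the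
exponents \<open>N = 2\<^sup>n\<close>.\<close>

lemma projection_in_ideal:
  assumes I: "cstar_ideal A I" and x: "x \<in> I"
    and p: "p \<in> carrier A" "p \<otimes> p = p" "p \<otimes> x = x" "x \<otimes> p = x"
    and near: "nrm A (p \<ominus> x) < 1"
  shows "p \<in> I"
proof -
  define e where "e = p \<ominus> x"
  define E where "E = iterated_square e"
  have xc: "x \<in> carrier A" using x ideal_closed(1)[OF I] by blast
  have e: "e \<in> carrier A" using p xc by (simp add: e_def)
  have E: "E n \<in> carrier A" for n by (induction n) (simp_all add: E_def e)
  have pe: "p \<otimes> e = e" "p \<ominus> e = x"
    using p xc by (simp_all add: e_def mult_minus_right) (simp add: a_minus_def minus_add minus_minus r_neg2)
  have pE: "p \<otimes> E n = E n" for n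
  proof (induction n)
    case 0 then show ?case using pe by (simp add: E_def)
  next
    case (Suc n)
    then show ?case using mult_assoc[of p "E n" "E n"] E[of n] p by (simp add: E_def)
  qed
  have in_I: "p \<ominus> E n \<in> I" for n
  proof (induction n)
    case 0 then show ?case using x pe by (simp add: E_def)
  next
    case (Suc n)
    have "p \<ominus> E (Suc n) = (p \<ominus> E n) \<oplus> (E n \<ominus> E n \<otimes> E n)"
      using p E[of n] minus_split[of p "E n" "E n \<otimes> E n"] by (simp add: E_def)
    also have "E n \<ominus> E n \<otimes> E n = (p \<ominus> E n) \<otimes> E n" using p E[of n] pE[of n] by (simp add: mult_minus_left)
    finally show ?case using ideal_closed(3)[OF I Suc] ideal_closed(6)[OF I Suc E] by simp
  qed
  have bound: "nrm A (E n) \<le> nrm A e ^ (2 ^ n)" for n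
  proof (induction n)
    case (Suc n)
    have "nrm A (E (Suc n)) \<le> nrm A (E n) * nrm A (E n)" using nrm_mult E[of n] by (simp add: E_def)
    also have "\<dots> \<le> nrm A e ^ (2 ^ n) * nrm A e ^ (2 ^ n)" using Suc e E[of n] by (intro mult_mono) auto
    finally show ?case by (simp add: mult_2 power_add)
  qed (simp add: E_def)
  have "tends (\<lambda>n. p \<ominus> E n) p"
  proof (rule tendsI)
    fix n :: nat
    have "(p \<ominus> E n) \<ominus> p = \<ominus> E n"
      using p E by (simp add: a_minus_def a_comm[of p] a_assoc r_neg)
    then have "nrm A ((p \<ominus> E n) \<ominus> p) \<le> nrm A e ^ (2 ^ n)" using bound[of n] E by (simp add: nrm_minus)
    also have "\<dots> \<le> nrm A e ^ n" using near e by (intro power_decreasing) (auto simp: e_def less_imp_le)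
    finally show "nrm A ((p \<ominus> E n) \<ominus> p) \<le> nrm A e ^ n" .
    show "(\<lambda>n. nrm A e ^ n) \<longlonglongrightarrow> 0"
      using near e by (intro LIMSEQ_realpow_zero) (auto simp: e_def)
  qed (use p E in auto)
  then show ?thesis by (rule ideal_closed(8)[OF I in_I])
qed

lemma iterated_square_self_adjoint:
  assumes "c \<in> carrier A" "adj A c = c"
  shows "iterated_square c n \<in> carrier A \<and> adj A (iterated_square c n) = iterated_square c n \<and> nrm A (iterated_square c n) = nrm A c ^ (2 ^ n)"
proof (induction n)
  case (Suc n)
  then show ?case
    by (simp add: adj_mult nrm_square_self_adjoint power_mult[symmetric] mult.commute)
qed (use assms in simp)

lemma cstar_subalgebra_closure:
  assumes D: "D \<subseteq> carrier A" "\<zero> \<in> D" "\<And>x y. x \<in> D \<Longrightarrow> y \<in> D \<Longrightarrow> x \<oplus> y \<in> D" "\<And>c x. x \<in> D \<Longrightarrow> c \<odot> x \<in> D"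
    "\<And>x y. x \<in> D \<Longrightarrow> y \<in> D \<Longrightarrow> x \<otimes> y \<in> D" "\<And>x. x \<in> D \<Longrightarrow> adj A x \<in> D"
  shows "cstar_subalgebra A (cstar_topology A closure_of D)"
proof -
  define S where "S = cstar_topology A closure_of D"
  have iff: "x \<in> S \<longleftrightarrow> (\<exists>X. (\<forall>n. X n \<in> D) \<and> tends X x)" for x
  proof
    assume "x \<in> S"
    then have x: "x \<in> carrier A" "\<And>r. r > 0 \<Longrightarrow> \<exists>y\<in>D. nrm A (x \<ominus> y) < r"
      using closure_iff[OF D(1)] by (auto simp: S_def)
    have "\<forall>n. \<exists>y\<in>D. nrm A (x \<ominus> y) < inverse (real (Suc n))" using x(2) by simp
    then obtain X where X: "\<And>n. X n \<in> D" "\<And>n. nrm A (x \<ominus> X n) < inverse (real (Suc n))" by metis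
    have Xc: "X n \<in> carrier A" for n using X D(1) by blast
    have "tends X x"
    proof (rule tendsI)
      show "nrm A (X n \<ominus> x) \<le> inverse (real (Suc n))" for n
        using X(2)[of n] Xc x(1) nrm_minus_commute[of x "X n"] by simp
      show "(\<lambda>n. inverse (real (Suc n))) \<longlonglongrightarrow> 0" by (rule LIMSEQ_inverse_real_of_nat)
    qed (use x Xc in auto)
    then show "\<exists>X. (\<forall>n. X n \<in> D) \<and> tends X x" using X by blast
  next
    assume "\<exists>X. (\<forall>n. X n \<in> D) \<and> tends X x"
    then obtain X where X: "\<And>n. X n \<in> D" "tends X x" by blast
    have "closedin (cstar_topology A) S" by (simp add: S_def)
    moreover have "D \<subseteq> S"
      unfolding S_def by (rule closure_of_subset) (use D(1) in \<open>simp add: Metric_space.topspace_mtopology[OF Metric_space]\<close>)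
    ultimately show "x \<in> S" using X unfolding closed_iff_sequentially_closed by blast
  qed
  have "closed_subspace A S"
    unfolding closed_subspace_def
  proof (intro conjI ballI allI)
    show "closedin (cstar_topology A) S" by (simp add: S_def)
    then show "S \<subseteq> carrier A" by (simp add: closed_iff_sequentially_closed)
    show "\<zero> \<in> S" unfolding iff using D(2) by (intro exI[of _ "\<lambda>_. \<zero>"]) (simp add: tends_const)
    fix x assume "x \<in> S"
    then obtain X where X: "\<And>n. X n \<in> D" "tends X x" unfolding iff by blast
    show "c \<odot> x \<in> S" for c unfolding iff using X D(4) tends_scale[OF X(2)] by (intro exI[of _ "\<lambda>n. c \<odot> X n"]) simp
    fix y assume "y \<in> S"
    then obtain Y where Y: "\<And>n. Y n \<in> D" "tends Y y" unfolding iff by blast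
    show "x \<oplus> y \<in> S" unfolding iff using X Y D(3) tends_add[OF X(2) Y(2)] by (intro exI[of _ "\<lambda>n. X n \<oplus> Y n"]) simp
  qed
  moreover have "x \<otimes> y \<in> S" if "x \<in> S" "y \<in> S" for x y
    using that tends_mult D(5) unfolding iff by meson
  moreover have "adj A x \<in> S" if "x \<in> S" for x
    using that tends_adj D(6) unfolding iff by meson
  ultimately show ?thesis by (simp add: cstar_subalgebra_def S_def)
qed

end

section \<open>Homomorphisms and their kernels\<close>

text \<open>Let \<open>a\<close> be self-adjoint with \<open>\<parallel>a\<parallel> < 1\<close>, and take \<open>y\<close> from \<open>half_square_fixpoint\<close>. Its defining equation is
preserved by \<open>f\<close> and bounds \<open>\<parallel>f(a)\<parallel>\<close> by \<open>1\<close>. Scaling and the C*-identity give the general case.\<close>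

lemma cstar_hom_contractive:
  assumes A: "cstar_algebra A" and B: "cstar_algebra B" and f: "cstar_hom A B f" and x: "x \<in> carrier A"
  shows "nrm B (f x) \<le> nrm A x"
proof -
  interpret A: cstar A by (intro cstar.intro A)
  interpret B: cstar B by (intro cstar.intro B)
  have f_closed: "f a \<in> carrier B" and f_scale: "f (c \<odot>\<^bsub>A\<^esub> a) = c \<odot>\<^bsub>B\<^esub> f a"
    and f_adj: "f (adj A a) = adj B (f a)" if "a \<in> carrier A" for a c
    using f that by (simp_all add: cstar_hom_def)
  have f_add: "f (a \<oplus>\<^bsub>A\<^esub> b) = f a \<oplus>\<^bsub>B\<^esub> f b" and f_mult: "f (a \<otimes>\<^bsub>A\<^esub> b) = f a \<otimes>\<^bsub>B\<^esub> f b"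
    if "a \<in> carrier A" "b \<in> carrier A" for a b
    using f that by (simp_all add: cstar_hom_def)
  have unit: "nrm B (f a) \<le> 1" if a: "a \<in> carrier A" "adj A a = a" "nrm A a < 1" for a
  proof -
    obtain y where y: "y \<in> carrier A" "adj A y = y" "y \<otimes>\<^bsub>A\<^esub> a = a \<otimes>\<^bsub>A\<^esub> y"
        "2 \<odot>\<^bsub>A\<^esub> y = a \<otimes>\<^bsub>A\<^esub> a \<oplus>\<^bsub>A\<^esub> y \<otimes>\<^bsub>A\<^esub> y"
      using A.half_square_fixpoint[OF a] by blast
    show ?thesis
    proof (rule B.nrm_le_one_of_square_identity[where y = "f y"])
      show "2 \<odot>\<^bsub>B\<^esub> f y = f a \<otimes>\<^bsub>B\<^esub> f a \<oplus>\<^bsub>B\<^esub> f y \<otimes>\<^bsub>B\<^esub> f y"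
        using f_scale[OF y(1), of 2] a y by (simp add: f_add f_mult)
      show "f y \<otimes>\<^bsub>B\<^esub> f a = f a \<otimes>\<^bsub>B\<^esub> f y" using f_mult[OF y(1) a(1)] f_mult[OF a(1) y(1)] y(3) by simp
    qed (use a y f_closed in \<open>simp_all flip: f_adj\<close>)
  qed
  have sa: "nrm B (f a) \<le> nrm A a" if a: "a \<in> carrier A" "adj A a = a" for a
  proof (rule dense_ge)
    fix t assume t: "nrm A a < t"
    then have t0: "t > 0" using A.nrm_nonneg[OF a(1)] by linarith
    have "nrm B (f (complex_of_real (1 / t) \<odot>\<^bsub>A\<^esub> a)) \<le> 1"
      using a t t0 by (intro unit) (simp_all add: A.adj_smult A.nrm_smult norm_divide)
    then show "nrm B (f a) \<le> t" using a t0 f_closed[OF a(1)] by (simp add: f_scale B.nrm_smult norm_divide field_simps)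
  qed
  have "(nrm B (f x))\<^sup>2 = nrm B (f (adj A x \<otimes>\<^bsub>A\<^esub> x))"
    using x f_closed by (simp add: f_mult f_adj B.nrm_adj_mult)
  also have "\<dots> \<le> nrm A (adj A x \<otimes>\<^bsub>A\<^esub> x)" using x by (intro sa) (auto simp: A.adj_mult)
  also have "\<dots> = (nrm A x)\<^sup>2" using x by (rule A.nrm_adj_mult)
  finally show ?thesis by (rule power2_le_imp_le) (simp add: x)
qed

text \<open>The kernel is closed because homomorphisms are continuous.\<close>

lemma kernel_ideal:
  assumes A: "cstar_algebra A" and B: "cstar_algebra B" and f: "cstar_hom A B f"
  shows "cstar_ideal A {x \<in> carrier A. f x = \<zero>\<^bsub>B\<^esub>}"
proof -
  interpret A: cstar A by (intro cstar.intro A)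
  interpret B: cstar B by (intro cstar.intro B)
  have f_closed: "f a \<in> carrier B" and f_scale: "f (c \<odot>\<^bsub>A\<^esub> a) = c \<odot>\<^bsub>B\<^esub> f a" if "a \<in> carrier A" for a c
    using f that by (simp_all add: cstar_hom_def)
  have f_add: "f (a \<oplus>\<^bsub>A\<^esub> b) = f a \<oplus>\<^bsub>B\<^esub> f b" and f_mult: "f (a \<otimes>\<^bsub>A\<^esub> b) = f a \<otimes>\<^bsub>B\<^esub> f b"
    if "a \<in> carrier A" "b \<in> carrier A" for a b
    using f that by (simp_all add: cstar_hom_def)
  have f_zero: "f \<zero>\<^bsub>A\<^esub> = \<zero>\<^bsub>B\<^esub>" using f_scale[of "\<zero>\<^bsub>A\<^esub>" 0] f_closed by (simp add: A.scale_zero B.scale_zero)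
  have "y \<in> carrier A \<and> f y = \<zero>\<^bsub>B\<^esub>" if Y: "\<And>n. Y n \<in> carrier A" "\<And>n. f (Y n) = \<zero>\<^bsub>B\<^esub>" and lim: "A.tends Y y" for Y y
  proof -
    note y = A.tendsD(1)[OF lim]
    have "nrm B (f y) \<le> nrm A (Y n \<ominus>\<^bsub>A\<^esub> y)" for n
      using cstar_hom_contractive[OF A B f, of "Y n \<ominus>\<^bsub>A\<^esub> y"] Y y f_closed[OF y]
      by (simp add: A.minus_eq_scale f_add f_scale B.nrm_smult)
    then have "nrm B (f y) \<le> 0" using A.tendsD(3)[OF lim] by (intro LIMSEQ_le_const) auto
    then have "f y = \<zero>\<^bsub>B\<^esub>" using B.nrm_nonneg[OF f_closed[OF y]] B.nrm_eq_0[OF f_closed[OF y]] by simp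
    then show ?thesis using y by simp
  qed
  then have "closedin (cstar_topology A) {x \<in> carrier A. f x = \<zero>\<^bsub>B\<^esub>}"
    unfolding A.closed_iff_sequentially_closed by blast
  then show ?thesis
    by (simp add: cstar_ideal_def closed_subspace_def f_zero f_add f_scale f_mult f_closed)
qed

section \<open>The Hilbert space of square-summable functions\<close>

definition square_summable :: "('x \<Rightarrow> complex) \<Rightarrow> bool" where
  "square_summable f \<longleftrightarrow> (\<lambda>x. (cmod (f x))\<^sup>2) summable_on UNIV"

typedef 'x ell2 = "{f :: 'x \<Rightarrow> complex. square_summable f}"
  morphisms ell2_apply Ell2
  by (intro exI[of _ "\<lambda>_. 0"]) (simp add: square_summable_def)

lemma square_summable_apply [simp]: "square_summable (ell2_apply f)"
  using ell2_apply by blast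

lemma ell2_eqI: "(\<And>x. ell2_apply f x = ell2_apply g x) \<Longrightarrow> f = g"
  by (metis ell2_apply_inject ext)

lemma square_summableD: "square_summable f \<Longrightarrow> (\<lambda>x. (cmod (f x))\<^sup>2) summable_on UNIV"
  by (simp add: square_summable_def)

lemma square_summableI_finite:
  assumes "\<And>F. finite F \<Longrightarrow> (\<Sum>x\<in>F. (cmod (f x))\<^sup>2) \<le> C"
  shows "square_summable f" "(\<Sum>\<^sub>\<infinity>x. (cmod (f x))\<^sup>2) \<le> C"
proof -
  show *: "square_summable f"
    unfolding square_summable_def
    by (rule nonneg_bdd_above_summable_on) (auto intro!: bdd_aboveI[of _ C] assms)
  show "(\<Sum>\<^sub>\<infinity>x. (cmod (f x))\<^sup>2) \<le> C"
    by (rule infsum_le_finite_sums[OF square_summableD[OF *]]) (simp add: assms)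
qed

lemma square_summable_products:
  assumes "square_summable f" "square_summable g"
  shows "(\<lambda>x. cmod (f x) * cmod (g x)) summable_on UNIV"
proof (rule summable_on_comparison_test)
  show "(\<lambda>x. (cmod (f x))\<^sup>2 + (cmod (g x))\<^sup>2) summable_on UNIV"
    by (intro summable_on_add square_summableD assms)
  fix x
  have "0 \<le> (cmod (f x) - cmod (g x))\<^sup>2" by simp
  then have "2 * (cmod (f x) * cmod (g x)) \<le> (cmod (f x))\<^sup>2 + (cmod (g x))\<^sup>2" by (simp add: power2_diff)
  moreover have "0 \<le> cmod (f x) * cmod (g x)" by simp
  ultimately show "cmod (f x) * cmod (g x) \<le> (cmod (f x))\<^sup>2 + (cmod (g x))\<^sup>2" by linarith
qed simp

lemma square_summable_inner:
  assumes "square_summable f" "square_summable g"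
  shows "(\<lambda>x. f x \<bullet> g x) summable_on UNIV"
proof (rule abs_summable_summable)
  show "(\<lambda>x. norm (f x \<bullet> g x)) summable_on UNIV"
    by (rule summable_on_comparison_test[OF square_summable_products[OF assms]]) (auto simp: Cauchy_Schwarz_ineq2)
qed

lemma square_summable_add:
  assumes "square_summable f" "square_summable g" shows "square_summable (\<lambda>x. f x + g x)"
  unfolding square_summable_def
proof (rule summable_on_comparison_test)
  show "(\<lambda>x. 2 * (cmod (f x))\<^sup>2 + 2 * (cmod (g x))\<^sup>2) summable_on UNIV"
    by (intro summable_on_add summable_on_cmult_right square_summableD assms)
  fix x
  have "(cmod (f x + g x))\<^sup>2 \<le> (cmod (f x) + cmod (g x))\<^sup>2" by (simp add: norm_triangle_ineq power_mono)
  moreover have "0 \<le> (cmod (f x) - cmod (g x))\<^sup>2" by simp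
  ultimately show "(cmod (f x + g x))\<^sup>2 \<le> 2 * (cmod (f x))\<^sup>2 + 2 * (cmod (g x))\<^sup>2"
    by (simp add: power2_diff power2_sum)
qed simp

lemma square_summable_scale: "square_summable f \<Longrightarrow> square_summable (\<lambda>x. c * f x)"
  unfolding square_summable_def by (simp add: norm_mult power_mult_distrib summable_on_cmult_right)

instantiation ell2 :: (type) real_inner
begin

definition "0 = Ell2 (\<lambda>_. 0)"
definition "f + g = Ell2 (\<lambda>x. ell2_apply f x + ell2_apply g x)"
definition "- f = Ell2 (\<lambda>x. - ell2_apply f x)"
definition "f - g = f + (- g)" for f g :: "'a ell2"
definition "c *\<^sub>R f = Ell2 (\<lambda>x. c *\<^sub>R ell2_apply f x)"
definition "f \<bullet> g = (\<Sum>\<^sub>\<infinity>x. ell2_apply f x \<bullet> ell2_apply g x)"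
definition "norm f = sqrt (f \<bullet> f)" for f :: "'a ell2"
definition "dist f g = norm (f - g)" for f g :: "'a ell2"
definition "sgn f = scaleR (inverse (norm f)) f" for f :: "'a ell2"
definition "uniformity = (INF e\<in>{0<..}. principal {(x :: 'a ell2, y). dist x y < e})"
definition "open U = (\<forall>x\<in>U. \<forall>\<^sub>F (x', y) in uniformity. x' = x \<longrightarrow> y \<in> U)" for U :: "'a ell2 set"

lemma ell2_apply_simps [simp]:
  "ell2_apply 0 x = 0"
  "ell2_apply (f + g) x = ell2_apply f x + ell2_apply g x"
  "ell2_apply (- f) x = - ell2_apply f x"
  "ell2_apply (f - g) x = ell2_apply f x - ell2_apply g x"
  "ell2_apply (c *\<^sub>R f) x = c *\<^sub>R ell2_apply f x"
proof -
  have neg: "ell2_apply (- g) = (\<lambda>x. - ell2_apply g x)" for g :: "'a ell2"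
    using square_summable_scale[of "ell2_apply g" "-1"] by (simp add: uminus_ell2_def Ell2_inverse)
  have add: "ell2_apply (f + g) = (\<lambda>x. ell2_apply f x + ell2_apply g x)" for f g :: "'a ell2"
    by (simp add: plus_ell2_def Ell2_inverse square_summable_add)
  show "ell2_apply 0 x = 0" by (simp add: zero_ell2_def Ell2_inverse square_summable_def)
  show "ell2_apply (f + g) x = ell2_apply f x + ell2_apply g x" by (simp add: add)
  show "ell2_apply (- f) x = - ell2_apply f x" by (simp add: neg)
  show "ell2_apply (f - g) x = ell2_apply f x - ell2_apply g x" by (simp add: minus_ell2_def add neg)
  show "ell2_apply (c *\<^sub>R f) x = c *\<^sub>R ell2_apply f x"
    using square_summable_scale[of "ell2_apply f" "of_real c"] by (simp add: scaleR_ell2_def Ell2_inverse scaleR_conv_of_real)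
qed

instance
proof
  fix f g h :: "'a ell2" and a b :: real
  show "f + g + h = f + (g + h)" "f + g = g + f" "0 + f = f" "- f + f = 0" "f - g = f + - g"
    "a *\<^sub>R (f + g) = a *\<^sub>R f + a *\<^sub>R g" "(a + b) *\<^sub>R f = a *\<^sub>R f + b *\<^sub>R f"
    "a *\<^sub>R b *\<^sub>R f = (a * b) *\<^sub>R f" "1 *\<^sub>R f = f"
    by (rule ell2_eqI, simp add: algebra_simps)+
  show "dist f g = norm (f - g)" "sgn f = inverse (norm f) *\<^sub>R f" "norm f = sqrt (f \<bullet> f)"
    by (simp_all add: dist_ell2_def sgn_ell2_def norm_ell2_def)
  show "uniformity = (INF e\<in>{0<..}. principal {(x :: 'a ell2, y). dist x y < e})"
    by (simp add: uniformity_ell2_def)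
  show "open U = (\<forall>x\<in>U. \<forall>\<^sub>F (x', y) in uniformity. x' = x \<longrightarrow> y \<in> U)" for U :: "'a ell2 set"
    by (simp add: open_ell2_def)
  show "f \<bullet> g = g \<bullet> f" by (simp add: inner_ell2_def inner_commute)
  show "(f + g) \<bullet> h = f \<bullet> h + g \<bullet> h"
    by (simp add: inner_ell2_def inner_add_left infsum_add square_summable_inner)
  show "(a *\<^sub>R f) \<bullet> g = a * (f \<bullet> g)"
    by (simp add: inner_ell2_def infsum_cmult_right square_summable_inner)
  show "0 \<le> f \<bullet> f" by (simp add: inner_ell2_def infsum_nonneg)
  show "f \<bullet> f = 0 \<longleftrightarrow> f = 0"
  proof
    assume "f \<bullet> f = 0"
    then have "ell2_apply f x \<bullet> ell2_apply f x = 0" for x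
      unfolding inner_ell2_def
      by (intro nonneg_infsum_le_0D[of "\<lambda>x. ell2_apply f x \<bullet> ell2_apply f x" UNIV]) (auto simp: square_summable_inner)
    then show "f = 0" by (intro ell2_eqI) simp
  qed (simp add: inner_ell2_def)
qed

end

lemma norm_ell2_power2: "(norm f)\<^sup>2 = (\<Sum>\<^sub>\<infinity>x. (cmod (ell2_apply f x))\<^sup>2)" for f :: "'x ell2"
  unfolding power2_norm_eq_inner[of f] by (simp add: inner_ell2_def power2_norm_eq_inner)

lemma finite_sum_le_norm: "finite F \<Longrightarrow> (\<Sum>x\<in>F. (cmod (ell2_apply f x))\<^sup>2) \<le> (norm f)\<^sup>2" for f :: "'x ell2"
  unfolding norm_ell2_power2 by (rule finite_sum_le_infsum) (auto simp: square_summableD)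

lemma ell2_apply_le_norm: "cmod (ell2_apply f x) \<le> norm f" for f :: "'x ell2"
proof (rule power2_le_imp_le)
  show "(cmod (ell2_apply f x))\<^sup>2 \<le> (norm f)\<^sup>2" using finite_sum_le_norm[of "{x}" f] by simp
qed simp

lemma ell2I_finite:
  assumes "\<And>F. finite F \<Longrightarrow> (\<Sum>x\<in>F. (cmod (f x))\<^sup>2) \<le> C\<^sup>2" "0 \<le> C"
  shows "square_summable f" "ell2_apply (Ell2 f) = f" "norm (Ell2 f) \<le> C"
proof -
  show *: "square_summable f" using square_summableI_finite(1)[OF assms(1)] .
  then show eq: "ell2_apply (Ell2 f) = f" by (simp add: Ell2_inverse)
  have "(norm (Ell2 f))\<^sup>2 \<le> C\<^sup>2"
    unfolding norm_ell2_power2 eq by (rule square_summableI_finite(2)[OF assms(1)])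
  then show "norm (Ell2 f) \<le> C" using assms(2) by (rule power2_le_imp_le)
qed

text \<open>A Cauchy sequence converges pointwise, and the estimates on finite sets of points pass to the limit.\<close>

instance ell2 :: (type) banach
proof
  fix X :: "nat \<Rightarrow> 'a ell2" assume X: "Cauchy X"
  have "Cauchy (\<lambda>n. ell2_apply (X n) x)" for x
  proof (rule CauchyI)
    fix e :: real assume "e > 0"
    then obtain N where N: "\<forall>m\<ge>N. \<forall>n\<ge>N. norm (X m - X n) < e" using CauchyD[OF X] by blast
    moreover have "cmod (ell2_apply (X m) x - ell2_apply (X n) x) \<le> norm (X m - X n)" for m n
      using ell2_apply_le_norm[of "X m - X n" x] by simp
    ultimately show "\<exists>N. \<forall>m\<ge>N. \<forall>n\<ge>N. cmod (ell2_apply (X m) x - ell2_apply (X n) x) < e"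
      by (meson le_less_trans)
  qed
  then have "\<exists>l. (\<lambda>n. ell2_apply (X n) x) \<longlonglongrightarrow> l" for x
    using Cauchy_convergent convergent_def by metis
  then obtain l where l: "\<And>x. (\<lambda>n. ell2_apply (X n) x) \<longlonglongrightarrow> l x" by metis
  have bound: "(\<Sum>x\<in>F. (cmod (l x - ell2_apply (X n) x))\<^sup>2) \<le> e\<^sup>2"
    if e: "\<forall>m\<ge>N. \<forall>n\<ge>N. norm (X m - X n) < e" "n \<ge> N" "finite F" for e N n F
  proof (rule LIMSEQ_le_const2)
    show "(\<lambda>m. \<Sum>x\<in>F. (cmod (ell2_apply (X m) x - ell2_apply (X n) x))\<^sup>2) \<longlonglongrightarrow> (\<Sum>x\<in>F. (cmod (l x - ell2_apply (X n) x))\<^sup>2)"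
      by (intro tendsto_intros l)
    have "(\<Sum>x\<in>F. (cmod (ell2_apply (X m) x - ell2_apply (X n) x))\<^sup>2) \<le> e\<^sup>2" if "m \<ge> N" for m
      using finite_sum_le_norm[OF e(3), of "X m - X n"] e(1)[rule_format, OF that e(2)]
        power_mono[of "norm (X m - X n)" e 2] by simp
    then show "\<exists>N. \<forall>m\<ge>N. (\<Sum>x\<in>F. (cmod (ell2_apply (X m) x - ell2_apply (X n) x))\<^sup>2) \<le> e\<^sup>2" by blast
  qed
  obtain N1 where N1: "\<forall>m\<ge>N1. \<forall>n\<ge>N1. norm (X m - X n) < 1" using CauchyD[OF X, of 1] by auto
  have "square_summable (\<lambda>x. l x - ell2_apply (X N1) x)"
    using ell2I_finite(1)[of "\<lambda>x. l x - ell2_apply (X N1) x" 1] bound[OF N1 order_refl] by simp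
  then have "square_summable (\<lambda>x. (l x - ell2_apply (X N1) x) + ell2_apply (X N1) x)"
    by (rule square_summable_add) simp
  then have l_apply: "ell2_apply (Ell2 l) = l" by (simp add: Ell2_inverse)
  have "X \<longlonglongrightarrow> Ell2 l"
  proof (rule LIMSEQ_I)
    fix e :: real assume e: "e > 0"
    then obtain N where N: "\<forall>m\<ge>N. \<forall>n\<ge>N. norm (X m - X n) < e / 2" using CauchyD[OF X, of "e / 2"] by auto
    have "norm (X n - Ell2 l) < e" if n: "n \<ge> N" for n
    proof -
      have "Ell2 l - X n = Ell2 (\<lambda>x. l x - ell2_apply (X n) x)"
        using ell2I_finite(2)[of "\<lambda>x. l x - ell2_apply (X n) x" "e/2"] bound[OF N n] e
        by (intro ell2_eqI) (simp add: l_apply)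
      then have "norm (Ell2 l - X n) \<le> e / 2"
        using ell2I_finite(3)[of "\<lambda>x. l x - ell2_apply (X n) x" "e/2"] bound[OF N n] e by simp
      then show ?thesis using e by (simp add: norm_minus_commute)
    qed
    then show "\<exists>N. \<forall>n\<ge>N. norm (X n - Ell2 l) < e" by blast
  qed
  then show "convergent X" by (auto simp: convergent_def)
qed

section \<open>The C*-algebra of operators on \<open>\<ell>\<^sup>2\<close>\<close>

lemma norm_le_ell2: "norm f \<le> norm g" if "\<And>x. cmod (ell2_apply f x) \<le> cmod (ell2_apply g x)" for f g :: "'x ell2"
proof (rule power2_le_imp_le)
  show "(norm f)\<^sup>2 \<le> (norm g)\<^sup>2"
    unfolding norm_ell2_power2 using that by (intro infsum_mono square_summableD) (auto intro: power_mono)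
qed simp

text \<open>The space is a real inner product space, so multiplication by \<open>\<i>\<close> is an operator on it. Complex linear operators are
the real linear ones that commute with this operator, and the adjoint of such an operator for the real inner product is its complex
adjoint.\<close>

definition imult :: "'x ell2 \<Rightarrow> 'x ell2" where
  "imult f = Ell2 (\<lambda>x. \<i> * ell2_apply f x)"

lemma imult_apply [simp]: "ell2_apply (imult f) x = \<i> * ell2_apply f x"
  by (simp add: imult_def Ell2_inverse square_summable_scale)

lemma imult_imult [simp]: "imult (imult f) = - f"
  by (rule ell2_eqI) simp

lemma norm_imult [simp]: "norm (imult f) = norm f"
  by (intro antisym norm_le_ell2) (simp_all add: norm_mult)

lemma bounded_linear_imult: "bounded_linear imult"
  by (rule bounded_linear_intro[of _ 1]) (auto intro: ell2_eqI simp: algebra_simps)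

lemma inner_imult: "imult f \<bullet> g = - (f \<bullet> imult g)"
proof -
  have "ell2_apply (imult f) x \<bullet> ell2_apply g x = - (ell2_apply f x \<bullet> ell2_apply (imult g) x)" for x
    by (simp add: inner_complex_def)
  then show ?thesis by (simp only: inner_ell2_def infsum_uminus)
qed

lemma inner_imult_self: "f \<bullet> imult f = 0"
  using inner_imult[of f f] by (simp add: inner_commute)

type_synonym 'x op = "'x ell2 \<Rightarrow>\<^sub>L 'x ell2"

definition I_op :: "'x op" where "I_op = Blinfun imult"

lemma I_op_apply [simp]: "blinfun_apply I_op f = imult f"
  by (simp add: I_op_def bounded_linear_Blinfun_apply bounded_linear_imult)

definition is_adjoint :: "'x op \<Rightarrow> 'x op \<Rightarrow> bool" where
  "is_adjoint T S \<longleftrightarrow> (\<forall>f g. blinfun_apply T f \<bullet> g = f \<bullet> blinfun_apply S g)"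

lemma is_adjoint_unique: "is_adjoint T S \<Longrightarrow> is_adjoint T S' \<Longrightarrow> S = S'"
  by (intro blinfun_eqI) (metis is_adjoint_def vector_eq_rdot inner_commute)

lemma is_adjoint_sym: "is_adjoint T S \<Longrightarrow> is_adjoint S T"
  by (simp add: is_adjoint_def inner_commute)

definition op_adj :: "'x op \<Rightarrow> 'x op" where
  "op_adj T = (THE S. is_adjoint T S)"

lemma op_adj_eq: "is_adjoint T S \<Longrightarrow> op_adj T = S"
  unfolding op_adj_def by (rule the_equality) (auto intro: is_adjoint_unique)

definition op_scale :: "complex \<Rightarrow> 'x op \<Rightarrow> 'x op" where
  "op_scale c T = Re c *\<^sub>R T + Im c *\<^sub>R (I_op o\<^sub>L T)"

text \<open>Requiring an adjoint to exist avoids the representation of functionals: the condition is closed under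
norm limits.\<close>

definition op_carrier :: "'x op set" where
  "op_carrier = {T. (\<forall>f. blinfun_apply T (imult f) = imult (blinfun_apply T f)) \<and> (\<exists>S. is_adjoint T S)}"

definition op_algebra :: "'x op cstar" where
  "op_algebra = \<lparr>carrier = op_carrier, mult = (o\<^sub>L), one = id_blinfun, zero = 0, add = (+),
    smult = op_scale, adj = op_adj, nrm = norm\<rparr>"

lemma op_scale_apply: "blinfun_apply (op_scale c T) f = Re c *\<^sub>R blinfun_apply T f + Im c *\<^sub>R imult (blinfun_apply T f)"
  by (simp add: op_scale_def blinfun.add_left blinfun.scaleR_left)

lemma op_scale_apply_ell2: "ell2_apply (blinfun_apply (op_scale c T) f) x = c * ell2_apply (blinfun_apply T f) x"
  by (simp add: op_scale_apply scaleR_conv_of_real) (metis complex_eq distrib_right mult.assoc mult.commute)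

lemma op_eqI: "(\<And>f x. ell2_apply (blinfun_apply T f) x = ell2_apply (blinfun_apply S f) x) \<Longrightarrow> T = S"
  by (intro blinfun_eqI ell2_eqI)

lemma op_carrierI:
  "(\<And>f. blinfun_apply T (imult f) = imult (blinfun_apply T f)) \<Longrightarrow> is_adjoint T S \<Longrightarrow> T \<in> op_carrier"
  by (auto simp: op_carrier_def)

lemma op_carrier_adj: assumes "T \<in> op_carrier" shows "is_adjoint T (op_adj T)" "op_adj T \<in> op_carrier"
proof -
  obtain S where S: "is_adjoint T S" "\<And>f. T (imult f) = imult (T f)" using assms by (auto simp: op_carrier_def)
  have "S (imult g) = imult (S g)" for g
  proof -
    have "f \<bullet> S (imult g) = f \<bullet> imult (S g)" for f
    proof -
      have "f \<bullet> S (imult g) = T f \<bullet> imult g" using S(1) by (simp add: is_adjoint_def)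
      also have "\<dots> = - (T (imult f) \<bullet> g)" using inner_imult[of "T f" g] by (simp add: S(2))
      also have "\<dots> = f \<bullet> imult (S g)" using S(1) inner_imult[of f "S g"] by (simp add: is_adjoint_def)
      finally show ?thesis .
    qed
    then show ?thesis by (metis vector_eq_ldot)
  qed
  then show "op_adj T \<in> op_carrier" using S by (auto simp: op_adj_eq intro: op_carrierI is_adjoint_sym)
  show "is_adjoint T (op_adj T)" using S(1) op_adj_eq by metis
qed

lemma imult_linear: "imult (f + g) = imult f + imult g" "imult (a *\<^sub>R f) = a *\<^sub>R imult f"
  by (auto intro!: ell2_eqI simp: algebra_simps)

lemma is_adjoint_compose: "is_adjoint T S \<Longrightarrow> is_adjoint T' S' \<Longrightarrow> is_adjoint (T o\<^sub>L T') (S' o\<^sub>L S)"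
  by (simp add: is_adjoint_def)

lemma is_adjoint_add: "is_adjoint T S \<Longrightarrow> is_adjoint T' S' \<Longrightarrow> is_adjoint (T + T') (S + S')"
  by (simp add: is_adjoint_def blinfun.add_left inner_add_left inner_add_right)

lemma is_adjoint_scale: 
  assumes "is_adjoint T S" "S \<in> op_carrier" shows "is_adjoint (op_scale c T) (op_scale (cnj c) S)"
proof -
  have "imult (T f) \<bullet> g = - (f \<bullet> imult (S g))" for f g
    using assms inner_imult[of "T f" g] by (simp add: is_adjoint_def op_carrier_def)
  then show ?thesis using assms
    by (simp add: is_adjoint_def op_scale_apply inner_add_left inner_add_right inner_diff_right)
qed

lemma op_closed:
  assumes "T \<in> op_carrier" "S \<in> op_carrier"
  shows "T + S \<in> op_carrier" "T o\<^sub>L S \<in> op_carrier" "op_scale c T \<in> op_carrier"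
  using assms is_adjoint_add[OF op_carrier_adj(1)[OF assms(1)] op_carrier_adj(1)[OF assms(2)]]
    is_adjoint_compose[OF op_carrier_adj(1)[OF assms(1)] op_carrier_adj(1)[OF assms(2)]]
    is_adjoint_scale[OF op_carrier_adj(1,2)[OF assms(1)], of c]
  by (auto simp: op_carrier_def blinfun.add_left imult_linear op_scale_apply)

lemma zero_op_carrier: "0 \<in> op_carrier"
  by (rule op_carrierI[of _ 0]) (auto intro: ell2_eqI simp: is_adjoint_def)

lemma norm_op_scale: "norm (op_scale c T) = cmod c * norm T"
proof -
  have pt: "norm (op_scale c T f) = cmod c * norm (T f)" for f
  proof -
    have "(norm (op_scale c T f))\<^sup>2 = (cmod c * norm (T f))\<^sup>2"
      unfolding op_scale_apply power2_norm_eq_inner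
      by (simp add: inner_add_left inner_add_right inner_imult_self inner_imult power_mult_distrib cmod_power2 
        power2_norm_eq_inner inner_commute[of "imult (T f)"]) (simp add: algebra_simps power2_eq_square)
    then show ?thesis by (metis mult_nonneg_nonneg norm_ge_zero power2_eq_imp_eq)
  qed
  have le: "norm (op_scale c T) \<le> cmod c * norm T"
    by (rule norm_blinfun_bound) (auto simp: pt mult.assoc intro: mult_left_mono norm_blinfun)
  have "cmod c * norm T \<le> norm (op_scale c T)" 
  proof (cases "c = 0")
    case False
    have "norm T \<le> norm (op_scale c T) / cmod c"
    proof (rule norm_blinfun_bound)
      fix f
      have "cmod c * norm (T f) \<le> norm (op_scale c T) * norm f" using norm_blinfun[of "op_scale c T" f] pt by simp
      then show "norm (T f) \<le> norm (op_scale c T) / cmod c * norm f" using False by (simp add: field_simps)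
    qed simp
    then show ?thesis using False by (simp add: field_simps)
  qed simp
  with le show ?thesis by simp
qed

lemma norm_op_adjoint:
  assumes "is_adjoint T S" shows "norm S = norm T" "norm (S o\<^sub>L T) = (norm T)\<^sup>2"
proof -
  have le: "norm T \<le> norm S" "(norm T)\<^sup>2 \<le> norm (S o\<^sub>L T)" if "is_adjoint T S" for T S :: "'x op"
  proof -
    have bound: "norm T \<le> sqrt (norm (S o\<^sub>L T))"
    proof (rule norm_blinfun_bound)
      fix f
      have "(norm (T f))\<^sup>2 = f \<bullet> (S o\<^sub>L T) f"
        using that by (simp add: is_adjoint_def power2_norm_eq_inner)
      also have "\<dots> \<le> norm f * norm ((S o\<^sub>L T) f)" by (rule norm_cauchy_schwarz)
      also have "\<dots> \<le> norm f * (norm (S o\<^sub>L T) * norm f)" by (intro mult_left_mono norm_blinfun) simp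
      finally have "(norm (T f))\<^sup>2 \<le> (sqrt (norm (S o\<^sub>L T)) * norm f)\<^sup>2"
        by (simp add: power_mult_distrib power2_eq_square[of "norm f"] ac_simps)
      then show "norm (T f) \<le> sqrt (norm (S o\<^sub>L T)) * norm f" by (rule power2_le_imp_le) simp
    qed simp
    then have "(norm T)\<^sup>2 \<le> (sqrt (norm (S o\<^sub>L T)))\<^sup>2" by (intro power_mono) auto
    then show 2: "(norm T)\<^sup>2 \<le> norm (S o\<^sub>L T)" by simp
    have "norm (S o\<^sub>L T) \<le> norm S * norm T" by (rule norm_blinfun_compose)
    then have "norm T * norm T \<le> norm S * norm T" using 2 by (simp add: power2_eq_square)
    then show "norm T \<le> norm S" by (cases "norm T = 0") (auto simp: mult_le_cancel_right)
  qed
  show eq: "norm S = norm T" using le(1)[OF assms] le(1)[OF is_adjoint_sym[OF assms]] by simp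
  have "norm (S o\<^sub>L T) \<le> norm S * norm T" by (rule norm_blinfun_compose)
  then show "norm (S o\<^sub>L T) = (norm T)\<^sup>2" using le(2)[OF assms] eq by (simp add: power2_eq_square)
qed

lemma op_algebra_simps [simp]:
  "carrier op_algebra = op_carrier" "mult op_algebra = (o\<^sub>L)" "zero op_algebra = 0" "add op_algebra = (+)"
  "smult op_algebra = op_scale" "adj op_algebra = op_adj" "nrm op_algebra = norm"
  by (simp_all add: op_algebra_def)

lemma cring_complex_ring: "cring complex_ring"
  by (intro cringI abelian_groupI comm_monoidI)
    (auto simp: complex_ring_def algebra_simps intro: exI[of _ "- _"])

lemma abelian_group_op: "abelian_group op_algebra"
proof (rule abelian_groupI)
  fix T :: "'a op" assume "T \<in> carrier op_algebra"
  then have "op_scale (-1) T \<in> op_carrier" "op_scale (-1) T + T = 0"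
    using op_closed(3) by (auto intro!: blinfun_eqI simp: op_scale_apply blinfun.add_left)
  then show "\<exists>y\<in>carrier op_algebra. y \<oplus>\<^bsub>op_algebra\<^esub> T = \<zero>\<^bsub>op_algebra\<^esub>" by auto
qed (auto simp: op_closed zero_op_carrier)

lemma op_minus: assumes "T \<in> op_carrier" "S \<in> op_carrier" shows "T \<ominus>\<^bsub>op_algebra\<^esub> S = T - S"
proof -
  interpret abelian_group op_algebra by (rule abelian_group_op)
  have "op_scale (-1) S = - S" by (intro blinfun_eqI) (simp add: op_scale_apply blinfun.minus_left)
  then have "- S \<in> op_carrier" using op_closed(3)[OF assms(2,2), of "-1"] by simp
  then have "\<ominus>\<^bsub>op_algebra\<^esub> S = - S" using assms by (intro minus_equality) auto
  then show ?thesis by (simp add: a_minus_def)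
qed

lemma finsum_op: "finite F \<Longrightarrow> (\<And>i. i \<in> F \<Longrightarrow> f i \<in> op_carrier) \<Longrightarrow> finsum op_algebra f F = sum f F"
proof (induction F rule: finite_induct)
  interpret abelian_group op_algebra by (rule abelian_group_op)
  case empty then show ?case by simp
next
  interpret abelian_group op_algebra by (rule abelian_group_op)
  case (insert i F)
  then have "f \<in> F \<rightarrow> carrier op_algebra" "f i \<in> carrier op_algebra" by auto
  then show ?case using insert by (simp add: finsum_insert)
qed

lemma op_scale_algebra:
  "op_scale (c + c') T = op_scale c T + op_scale c' T" "op_scale c (T + S) = op_scale c T + op_scale c S"
  "op_scale (c * c') T = op_scale c (op_scale c' T)" "op_scale 1 T = T"
  "op_scale c T o\<^sub>L S = op_scale c (T o\<^sub>L S)"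
  by (rule op_eqI, simp add: op_scale_apply_ell2 blinfun.add_left algebra_simps)+

lemma op_scale_compose_right: "T \<in> op_carrier \<Longrightarrow> T o\<^sub>L op_scale c S = op_scale c (T o\<^sub>L S)"
  by (rule blinfun_eqI) (simp add: op_scale_apply blinfun.add_right blinfun.scaleR_right op_carrier_def)

lemma module_op: "module complex_ring op_algebra"
  by (rule moduleI) (auto simp: abelian_group_op cring_complex_ring op_closed op_scale_algebra)

lemma op_Metric_space: "Metric_space op_carrier (cstar_dist op_algebra)"
proof -
  have d: "cstar_dist op_algebra T S = (if T \<in> op_carrier \<and> S \<in> op_carrier then norm (T - S) else 0)" for T S :: "'a op"
    by (simp add: cstar_dist_def op_minus)
  show ?thesis
  proof
    fix T S R :: "'a op"
    show "0 \<le> cstar_dist op_algebra T S" by (simp add: d)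
    show "cstar_dist op_algebra T S = cstar_dist op_algebra S T" by (simp add: d norm_minus_commute[of T S])
    show "T \<in> op_carrier \<Longrightarrow> S \<in> op_carrier \<Longrightarrow> cstar_dist op_algebra T S = 0 \<longleftrightarrow> T = S" by (simp add: d)
    show "T \<in> op_carrier \<Longrightarrow> S \<in> op_carrier \<Longrightarrow> R \<in> op_carrier \<Longrightarrow>
        cstar_dist op_algebra T R \<le> cstar_dist op_algebra T S + cstar_dist op_algebra S R"
      using dist_triangle[of T R S] by (simp add: d dist_norm)
  qed
qed

text \<open>Taking adjoints is isometric, so the adjoints of a Cauchy sequence converge, to an adjoint of the limit.\<close>

lemma op_mcomplete: "Metric_space.mcomplete (carrier op_algebra) (cstar_dist op_algebra)"
proof -
  interpret M: Metric_space op_carrier "cstar_dist op_algebra" by (rule op_Metric_space)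
  have "\<exists>T. limitin M.mtopology \<sigma> T sequentially" if \<sigma>: "M.MCauchy \<sigma>" for \<sigma> :: "nat \<Rightarrow> 'a op"
  proof -
    have c: "\<sigma> n \<in> op_carrier" for n using \<sigma> by (auto simp: M.MCauchy_def)
    have d: "cstar_dist op_algebra (\<sigma> m) (\<sigma> n) = norm (\<sigma> m - \<sigma> n)" for m n
      using c by (simp add: cstar_dist_def op_minus)
    have C: "Cauchy \<sigma>"
    proof (rule CauchyI)
      fix e :: real assume "e > 0"
      then obtain N where "\<forall>m n. N \<le> m \<longrightarrow> N \<le> n \<longrightarrow> norm (\<sigma> m - \<sigma> n) < e"
        using \<sigma> by (auto simp: M.MCauchy_def d)
      then show "\<exists>N. \<forall>m\<ge>N. \<forall>n\<ge>N. norm (\<sigma> m - \<sigma> n) < e" by (intro exI[of _ N]) simp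
    qed
    have adj_diff: "norm (op_adj (\<sigma> m) - op_adj (\<sigma> n)) = norm (\<sigma> m - \<sigma> n)" for m n
      using op_carrier_adj(1)[OF c[of m]] op_carrier_adj(1)[OF c[of n]]
      by (intro norm_op_adjoint) (simp add: is_adjoint_def blinfun.diff_left inner_diff_left inner_diff_right)
    have "Cauchy (\<lambda>n. op_adj (\<sigma> n))"
      using CauchyD[OF C] by (intro CauchyI) (simp add: adj_diff)
    then obtain S where S: "(\<lambda>n. op_adj (\<sigma> n)) \<longlonglongrightarrow> S" using Cauchy_convergent convergent_def by blast
    obtain T where T: "\<sigma> \<longlonglongrightarrow> T" using C Cauchy_convergent convergent_def by blast
    have Tf: "(\<lambda>n. \<sigma> n f) \<longlonglongrightarrow> T f" "(\<lambda>n. op_adj (\<sigma> n) f) \<longlonglongrightarrow> S f" for f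
      by (intro tendsto_intros T S)+
    have "is_adjoint T S"
      unfolding is_adjoint_def
    proof (intro allI)
      fix f g
      have "(\<lambda>n. \<sigma> n f \<bullet> g) \<longlonglongrightarrow> T f \<bullet> g" "(\<lambda>n. f \<bullet> op_adj (\<sigma> n) g) \<longlonglongrightarrow> f \<bullet> S g"
        by (intro tendsto_intros Tf)+
      moreover have "\<sigma> n f \<bullet> g = f \<bullet> op_adj (\<sigma> n) g" for n
        using op_carrier_adj(1)[OF c] by (simp add: is_adjoint_def)
      ultimately show "T f \<bullet> g = f \<bullet> S g" using LIMSEQ_unique by auto
    qed
    moreover have "T (imult f) = imult (T f)" for f
    proof -
      have "(\<lambda>n. imult (\<sigma> n f)) \<longlonglongrightarrow> imult (T f)" by (rule bounded_linear.tendsto[OF bounded_linear_imult Tf(1)])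
      moreover have "imult (\<sigma> n f) = \<sigma> n (imult f)" for n using c by (simp add: op_carrier_def)
      ultimately show ?thesis using Tf(1)[of "imult f"] LIMSEQ_unique by auto
    qed
    ultimately have TC: "T \<in> op_carrier" by (intro op_carrierI)
    have "(\<lambda>n. norm (\<sigma> n - T)) \<longlonglongrightarrow> 0" using T by (simp add: LIM_zero tendsto_norm_zero)
    then have "limitin M.mtopology \<sigma> T sequentially"
      using TC c by (simp add: M.limitin_metric_dist_null cstar_dist_def op_minus)
    then show ?thesis ..
  qed
  then show ?thesis by (simp add: M.mcomplete_def)
qed

lemma op_adj_simps:
  assumes T: "T \<in> op_carrier"
  shows "op_adj T \<in> op_carrier" "op_adj (op_adj T) = T" "op_adj (op_scale c T) = op_scale (cnj c) (op_adj T)"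
    "norm (op_adj T o\<^sub>L T) = (norm T)\<^sup>2" "S \<in> op_carrier \<Longrightarrow> op_adj (T + S) = op_adj T + op_adj S"
    "S \<in> op_carrier \<Longrightarrow> op_adj (T o\<^sub>L S) = op_adj S o\<^sub>L op_adj T"
  using op_carrier_adj[OF T] op_adj_eq[OF is_adjoint_sym[OF op_carrier_adj(1)[OF T]]] norm_op_adjoint[OF op_carrier_adj(1)[OF T]]
    op_adj_eq[OF is_adjoint_scale[OF op_carrier_adj[OF T]]] op_adj_eq[OF is_adjoint_add[OF op_carrier_adj(1)[OF T] op_carrier_adj(1)]]
    op_adj_eq[OF is_adjoint_compose[OF op_carrier_adj(1)[OF T] op_carrier_adj(1)]]
  by auto

lemma cstar_algebra_op: "cstar_algebra op_algebra"
proof -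
  interpret module complex_ring op_algebra by (rule module_op)
  have distrib: "(T + S) o\<^sub>L R = (T o\<^sub>L R) + (S o\<^sub>L R)" "R o\<^sub>L (T + S) = (R o\<^sub>L T) + (R o\<^sub>L S)"
      "(T o\<^sub>L S) o\<^sub>L R = T o\<^sub>L (S o\<^sub>L R)" for T S R :: "'a op"
    by (auto intro!: blinfun_eqI simp: blinfun.add_left blinfun.add_right)
  show ?thesis
    by unfold_locales (auto simp: op_closed op_adj_simps distrib op_scale_algebra op_scale_compose_right norm_op_scale
      norm_blinfun_compose norm_triangle_ineq op_mcomplete[simplified])
qed

section \<open>Partial isometries from partial injections\<close>

text \<open>A partial injection \<open>g\<close> acts on functions by \<open>f \<mapsto> f \<circ> g\<close>, extended by \<open>0\<close> where \<open>g\<close> is undefined. Composition of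
operators then corresponds to composition of partial maps in the opposite order, and the adjoint to the converse.\<close>

definition pull :: "('x \<Rightarrow> 'x option) \<Rightarrow> 'x ell2 \<Rightarrow> 'x ell2" where
  "pull g f = Ell2 (\<lambda>y. case g y of None \<Rightarrow> 0 | Some x \<Rightarrow> ell2_apply f x)"

definition converse_maps :: "('x \<Rightarrow> 'x option) \<Rightarrow> ('x \<Rightarrow> 'x option) \<Rightarrow> bool" where
  "converse_maps g h \<longleftrightarrow> (\<forall>x y. g y = Some x \<longleftrightarrow> h x = Some y)"

lemma converse_maps_sym: "converse_maps g h \<Longrightarrow> converse_maps h g"
  by (simp add: converse_maps_def)

lemma pull_bound:
  assumes gh: "converse_maps g h" and F: "finite F"
  shows "(\<Sum>y\<in>F. (cmod (case g y of None \<Rightarrow> 0 | Some x \<Rightarrow> ell2_apply f x))\<^sup>2) \<le> (norm f)\<^sup>2"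
proof -
  define G where "G = {y \<in> F. g y \<noteq> None}"
  have inj: "inj_on (\<lambda>y. the (g y)) G"
  proof (rule inj_onI)
    fix y z assume "y \<in> G" "z \<in> G" "the (g y) = the (g z)"
    then obtain x where "g y = Some x" "g z = Some x" by (auto simp: G_def)
    then have "h x = Some y" "h x = Some z" using gh by (simp_all add: converse_maps_def)
    then show "y = z" by simp
  qed
  have "(\<Sum>y\<in>F. (cmod (case g y of None \<Rightarrow> 0 | Some x \<Rightarrow> ell2_apply f x))\<^sup>2) = (\<Sum>y\<in>G. (cmod (ell2_apply f (the (g y))))\<^sup>2)"
    using F by (intro sum.mono_neutral_cong_right) (auto simp: G_def)
  also have "\<dots> = (\<Sum>x\<in>(\<lambda>y. the (g y)) ` G. (cmod (ell2_apply f x))\<^sup>2)" by (simp add: sum.reindex[OF inj])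
  also have "\<dots> \<le> (norm f)\<^sup>2" using F by (intro finite_sum_le_norm) (simp add: G_def)
  finally show ?thesis .
qed

lemma pull_apply:
  assumes "converse_maps g h"
  shows "ell2_apply (pull g f) y = (case g y of None \<Rightarrow> 0 | Some x \<Rightarrow> ell2_apply f x)"
  unfolding pull_def using ell2I_finite(2)[OF pull_bound[OF assms, of _ f]] by simp

lemma norm_pull: "converse_maps g h \<Longrightarrow> norm (pull g f) \<le> norm f"
  unfolding pull_def by (rule ell2I_finite(3)[OF pull_bound]) auto

lemma bounded_linear_pull: "converse_maps g h \<Longrightarrow> bounded_linear (pull g)"
  by (rule bounded_linear_intro[of _ 1])
    (auto intro: ell2_eqI norm_pull simp: pull_apply split: option.splits)

definition pull_op :: "('x \<Rightarrow> 'x option) \<Rightarrow> 'x op" where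
  "pull_op g = Blinfun (pull g)"

lemma pull_op_apply:
  "converse_maps g h \<Longrightarrow> ell2_apply (blinfun_apply (pull_op g) f) y = (case g y of None \<Rightarrow> 0 | Some x \<Rightarrow> ell2_apply f x)"
  by (simp add: pull_op_def bounded_linear_Blinfun_apply[OF bounded_linear_pull] pull_apply)

lemma is_adjoint_pull:
  assumes gh: "converse_maps g h" shows "is_adjoint (pull_op g) (pull_op h)"
  unfolding is_adjoint_def
proof (intro allI)
  fix f k :: "'a ell2"
  note hg = converse_maps_sym[OF gh]
  define D where "D = {y. g y \<noteq> None}"
  define E where "E = {x. h x \<noteq> None}"
  have gD: "\<And>x y. g y = Some x \<Longrightarrow> h x = Some y" and hD: "\<And>x y. h x = Some y \<Longrightarrow> g y = Some x"
    using gh by (simp_all add: converse_maps_def)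
  have hg_inv: "the (h (the (g y))) = y" if y: "y \<in> D" for y
  proof -
    obtain x where "g y = Some x" using y by (auto simp: D_def)
    then show ?thesis using gD[of y x] by simp
  qed
  have bij: "bij_betw (\<lambda>y. the (g y)) D E"
  proof (rule bij_betwI[where g = "\<lambda>x. the (h x)"])
    show "(\<lambda>y. the (g y)) \<in> D \<rightarrow> E" "(\<lambda>x. the (h x)) \<in> E \<rightarrow> D" 
      by (auto simp: D_def E_def) (use gD hD in blast)+
    show "the (h (the (g y))) = y" if "y \<in> D" for y using that by (rule hg_inv)
    show "the (g (the (h x))) = x" if x: "x \<in> E" for x
    proof -
      obtain y where "h x = Some y" using x by (auto simp: E_def)
      then show ?thesis using hD[of x y] by simp
    qed
  qed
  have "blinfun_apply (pull_op g) f \<bullet> k = (\<Sum>\<^sub>\<infinity>y\<in>D. ell2_apply f (the (g y)) \<bullet> ell2_apply k y)"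
    unfolding inner_ell2_def by (rule infsum_cong_neutral) (auto simp: pull_op_apply[OF gh] D_def)
  also have "\<dots> = (\<Sum>\<^sub>\<infinity>y\<in>D. ell2_apply f (the (g y)) \<bullet> ell2_apply k (the (h (the (g y)))))"
    by (intro infsum_cong) (simp add: hg_inv)
  also have "\<dots> = (\<Sum>\<^sub>\<infinity>x\<in>E. ell2_apply f x \<bullet> ell2_apply k (the (h x)))"
    by (rule infsum_reindex_bij_betw[OF bij, of "\<lambda>x. ell2_apply f x \<bullet> ell2_apply k (the (h x))"])
  also have "\<dots> = f \<bullet> blinfun_apply (pull_op h) k"
    unfolding inner_ell2_def by (rule infsum_cong_neutral) (auto simp: pull_op_apply[OF hg] E_def)
  finally show "blinfun_apply (pull_op g) f \<bullet> k = f \<bullet> blinfun_apply (pull_op h) k" .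
qed

lemma pull_op_carrier: "converse_maps g h \<Longrightarrow> pull_op g \<in> op_carrier"
  by (rule op_carrierI[OF _ is_adjoint_pull])
    (auto intro!: ell2_eqI simp: pull_op_apply split: option.splits)

lemma op_adj_pull: "converse_maps g h \<Longrightarrow> op_adj (pull_op g) = pull_op h"
  by (rule op_adj_eq[OF is_adjoint_pull])

lemma pull_op_compose:
  assumes "converse_maps g h" "converse_maps g' h'" "converse_maps k l" "\<And>y. k y = Option.bind (g y) g'"
  shows "pull_op g o\<^sub>L pull_op g' = pull_op k"
  by (rule op_eqI) (auto simp: pull_op_apply[OF assms(1)] pull_op_apply[OF assms(2)] pull_op_apply[OF assms(3)] assms(4)
      split: option.splits bind_splits)

lemma exists_unit_vector: "\<exists>f. ell2_apply f x = 1"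
proof -
  have "(\<Sum>y\<in>F. (cmod (if y = x then 1 else 0))\<^sup>2) \<le> (1::real)\<^sup>2" if "finite F" for F
  proof -
    have "(\<Sum>y\<in>F. (cmod (if y = x then 1 else 0))\<^sup>2) = (\<Sum>y\<in>F. if y = x then 1 else 0)" by (intro sum.cong) auto
    also have "\<dots> \<le> 1" using that by (simp add: sum.delta)
    finally show ?thesis by simp
  qed
  from ell2I_finite(2)[OF this] show ?thesis by (intro exI[of _ "Ell2 (\<lambda>y. if y = x then 1 else 0)"]) simp
qed

section \<open>Paths and their prefixes\<close>

context kgraph
begin

abbreviation edges :: "'a \<Rightarrow> 'k \<Rightarrow> 'a set" where
  "edges v i \<equiv> from_range \<Lambda> v (deg_paths \<Lambda> (unit_vec i))"

abbreviation comp (infixl "\<cdot>" 70) where "\<eta> \<cdot> \<mu> \<equiv> cmp \<Lambda> \<eta> \<mu>"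

abbreviation r where "r \<equiv> rng \<Lambda>"
abbreviation s where "s \<equiv> src \<Lambda>"
abbreviation d where "d \<equiv> deg \<Lambda>"
abbreviation P where "P \<equiv> paths \<Lambda>"

declare rng_in_paths [simp] src_in_paths [simp] rng_rng [simp] src_rng [simp] rng_src [simp] src_src [simp]
  cmp_in_paths [simp] rng_cmp [simp] src_cmp [simp] cmp_rng [simp] cmp_src [simp] deg_cmp [simp]
  deg_rng [simp] deg_src [simp]

lemma factorise:
  assumes "\<zeta> \<in> P" "m \<le> d \<zeta>"
  obtains \<mu> \<nu> where "\<mu> \<in> P" "\<nu> \<in> P" "d \<mu> = m" "d \<nu> = d \<zeta> - m" "s \<mu> = r \<nu>" "\<zeta> = \<mu> \<cdot> \<nu>"
proof -
  have "d \<zeta> = m + (d \<zeta> - m)" using assms(2) by (simp add: vec_eq_iff less_eq_vec_def)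
  from factorisation[OF assms(1) this] that show ?thesis by blast
qed

lemma factorise_unique:
  assumes "\<mu> \<in> P" "\<nu> \<in> P" "\<mu>' \<in> P" "\<nu>' \<in> P" "s \<mu> = r \<nu>" "s \<mu>' = r \<nu>'"
    and eq: "\<mu> \<cdot> \<nu> = \<mu>' \<cdot> \<nu>'" and deg: "d \<mu> = d \<mu>'"
  shows "\<mu> = \<mu>' \<and> \<nu> = \<nu>'"
proof -
  have 1: "d (\<mu> \<cdot> \<nu>) = d \<mu> + d \<nu>" using assms(1,2,5) by simp
  have "d \<mu>' + d \<nu>' = d \<mu> + d \<nu>" using 1 assms(1-6) eq by (metis deg_cmp)
  then have "d \<nu> = d \<nu>'" using deg by simp
  define Q where "Q = (\<lambda>(x, y). x \<in> P \<and> y \<in> P \<and> d x = d \<mu> \<and> d y = d \<nu> \<and> s x = r y \<and> \<mu> \<cdot> \<nu> = x \<cdot> y)"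
  have "\<exists>!p. Q p" unfolding Q_def by (rule factorisation[OF _ 1]) (use assms(1,2,5) in simp)
  moreover have "Q (\<mu>, \<nu>)" using assms(1,2,5) by (simp add: Q_def)
  moreover have "Q (\<mu>', \<nu>')"
    using assms(3,4,6) eq deg \<open>d \<nu> = d \<nu>'\<close> unfolding Q_def prod.case by metis
  ultimately have "(\<mu>, \<nu>) = (\<mu>', \<nu>')" by blast
  then show ?thesis by simp
qed

lemma cancel_left:
  "\<lbrakk>\<mu> \<in> P; \<nu> \<in> P; \<nu>' \<in> P; s \<mu> = r \<nu>; s \<mu> = r \<nu>'; \<mu> \<cdot> \<nu> = \<mu> \<cdot> \<nu>'\<rbrakk> \<Longrightarrow> \<nu> = \<nu>'"
  using factorise_unique[of \<mu> \<nu> \<mu> \<nu>'] by blast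

lemma rng_degree_zero: assumes "v \<in> P" "d v = 0" shows "r v = v" "s v = v"
  using factorise_unique[of "r v" v v "s v"] assms by simp_all

lemma vertices_iff: "v \<in> vertices \<Lambda> \<longleftrightarrow> v \<in> P \<and> r v = v"
  using rng_degree_zero deg_rng by (fastforce simp: vertices_def deg_paths_def)

lemma vertexD: assumes "v \<in> vertices \<Lambda>" shows "v \<in> P" "r v = v" "s v = v" "d v = 0"
proof -
  show "v \<in> P" "r v = v" using assms vertices_iff by auto
  then show "s v = v" "d v = 0" using src_rng[of v] deg_rng[of v] by simp_all
qed

lemma range_vertex [simp]: "\<eta> \<in> P \<Longrightarrow> r \<eta> \<in> vertices \<Lambda>" "\<eta> \<in> P \<Longrightarrow> s \<eta> \<in> vertices \<Lambda>"
  by (simp_all add: vertices_iff)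

definition prefix :: "'a \<Rightarrow> 'a \<Rightarrow> bool" where
  "prefix \<eta> \<zeta> \<longleftrightarrow> \<eta> \<in> P \<and> (\<exists>\<alpha> \<in> P. s \<eta> = r \<alpha> \<and> \<zeta> = \<eta> \<cdot> \<alpha>)"

lemma prefixI: "\<lbrakk>\<eta> \<in> P; \<alpha> \<in> P; s \<eta> = r \<alpha>\<rbrakk> \<Longrightarrow> prefix \<eta> (\<eta> \<cdot> \<alpha>)"
  by (auto simp: prefix_def)

lemma prefixE:
  assumes "prefix \<eta> \<zeta>"
  obtains \<alpha> where "\<eta> \<in> P" "\<alpha> \<in> P" "s \<eta> = r \<alpha>" "\<zeta> = \<eta> \<cdot> \<alpha>" "d \<zeta> = d \<eta> + d \<alpha>"
  using assms that unfolding prefix_def by fastforce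

lemma prefixD:
  assumes "prefix \<eta> \<zeta>" shows "\<eta> \<in> P" "\<zeta> \<in> P" "r \<zeta> = r \<eta>" "d \<eta> \<le> d \<zeta>"
  using assms by (auto elim!: prefixE simp: less_eq_vec_def)

lemma prefix_refl: "\<eta> \<in> P \<Longrightarrow> prefix \<eta> \<eta>"
  using prefixI[of \<eta> "s \<eta>"] by simp

lemma prefix_rng: "\<eta> \<in> P \<Longrightarrow> prefix (r \<eta>) \<eta>"
  using prefixI[of "r \<eta>" \<eta>] by simp

lemma prefix_trans: assumes "prefix \<eta> \<zeta>" "prefix \<zeta> \<xi>" shows "prefix \<eta> \<xi>"
proof -
  obtain \<alpha> where \<alpha>: "\<eta> \<in> P" "\<alpha> \<in> P" "s \<eta> = r \<alpha>" "\<zeta> = \<eta> \<cdot> \<alpha>" using assms(1) by (elim prefixE)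
  obtain \<beta> where \<beta>: "\<beta> \<in> P" "s \<zeta> = r \<beta>" "\<xi> = \<zeta> \<cdot> \<beta>" using assms(2) by (elim prefixE)
  have "\<xi> = \<eta> \<cdot> (\<alpha> \<cdot> \<beta>)" using \<alpha> \<beta> by (simp add: cmp_assoc)
  then show ?thesis using prefixI[of \<eta> "\<alpha> \<cdot> \<beta>"] \<alpha> \<beta> by simp
qed

lemma prefix_exists: assumes "\<zeta> \<in> P" "m \<le> d \<zeta>" obtains \<eta> where "prefix \<eta> \<zeta>" "d \<eta> = m"
  using factorise[OF assms] prefixI by metis

lemma prefix_unique: "\<lbrakk>prefix \<eta> \<zeta>; prefix \<eta>' \<zeta>; d \<eta> = d \<eta>'\<rbrakk> \<Longrightarrow> \<eta> = \<eta>'"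
  using factorise_unique by (metis prefixE)

lemma prefix_linear:
  assumes "prefix \<eta> \<zeta>" "prefix \<eta>' \<zeta>" "d \<eta> \<le> d \<eta>'" shows "prefix \<eta> \<eta>'"
proof -
  obtain \<eta>'' where "prefix \<eta>'' \<eta>'" "d \<eta>'' = d \<eta>" using prefix_exists[OF _ assms(3)] prefixD(1)[OF assms(2)] by blast
  then show ?thesis using prefix_unique[OF _ assms(1)] prefix_trans[OF _ assms(2)] by metis
qed

lemma prefix_cmp:
  assumes "prefix \<alpha> \<beta>" "\<mu> \<in> P" "s \<mu> = r \<alpha>" shows "prefix (\<mu> \<cdot> \<alpha>) (\<mu> \<cdot> \<beta>)"
proof -
  obtain \<gamma> where \<gamma>: "\<alpha> \<in> P" "\<gamma> \<in> P" "s \<alpha> = r \<gamma>" "\<beta> = \<alpha> \<cdot> \<gamma>" using assms(1) by (elim prefixE)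
  then have "\<mu> \<cdot> \<beta> = (\<mu> \<cdot> \<alpha>) \<cdot> \<gamma>" using assms by (simp add: cmp_assoc)
  then show ?thesis using prefixI[of "\<mu> \<cdot> \<alpha>" \<gamma>] \<gamma> assms by simp
qed

lemma prefix_cmp_cancel:
  assumes "prefix (\<mu> \<cdot> \<alpha>) (\<mu> \<cdot> \<beta>)" "\<mu> \<in> P" "\<alpha> \<in> P" "\<beta> \<in> P" "s \<mu> = r \<alpha>" "s \<mu> = r \<beta>" shows "prefix \<alpha> \<beta>"
proof -
  obtain \<gamma> where \<gamma>: "\<gamma> \<in> P" "s (\<mu> \<cdot> \<alpha>) = r \<gamma>" "\<mu> \<cdot> \<beta> = (\<mu> \<cdot> \<alpha>) \<cdot> \<gamma>" using assms(1) by (elim prefixE)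
  then have "\<beta> = \<alpha> \<cdot> \<gamma>" using cancel_left[of \<mu> \<beta> "\<alpha> \<cdot> \<gamma>"] assms by (simp add: cmp_assoc)
  then show ?thesis using prefixI[of \<alpha> \<gamma>] \<gamma> assms by simp
qed

lemma le_pathsD:
  assumes "\<eta> \<in> le_paths \<Lambda> n"
  shows "\<eta> \<in> P" "d \<eta> \<le> n" "d \<eta> + unit_vec i \<le> n \<Longrightarrow> edges (s \<eta>) i = {}"
  using assms by (auto simp: le_paths_def)

lemma finite_vec_le: "finite {m :: nat ^ 'k. m \<le> n}"
proof -
  define N where "N = (\<Sum>i\<in>UNIV. n $ i)"
  have N: "n $ i \<le> N" for i unfolding N_def by (rule member_le_sum) auto
  have "{m. m \<le> n} \<subseteq> vec_lambda ` (UNIV \<rightarrow>\<^sub>E {..N})"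
  proof
    fix m assume "m \<in> {m. m \<le> n}"
    then have "m $ i \<le> N" for i using N[of i] by (auto simp: less_eq_vec_def intro: order_trans)
    then have "vec_nth m \<in> UNIV \<rightarrow>\<^sub>E {..N}" by auto
    then show "m \<in> vec_lambda ` (UNIV \<rightarrow>\<^sub>E {..N})" by (intro image_eqI[of _ _ "vec_nth m"]) simp_all
  qed
  moreover have "finite (UNIV \<rightarrow>\<^sub>E {..N} :: ('k \<Rightarrow> nat) set)" by (rule finite_PiE) auto
  ultimately show ?thesis by (meson finite_imageI finite_subset)
qed

lemma finite_le_paths:
  assumes "row_finite \<Lambda>" "v \<in> vertices \<Lambda>"
  shows "finite (from_range \<Lambda> v (le_paths \<Lambda> n))"
proof (rule finite_subset)
  show "from_range \<Lambda> v (le_paths \<Lambda> n) \<subseteq> (\<Union>m\<in>{m. m \<le> n}. from_range \<Lambda> v (deg_paths \<Lambda> m))"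
    by (auto simp: from_range_def le_paths_def deg_paths_def)
  show "finite (\<Union>m\<in>{m. m \<le> n}. from_range \<Lambda> v (deg_paths \<Lambda> m))"
    using assms finite_vec_le by (auto simp: row_finite_def)
qed

lemma exists_path_of_maximal_degree:
  assumes "\<eta>0 \<in> S" "\<And>\<eta>. \<eta> \<in> S \<Longrightarrow> d \<eta> \<le> n"
  shows "\<exists>\<eta>\<in>S. \<forall>\<zeta>\<in>S. \<forall>i. d \<zeta> \<noteq> d \<eta> + unit_vec i"
proof -
  have "finite (d ` S)" by (rule finite_subset[OF _ finite_vec_le[of n]]) (use assms(2) in auto)
  then obtain \<eta> where \<eta>: "\<eta> \<in> S" "\<And>\<zeta>. \<zeta> \<in> S \<Longrightarrow> d \<eta> \<le> d \<zeta> \<Longrightarrow> d \<eta> = d \<zeta>"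
    using finite_has_maximal[of "d ` S"] assms(1) by auto
  have "d \<zeta> \<noteq> d \<eta> + unit_vec i" if "\<zeta> \<in> S" for \<zeta> i
  proof
    assume eq: "d \<zeta> = d \<eta> + unit_vec i"
    then have "d \<eta> = d \<zeta>" using \<eta>(2)[OF that] by (simp add: less_eq_vec_def)
    then have "d \<eta> $ i = d \<eta> $ i + 1" using eq by (metis axis_nth vector_add_component)
    then show False by simp
  qed
  then show ?thesis using \<eta>(1) by blast
qed

lemma le_paths_extend:
  assumes "\<mu> \<in> P" "d \<mu> \<le> n" shows "\<exists>\<eta>. prefix \<mu> \<eta> \<and> \<eta> \<in> le_paths \<Lambda> n"
proof -
  define S where "S = {\<eta>. prefix \<mu> \<eta> \<and> d \<eta> \<le> n}"
  have S: "\<mu> \<in> S" "\<And>\<eta>. \<eta> \<in> S \<Longrightarrow> d \<eta> \<le> n" using assms prefix_refl by (simp_all add: S_def)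
  obtain \<eta> where \<eta>: "\<eta> \<in> S" "\<forall>\<zeta>\<in>S. \<forall>i. d \<zeta> \<noteq> d \<eta> + unit_vec i"
    using exists_path_of_maximal_degree[OF S] by blast
  have \<eta>P: "prefix \<mu> \<eta>" "\<eta> \<in> P" "d \<eta> \<le> n" using \<eta>(1) prefixD by (auto simp: S_def)
  have "edges (s \<eta>) i = {}" if le: "d \<eta> + unit_vec i \<le> n" for i
  proof (rule ccontr)
    assume "edges (s \<eta>) i \<noteq> {}"
    then obtain e where e: "e \<in> P" "r e = s \<eta>" "d e = unit_vec i" by (auto simp: from_range_def deg_paths_def)
    then have "\<eta> \<cdot> e \<in> S" using \<eta>P le prefix_trans[OF \<eta>P(1) prefixI[of \<eta> e]] by (simp add: S_def)
    moreover have "d (\<eta> \<cdot> e) = d \<eta> + unit_vec i" using e \<eta>P by simp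
    ultimately show False using \<eta>(2) by blast
  qed
  then show ?thesis using \<eta>P by (auto simp: le_paths_def)
qed

lemma le_paths_cmp:
  assumes "\<mu> \<in> P" "d \<mu> \<le> n" "\<eta> \<in> le_paths \<Lambda> (n - d \<mu>)" "r \<eta> = s \<mu>"
  shows "\<mu> \<cdot> \<eta> \<in> le_paths \<Lambda> n"
proof -
  note \<eta> = le_pathsD[OF assms(3)]
  have *: "(d \<mu> + x \<le> n) = (x \<le> n - d \<mu>)" for x
    using assms(2) by (simp add: less_eq_vec_def le_diff_conv2 add.commute)
  show ?thesis
    using \<eta> assms by (simp add: le_paths_def * add.assoc)
qed

text \<open>Local convexity, applied to one edge of \<open>\<beta>\<close> after the other: none of these edges has degree \<open>e\<^sub>i\<close>.\<close>

lemma edges_propagate: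
  assumes lc: "locally_convex \<Lambda>"
  shows "\<lbrakk>\<beta> \<in> P; d \<beta> $ i = 0; edges (r \<beta>) i \<noteq> {}\<rbrakk> \<Longrightarrow> edges (s \<beta>) i \<noteq> {}"
proof (induction "\<Sum>j\<in>UNIV. d \<beta> $ j" arbitrary: \<beta> rule: less_induct)
  case less
  show ?case
  proof (cases "d \<beta> = 0")
    case True
    then show ?thesis using less rng_degree_zero by simp
  next
    case False
    then obtain j where j: "d \<beta> $ j > 0" by (auto simp: vec_eq_iff)
    then have "unit_vec j \<le> d \<beta>" by (auto simp: less_eq_vec_def axis_def)
    then obtain \<mu> \<nu> where \<mu>\<nu>: "\<mu> \<in> P" "\<nu> \<in> P" "d \<mu> = unit_vec j" "d \<nu> = d \<beta> - unit_vec j" "s \<mu> = r \<nu>" "\<beta> = \<mu> \<cdot> \<nu>"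
      using factorise[OF less(2)] by blast
    have ij: "i \<noteq> j" using j less by auto
    obtain e where e: "e \<in> deg_paths \<Lambda> (unit_vec i)" "r e = r \<beta>" using less by (auto simp: from_range_def)
    have \<mu>: "\<mu> \<in> deg_paths \<Lambda> (unit_vec j)" using \<mu>\<nu> by (simp add: deg_paths_def)
    have "edges (s \<mu>) i \<noteq> {}"
      using lc[unfolded locally_convex_def, rule_format, OF ij e(1) \<mu>] e(2) \<mu>\<nu> by simp
    moreover have "(\<Sum>l\<in>UNIV. d \<nu> $ l) < (\<Sum>l\<in>UNIV. d \<beta> $ l)"
    proof (rule sum_strict_mono_ex1)
      show "\<forall>l\<in>UNIV. d \<nu> $ l \<le> d \<beta> $ l" unfolding \<mu>\<nu>(4) by simp
      have "d \<nu> $ j < d \<beta> $ j" unfolding \<mu>\<nu>(4) using j by (simp add: axis_def)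
      then show "\<exists>l\<in>UNIV. d \<nu> $ l < d \<beta> $ l" by blast
    qed simp
    moreover have "d \<nu> $ i = 0" using less(3) unfolding \<mu>\<nu>(4) by simp
    moreover have "s \<nu> = s \<beta>" using \<mu>\<nu>(1,2,5) unfolding \<mu>\<nu>(6) by simp
    ultimately show ?thesis using less(1)[of \<nu>] \<mu>\<nu>(2,5) by simp
  qed
qed

section \<open>Boundary filters\<close>

text \<open>The set of initial segments \<open>x(0, p)\<close> of a boundary path \<open>x\<close>. It determines \<open>x\<close>, and unlike the functor \<open>x\<close> it
has no irrelevant values outside its domain, so that equality of boundary paths is equality of sets.\<close>

definition boundary_filter :: "'a set \<Rightarrow> bool" where
  "boundary_filter Y \<longleftrightarrow> Y \<subseteq> P \<and> Y \<noteq> {} \<and>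
    (\<forall>\<zeta> \<in> Y. \<forall>\<eta>. prefix \<eta> \<zeta> \<longrightarrow> \<eta> \<in> Y) \<and>
    (\<forall>\<eta> \<in> Y. \<forall>\<zeta> \<in> Y. \<exists>\<xi> \<in> Y. prefix \<eta> \<xi> \<and> prefix \<zeta> \<xi>) \<and>
    (\<forall>\<eta> \<in> Y. \<forall>i. edges (s \<eta>) i \<noteq> {} \<longrightarrow> (\<exists>\<zeta> \<in> Y. prefix \<eta> \<zeta> \<and> d \<eta> $ i < d \<zeta> $ i))"

lemma boundary_filterD:
  assumes "boundary_filter Y"
  shows "\<eta> \<in> Y \<Longrightarrow> \<eta> \<in> P" "Y \<noteq> {}" "\<zeta> \<in> Y \<Longrightarrow> prefix \<eta> \<zeta> \<Longrightarrow> \<eta> \<in> Y"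
    "\<eta> \<in> Y \<Longrightarrow> \<zeta> \<in> Y \<Longrightarrow> \<exists>\<xi> \<in> Y. prefix \<eta> \<xi> \<and> prefix \<zeta> \<xi>"
    "\<eta> \<in> Y \<Longrightarrow> edges (s \<eta>) i \<noteq> {} \<Longrightarrow> \<exists>\<zeta> \<in> Y. prefix \<eta> \<zeta> \<and> d \<eta> $ i < d \<zeta> $ i"
proof -
  from assms have *: "Y \<subseteq> P" "Y \<noteq> {}" "\<forall>\<zeta> \<in> Y. \<forall>\<eta>. prefix \<eta> \<zeta> \<longrightarrow> \<eta> \<in> Y"
    "\<forall>\<eta> \<in> Y. \<forall>\<zeta> \<in> Y. \<exists>\<xi> \<in> Y. prefix \<eta> \<xi> \<and> prefix \<zeta> \<xi>"
    "\<forall>\<eta> \<in> Y. \<forall>i. edges (s \<eta>) i \<noteq> {} \<longrightarrow> (\<exists>\<zeta> \<in> Y. prefix \<eta> \<zeta> \<and> d \<eta> $ i < d \<zeta> $ i)"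
    by (simp_all add: boundary_filter_def)
  show "Y \<noteq> {}" "\<eta> \<in> Y \<Longrightarrow> \<eta> \<in> P" "\<zeta> \<in> Y \<Longrightarrow> prefix \<eta> \<zeta> \<Longrightarrow> \<eta> \<in> Y" using *(1-3) by auto
  show "\<eta> \<in> Y \<Longrightarrow> \<zeta> \<in> Y \<Longrightarrow> \<exists>\<xi> \<in> Y. prefix \<eta> \<xi> \<and> prefix \<zeta> \<xi>" using *(4) by simp
  show "\<eta> \<in> Y \<Longrightarrow> edges (s \<eta>) i \<noteq> {} \<Longrightarrow> \<exists>\<zeta> \<in> Y. prefix \<eta> \<zeta> \<and> d \<eta> $ i < d \<zeta> $ i" using *(5) by simp
qed

lemma filter_rng:
  assumes Y: "boundary_filter Y" "\<eta> \<in> Y" "\<zeta> \<in> Y" shows "r \<eta> = r \<zeta>"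
  using boundary_filterD(4)[OF Y] prefixD(3) by metis

lemma filter_vertex:
  assumes Y: "boundary_filter Y" "\<eta> \<in> Y" and v: "v \<in> vertices \<Lambda>" shows "v \<in> Y \<longleftrightarrow> r \<eta> = v"
proof
  assume "v \<in> Y"
  then show "r \<eta> = v" using filter_rng[OF Y, of v] vertexD[OF v] by simp
next
  assume "r \<eta> = v"
  then show "v \<in> Y"
    using prefix_rng[of \<eta>] boundary_filterD(1)[OF Y] boundary_filterD(3)[OF Y, of v] by simp
qed

text \<open>Existence: a member of maximal degree below \<open>n\<close> is in \<open>\<Lambda>\<^bsup>\<le>n\<^esup>\<close>, for otherwise the last clause of the definition
would extend it inside the filter. Uniqueness: two such members have a common extension in the filter, and neither can be
prolonged towards the supremum of their degrees. This is what makes the relation \<open>t\<^sub>v = \<Sum> t\<^sub>\<lambda> t\<^sub>\<lambda>*\<close> hold for operators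
on boundary filters.\<close>

lemma filter_le_path:
  assumes Y: "boundary_filter Y" shows "\<exists>!\<eta>. \<eta> \<in> Y \<and> \<eta> \<in> le_paths \<Lambda> n"
proof -
  have unique: "\<eta> = \<zeta>" if h: "\<eta> \<in> Y" "\<eta> \<in> le_paths \<Lambda> n" "\<zeta> \<in> Y" "\<zeta> \<in> le_paths \<Lambda> n" for \<eta> \<zeta>
  proof -
    obtain \<xi> where \<xi>: "\<xi> \<in> Y" "prefix \<eta> \<xi>" "prefix \<zeta> \<xi>" using boundary_filterD(4)[OF Y h(1,3)] by blast
    define j :: "nat ^ 'k" where "j = (\<chi> i. max (d \<eta> $ i) (d \<zeta> $ i))"
    have j: "j \<le> d \<xi>" "j \<le> n" "d \<eta> \<le> j" "d \<zeta> \<le> j"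
      using prefixD(4)[OF \<xi>(2)] prefixD(4)[OF \<xi>(3)] le_pathsD(2)[OF h(2)] le_pathsD(2)[OF h(4)]
      by (auto simp: less_eq_vec_def j_def)
    obtain \<omega> where \<omega>: "prefix \<omega> \<xi>" "d \<omega> = j" using prefix_exists[OF prefixD(2)[OF \<xi>(2)] j(1)] by blast
    have deg: "d \<theta> = j" if \<theta>: "\<theta> \<in> le_paths \<Lambda> n" "prefix \<theta> \<xi>" "d \<theta> \<le> j" for \<theta>
    proof (rule ccontr)
      assume "d \<theta> \<noteq> j"
      then obtain i where i: "d \<theta> $ i < j $ i" using \<theta>(3) by (auto simp: vec_eq_iff less_eq_vec_def order_less_le)
      obtain \<alpha> where \<alpha>: "\<theta> \<in> P" "\<alpha> \<in> P" "s \<theta> = r \<alpha>" "\<omega> = \<theta> \<cdot> \<alpha>" "d \<omega> = d \<theta> + d \<alpha>"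
        using prefix_linear[OF \<theta>(2) \<omega>(1)] \<theta>(3) \<omega>(2) by (metis prefixE)
      have "unit_vec i \<le> d \<alpha>" using \<alpha>(5) \<omega>(2) i by (auto simp: less_eq_vec_def axis_def vec_eq_iff)
      then obtain \<beta> where "prefix \<beta> \<alpha>" "d \<beta> = unit_vec i" using prefix_exists \<alpha> by blast
      then have "\<beta> \<in> edges (s \<theta>) i" using prefixD \<alpha> by (auto simp: from_range_def deg_paths_def)
      moreover have "d \<theta> + unit_vec i \<le> n"
        unfolding less_eq_vec_def
      proof
        fix l
        have "d \<theta> $ l \<le> n $ l" "d \<theta> $ i < n $ i" using i j(2) \<theta>(3) by (auto simp: less_eq_vec_def intro: order_trans less_le_trans)
        then show "(d \<theta> + unit_vec i) $ l \<le> n $ l" by (auto simp: axis_def)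
      qed
      ultimately show False using le_pathsD(3)[OF \<theta>(1)] by blast
    qed
    show ?thesis using deg[OF h(2) \<xi>(2) j(3)] deg[OF h(4) \<xi>(3) j(4)] prefix_unique[OF \<xi>(2,3)] by simp
  qed
  obtain \<eta>0 where \<eta>0: "\<eta>0 \<in> Y" using boundary_filterD(2)[OF Y] by blast
  define S where "S = {\<eta> \<in> Y. d \<eta> \<le> n}"
  have S: "r \<eta>0 \<in> S" "\<And>\<eta>. \<eta> \<in> S \<Longrightarrow> d \<eta> \<le> n"
    using \<eta>0 boundary_filterD(1,3)[OF Y] prefix_rng by (auto simp: S_def less_eq_vec_def)
  obtain \<eta> where \<eta>: "\<eta> \<in> S" "\<forall>\<zeta>\<in>S. \<forall>i. d \<zeta> \<noteq> d \<eta> + unit_vec i"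
    using exists_path_of_maximal_degree[OF S] by blast
  have \<eta>Y: "\<eta> \<in> Y" "d \<eta> \<le> n" "\<eta> \<in> P" using \<eta>(1) boundary_filterD(1)[OF Y] by (auto simp: S_def)
  have "edges (s \<eta>) i = {}" if le: "d \<eta> + unit_vec i \<le> n" for i
  proof (rule ccontr)
    assume "edges (s \<eta>) i \<noteq> {}"
    then obtain \<zeta> where \<zeta>: "\<zeta> \<in> Y" "prefix \<eta> \<zeta>" "d \<eta> $ i < d \<zeta> $ i"
      using boundary_filterD(5)[OF Y \<eta>Y(1)] by blast
    have "d \<eta> + unit_vec i \<le> d \<zeta>"
      using \<zeta>(3) prefixD(4)[OF \<zeta>(2)] by (auto simp: less_eq_vec_def axis_def)
    then obtain \<omega> where \<omega>: "prefix \<omega> \<zeta>" "d \<omega> = d \<eta> + unit_vec i" using prefix_exists prefixD(2)[OF \<zeta>(2)] by blast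
    then have "\<omega> \<in> S" using boundary_filterD(3)[OF Y \<zeta>(1)] le by (simp add: S_def)
    then show False using \<eta>(2) \<omega>(2) by blast
  qed
  then have "\<eta> \<in> le_paths \<Lambda> n" using \<eta>Y by (simp add: le_paths_def)
  then show ?thesis using unique \<eta>Y(1) by blast
qed

text \<open>The filter of the boundary path \<open>\<mu>y\<close>, where \<open>Y\<close> is that of \<open>y\<close>.\<close>

definition shift :: "'a \<Rightarrow> 'a set \<Rightarrow> 'a set" where
  "shift \<mu> Y = {\<alpha>. \<exists>\<eta> \<in> Y. prefix \<alpha> (\<mu> \<cdot> \<eta>)}"

text \<open>The inverse of \<open>shift\<close> on filters with \<open>\<mu> \<in> Y\<close>.\<close>

definition unshift :: "'a \<Rightarrow> 'a set \<Rightarrow> 'a set" where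
  "unshift \<mu> Y = {\<eta> \<in> P. r \<eta> = s \<mu> \<and> \<mu> \<cdot> \<eta> \<in> Y}"

lemma filter_rng_eq: assumes Y: "boundary_filter Y" "v \<in> Y" "v \<in> vertices \<Lambda>" "\<eta> \<in> Y" shows "r \<eta> = v" "\<eta> \<in> P"
  using filter_vertex[OF Y(1,4,3)] Y boundary_filterD(1) by auto

text \<open>Only the last clause of the definition needs an argument. For a member that ends inside \<open>\<mu>\<eta>\<close> and is followed there
by a path \<open>\<beta>\<close> of degree \<open>0\<close> in direction \<open>i\<close>, local convexity carries an edge of degree \<open>e\<^sub>i\<close> along \<open>\<beta>\<close> to the source of
\<open>\<eta>\<close>, where the filter \<open>Y\<close> continues in direction \<open>i\<close>.\<close>

lemma boundary_filter_shift:
  assumes lc: "locally_convex \<Lambda>" and Y: "boundary_filter Y" and \<mu>: "\<mu> \<in> P" "s \<mu> \<in> Y"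
  shows "boundary_filter (shift \<mu> Y)" "\<mu> \<in> shift \<mu> Y"
proof -
  have rs: "r \<eta> = s \<mu>" "\<eta> \<in> P" if "\<eta> \<in> Y" for \<eta>
    using filter_rng_eq[OF Y \<mu>(2) _ that] \<mu> by simp_all
  show "\<mu> \<in> shift \<mu> Y" unfolding shift_def using \<mu> prefix_refl[of \<mu>] by (auto intro!: bexI[of _ "s \<mu>"])
  moreover have "\<exists>\<xi> \<in> shift \<mu> Y. prefix \<alpha> \<xi> \<and> prefix \<beta> \<xi>" if h: "\<alpha> \<in> shift \<mu> Y" "\<beta> \<in> shift \<mu> Y" for \<alpha> \<beta>
  proof -
    obtain \<eta> \<zeta> where *: "\<eta> \<in> Y" "prefix \<alpha> (\<mu> \<cdot> \<eta>)" "\<zeta> \<in> Y" "prefix \<beta> (\<mu> \<cdot> \<zeta>)" using h by (auto simp: shift_def)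
    obtain \<xi> where \<xi>: "\<xi> \<in> Y" "prefix \<eta> \<xi>" "prefix \<zeta> \<xi>" using boundary_filterD(4)[OF Y *(1,3)] by blast
    have "\<mu> \<cdot> \<xi> \<in> shift \<mu> Y" using \<xi>(1) rs \<mu> prefix_refl[of "\<mu> \<cdot> \<xi>"] by (auto simp: shift_def intro!: bexI[of _ \<xi>])
    moreover have "prefix \<alpha> (\<mu> \<cdot> \<xi>)" "prefix \<beta> (\<mu> \<cdot> \<xi>)"
      using prefix_cmp[OF \<xi>(2) \<mu>(1)] prefix_cmp[OF \<xi>(3) \<mu>(1)] rs * prefix_trans by metis+
    ultimately show ?thesis by blast
  qed
  moreover have "\<exists>\<zeta> \<in> shift \<mu> Y. prefix \<alpha> \<zeta> \<and> d \<alpha> $ i < d \<zeta> $ i" if \<alpha>: "\<alpha> \<in> shift \<mu> Y" and i: "edges (s \<alpha>) i \<noteq> {}" for \<alpha> i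
  proof -
    obtain \<eta> where \<eta>: "\<eta> \<in> Y" "prefix \<alpha> (\<mu> \<cdot> \<eta>)" using \<alpha> by (auto simp: shift_def)
    have in_shift: "\<mu> \<cdot> \<zeta> \<in> shift \<mu> Y" if "\<zeta> \<in> Y" for \<zeta>
      using that rs \<mu> prefix_refl[of "\<mu> \<cdot> \<zeta>"] by (auto simp: shift_def intro!: bexI[of _ \<zeta>])
    obtain \<beta> where \<beta>: "\<alpha> \<in> P" "\<beta> \<in> P" "s \<alpha> = r \<beta>" "\<mu> \<cdot> \<eta> = \<alpha> \<cdot> \<beta>" "d (\<mu> \<cdot> \<eta>) = d \<alpha> + d \<beta>" using \<eta>(2) by (metis prefixE)
    show ?thesis
    proof (cases "d \<beta> $ i = 0")
      case False
      then show ?thesis using \<beta>(5) \<eta>(2) in_shift[OF \<eta>(1)] by (intro bexI[of _ "\<mu> \<cdot> \<eta>"]) auto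
    next
      case True
      have "s \<beta> = s \<eta>" using arg_cong[OF \<beta>(4), of s] \<beta>(1-3) rs[OF \<eta>(1)] \<mu> by simp
      then have "edges (s \<eta>) i \<noteq> {}" using edges_propagate[OF lc \<beta>(2) True] i \<beta>(3) by simp
      then obtain \<zeta> where \<zeta>: "\<zeta> \<in> Y" "prefix \<eta> \<zeta>" "d \<eta> $ i < d \<zeta> $ i"
        using boundary_filterD(5)[OF Y \<eta>(1)] by blast
      have "prefix \<alpha> (\<mu> \<cdot> \<zeta>)"
        using prefix_trans[OF \<eta>(2) prefix_cmp[OF \<zeta>(2) \<mu>(1)]] rs[OF \<eta>(1)] by simp
      moreover have "d \<alpha> $ i \<le> d (\<mu> \<cdot> \<eta>) $ i" using prefixD(4)[OF \<eta>(2)] by (simp add: less_eq_vec_def)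
      ultimately show ?thesis
        using in_shift[OF \<zeta>(1)] \<zeta>(3) rs[OF \<eta>(1)] rs[OF \<zeta>(1)] \<mu> by (intro bexI[of _ "\<mu> \<cdot> \<zeta>"]) auto
    qed
  qed
  moreover have "shift \<mu> Y \<subseteq> P" using prefixD(1) by (auto simp: shift_def)
  moreover have "\<eta> \<in> shift \<mu> Y" if "\<zeta> \<in> shift \<mu> Y" "prefix \<eta> \<zeta>" for \<eta> \<zeta>
    using that prefix_trans by (auto simp: shift_def)
  ultimately show "boundary_filter (shift \<mu> Y)"
    unfolding boundary_filter_def by blast
qed

lemma boundary_filter_unshift:
  assumes Y: "boundary_filter Y" and \<mu>: "\<mu> \<in> Y"
  shows "boundary_filter (unshift \<mu> Y)" "s \<mu> \<in> unshift \<mu> Y"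
proof -
  have \<mu>P: "\<mu> \<in> P" using boundary_filterD(1)[OF Y \<mu>] .
  show s: "s \<mu> \<in> unshift \<mu> Y" using \<mu> \<mu>P by (simp add: unshift_def)
  have ext: "\<exists>\<xi>\<in>unshift \<mu> Y. prefix \<eta> \<xi> \<and> \<mu> \<cdot> \<xi> = \<omega>" if "\<eta> \<in> unshift \<mu> Y" "\<omega> \<in> Y" "prefix (\<mu> \<cdot> \<eta>) \<omega>" for \<eta> \<omega>
  proof -
    have \<eta>: "\<eta> \<in> P" "r \<eta> = s \<mu>" using that by (auto simp: unshift_def)
    have "prefix \<mu> \<omega>" using prefix_trans[OF prefixI that(3)] \<eta> \<mu>P by simp
    then obtain \<xi> where \<xi>: "\<xi> \<in> P" "s \<mu> = r \<xi>" "\<omega> = \<mu> \<cdot> \<xi>" by (auto simp: prefix_def)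
    have "prefix \<eta> \<xi>"
      by (rule prefix_cmp_cancel[OF that(3)[unfolded \<xi>(3)] \<mu>P \<eta>(1) \<xi>(1) \<eta>(2)[symmetric] \<xi>(2)])
    then show ?thesis using \<xi> that(2) by (auto simp: unshift_def)
  qed
  have "\<eta> \<in> unshift \<mu> Y" if \<zeta>: "\<zeta> \<in> unshift \<mu> Y" and pre: "prefix \<eta> \<zeta>" for \<eta> \<zeta>
  proof -
    have "r \<eta> = s \<mu>" "\<eta> \<in> P" using prefixD[OF pre] \<zeta> by (auto simp: unshift_def)
    then show ?thesis
      using prefix_cmp[OF pre \<mu>P] boundary_filterD(3)[OF Y] \<zeta> by (auto simp: unshift_def)
  qed
  moreover have "\<exists>\<xi> \<in> unshift \<mu> Y. prefix \<eta> \<xi> \<and> prefix \<zeta> \<xi>" if h: "\<eta> \<in> unshift \<mu> Y" "\<zeta> \<in> unshift \<mu> Y" for \<eta> \<zeta>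
  proof -
    have *: "\<mu> \<cdot> \<eta> \<in> Y" "\<mu> \<cdot> \<zeta> \<in> Y" "\<zeta> \<in> P" "s \<mu> = r \<zeta>" using h by (auto simp: unshift_def)
    obtain \<omega> where \<omega>: "\<omega> \<in> Y" "prefix (\<mu> \<cdot> \<eta>) \<omega>" "prefix (\<mu> \<cdot> \<zeta>) \<omega>" using boundary_filterD(4)[OF Y *(1,2)] by blast
    obtain \<xi> where \<xi>: "\<xi> \<in> unshift \<mu> Y" "prefix \<eta> \<xi>" "\<mu> \<cdot> \<xi> = \<omega>" using ext[OF h(1) \<omega>(1,2)] by blast
    have "prefix (\<mu> \<cdot> \<zeta>) (\<mu> \<cdot> \<xi>)" "\<xi> \<in> P" "s \<mu> = r \<xi>" using \<omega>(3) \<xi> by (auto simp: unshift_def)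
    then have "prefix \<zeta> \<xi>" using prefix_cmp_cancel[OF _ \<mu>P *(3) _ *(4)] by blast
    then show ?thesis using \<xi> by blast
  qed
  moreover have "\<exists>\<zeta> \<in> unshift \<mu> Y. prefix \<eta> \<zeta> \<and> d \<eta> $ i < d \<zeta> $ i" if \<eta>: "\<eta> \<in> unshift \<mu> Y" and i: "edges (s \<eta>) i \<noteq> {}" for \<eta> i
  proof -
    have *: "\<mu> \<cdot> \<eta> \<in> Y" "\<eta> \<in> P" "s \<mu> = r \<eta>" using \<eta> by (auto simp: unshift_def)
    then have "edges (s (\<mu> \<cdot> \<eta>)) i \<noteq> {}" using i \<mu>P by simp
    then obtain \<omega> where \<omega>: "\<omega> \<in> Y" "prefix (\<mu> \<cdot> \<eta>) \<omega>" "d (\<mu> \<cdot> \<eta>) $ i < d \<omega> $ i"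
      using boundary_filterD(5)[OF Y *(1)] by blast
    obtain \<xi> where \<xi>: "\<xi> \<in> unshift \<mu> Y" "prefix \<eta> \<xi>" "\<mu> \<cdot> \<xi> = \<omega>" using ext[OF \<eta> \<omega>(1,2)] by blast
    have "\<xi> \<in> P" "s \<mu> = r \<xi>" using \<xi>(1) by (auto simp: unshift_def)
    then have "d \<eta> $ i < d \<xi> $ i" using \<omega>(3) \<xi>(3) * \<mu>P by auto
    then show ?thesis using \<xi> by blast
  qed
  moreover have "unshift \<mu> Y \<subseteq> P" by (auto simp: unshift_def)
  ultimately show "boundary_filter (unshift \<mu> Y)"
    unfolding boundary_filter_def using s by blast
qed

lemma unshift_shift:
  assumes Y: "boundary_filter Y" and \<mu>: "\<mu> \<in> P" "s \<mu> \<in> Y"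
  shows "unshift \<mu> (shift \<mu> Y) = Y"
proof -
  have rs: "r \<eta> = s \<mu>" "\<eta> \<in> P" if "\<eta> \<in> Y" for \<eta>
    using filter_rng_eq[OF Y \<mu>(2) _ that] \<mu> by simp_all
  have "\<eta> \<in> Y" if "\<eta> \<in> P" "r \<eta> = s \<mu>" "\<zeta> \<in> Y" "prefix (\<mu> \<cdot> \<eta>) (\<mu> \<cdot> \<zeta>)" for \<eta> \<zeta>
    by (rule boundary_filterD(3)[OF Y that(3)])
      (rule prefix_cmp_cancel[OF that(4) \<mu>(1) that(1) rs(2)[OF that(3)] that(2)[symmetric] rs(1)[OF that(3), symmetric]])
  moreover have "\<exists>\<zeta>\<in>Y. prefix (\<mu> \<cdot> \<eta>) (\<mu> \<cdot> \<zeta>)" if "\<eta> \<in> Y" for \<eta>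
    using that rs[OF that] \<mu> prefix_refl[of "\<mu> \<cdot> \<eta>"] by auto
  ultimately show ?thesis using rs by (auto simp: unshift_def shift_def)
qed

lemma shift_unshift:
  assumes Y: "boundary_filter Y" and \<mu>: "\<mu> \<in> Y"
  shows "shift \<mu> (unshift \<mu> Y) = Y"
proof -
  have \<mu>P: "\<mu> \<in> P" using boundary_filterD(1)[OF Y \<mu>] .
  have "\<alpha> \<in> shift \<mu> (unshift \<mu> Y)" if \<alpha>: "\<alpha> \<in> Y" for \<alpha>
  proof -
    obtain \<xi> where \<xi>: "\<xi> \<in> Y" "prefix \<alpha> \<xi>" "prefix \<mu> \<xi>" using boundary_filterD(4)[OF Y \<alpha> \<mu>] by blast
    obtain \<eta> where "\<eta> \<in> P" "s \<mu> = r \<eta>" "\<xi> = \<mu> \<cdot> \<eta>" using \<xi>(3) by (auto simp: prefix_def)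
    then show ?thesis using \<xi> by (auto simp: shift_def unshift_def)
  qed
  then show ?thesis using boundary_filterD(3)[OF Y] by (auto simp: shift_def unshift_def)
qed

lemma mem_unshift_cmp:
  assumes Y: "boundary_filter Y" and "\<mu> \<in> P" "\<nu> \<in> P" "s \<mu> = r \<nu>"
  shows "\<mu> \<cdot> \<nu> \<in> Y \<longleftrightarrow> \<mu> \<in> Y \<and> \<nu> \<in> unshift \<mu> Y" "unshift (\<mu> \<cdot> \<nu>) Y = unshift \<nu> (unshift \<mu> Y)"
  using boundary_filterD(3)[OF Y _ prefixI[OF assms(2-4)]] assms by (auto simp: unshift_def cmp_assoc)

section \<open>Filters that avoid a hereditary set, and boundary paths\<close>

definition hereditary :: "'a set \<Rightarrow> bool" where
  "hereditary H \<longleftrightarrow> (\<forall>\<eta> \<in> P. r \<eta> \<in> H \<longrightarrow> s \<eta> \<in> H)"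

definition avoids :: "'a set \<Rightarrow> 'a set \<Rightarrow> bool" where
  "avoids H Y \<longleftrightarrow> (\<forall>\<eta> \<in> Y. s \<eta> \<notin> H)"

lemma hereditary_prefix: assumes "hereditary H" "prefix \<eta> \<zeta>" "s \<eta> \<in> H" shows "s \<zeta> \<in> H"
proof -
  obtain \<alpha> where "\<eta> \<in> P" "\<alpha> \<in> P" "s \<eta> = r \<alpha>" "\<zeta> = \<eta> \<cdot> \<alpha>" using assms(2) by (auto simp: prefix_def)
  then show ?thesis using assms(1,3) unfolding hereditary_def by auto
qed

text \<open>Prolong \<open>w\<close> repeatedly by paths in \<open>\<Lambda>\<^bsup>\<le>(1,...,1)\<^esup>\<close> whose source is outside \<open>H\<close>. If edges of degree
\<open>e\<^sub>i\<close> leave some member, then by local convexity they leave every later member until one has been used, and the next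
prolongation has to use one.\<close>

lemma exists_avoiding_filter:
  assumes lc: "locally_convex \<Lambda>" and H: "hereditary H" and w: "w \<in> vertices \<Lambda>" "w \<notin> H"
    and ext: "\<And>u. u \<in> vertices \<Lambda> \<Longrightarrow> u \<notin> H \<Longrightarrow> \<exists>\<alpha> \<in> le_paths \<Lambda> 1. r \<alpha> = u \<and> s \<alpha> \<notin> H"
  shows "\<exists>Y. boundary_filter Y \<and> avoids H Y \<and> w \<in> Y"
proof -
  have "\<exists>L. \<forall>n. (L n \<in> P \<and> r (L n) = w \<and> s (L n) \<notin> H) \<and>
      (\<exists>\<alpha> \<in> le_paths \<Lambda> 1. r \<alpha> = s (L n) \<and> L (Suc n) = L n \<cdot> \<alpha>)"
  proof (rule dependent_nat_choice)
    show "\<exists>x. x \<in> P \<and> r x = w \<and> s x \<notin> H" using w vertexD[OF w(1)] by (intro exI[of _ w]) simp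
    fix x n assume x: "x \<in> P \<and> r x = w \<and> s x \<notin> H"
    then obtain \<alpha> where \<alpha>: "\<alpha> \<in> le_paths \<Lambda> 1" "r \<alpha> = s x" "s \<alpha> \<notin> H" using ext[of "s x"] by auto
    then show "\<exists>y. (y \<in> P \<and> r y = w \<and> s y \<notin> H) \<and> (\<exists>\<alpha>\<in>le_paths \<Lambda> 1. r \<alpha> = s x \<and> y = x \<cdot> \<alpha>)"
      using x le_pathsD(1)[OF \<alpha>(1)] by (intro exI[of _ "x \<cdot> \<alpha>"]) auto
  qed
  then obtain L where L: "\<And>n. L n \<in> P" "\<And>n. r (L n) = w" "\<And>n. s (L n) \<notin> H"
    and step: "\<And>n. \<exists>\<alpha> \<in> le_paths \<Lambda> 1. r \<alpha> = s (L n) \<and> L (Suc n) = L n \<cdot> \<alpha>" by blast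
  have pre_Suc: "prefix (L n) (L (Suc n))" for n using step[of n] L(1)[of n] le_pathsD(1) prefixI by metis
  have mono: "prefix (L m) (L n)" if "m \<le> n" for m n
    using that
  proof (induction n)
    case (Suc n)
    then show ?case using pre_Suc prefix_trans prefix_refl[OF L(1)] by (cases "m = Suc n") auto
  qed (simp add: prefix_refl L)
  define Y where "Y = {\<eta>. \<exists>n. prefix \<eta> (L n)}"
  have LY: "L n \<in> Y" for n using prefix_refl[OF L(1)] by (auto simp: Y_def)
  have "Y \<subseteq> P" using prefixD(1) by (auto simp: Y_def)
  moreover have "Y \<noteq> {}" using LY by blast
  moreover have "\<eta> \<in> Y" if "\<zeta> \<in> Y" "prefix \<eta> \<zeta>" for \<eta> \<zeta> using that prefix_trans by (auto simp: Y_def)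
  moreover have "\<exists>\<xi>\<in>Y. prefix \<eta> \<xi> \<and> prefix \<zeta> \<xi>" if h: "\<eta> \<in> Y" "\<zeta> \<in> Y" for \<eta> \<zeta>
  proof -
    obtain m n where mn: "prefix \<eta> (L m)" "prefix \<zeta> (L n)" using h by (auto simp: Y_def)
    then have "prefix \<eta> (L (max m n))" "prefix \<zeta> (L (max m n))"
      using prefix_trans[OF mn(1) mono] prefix_trans[OF mn(2) mono] by auto
    then show ?thesis using LY by blast
  qed
  moreover have "\<exists>\<zeta>\<in>Y. prefix \<eta> \<zeta> \<and> d \<eta> $ i < d \<zeta> $ i" if \<eta>: "\<eta> \<in> Y" and i: "edges (s \<eta>) i \<noteq> {}" for \<eta> i
  proof -
    \<comment> \<open>It is enough that \<open>L (Suc n)\<close> goes further than \<open>\<eta>\<close> in direction \<open>i\<close>; suppose that the rest \<open>\<beta>\<close> does not.\<close>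
    obtain n where n: "prefix \<eta> (L n)" using \<eta> by (auto simp: Y_def)
    obtain \<alpha> where \<alpha>: "\<alpha> \<in> le_paths \<Lambda> 1" "r \<alpha> = s (L n)" "L (Suc n) = L n \<cdot> \<alpha>" using step by blast
    note \<alpha>P = le_pathsD[OF \<alpha>(1)]
    have pre: "prefix \<eta> (L (Suc n))" using prefix_trans[OF n pre_Suc] .
    obtain \<beta> where \<beta>: "\<eta> \<in> P" "\<beta> \<in> P" "s \<eta> = r \<beta>" "L (Suc n) = \<eta> \<cdot> \<beta>" "d (L (Suc n)) = d \<eta> + d \<beta>"
      using pre by (rule prefixE)
    have "d \<beta> $ i \<noteq> 0"
    proof
      assume 0: "d \<beta> $ i = 0"
      then have "edges (s \<beta>) i \<noteq> {}" using edges_propagate[OF lc \<beta>(2)] i \<beta>(3) by simp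
      moreover have "s \<beta> = s \<alpha>" using \<alpha> \<alpha>P(1) \<beta>(1-4) L(1)[of n] by (metis src_cmp)
      moreover have "d \<alpha> + unit_vec i \<le> 1"
      proof -
        have "d (L (Suc n)) $ i = d (L n) $ i + d \<alpha> $ i" using \<alpha> \<alpha>P(1) L(1) by simp
        moreover have "d \<eta> $ i \<le> d (L n) $ i" using prefixD(4)[OF n] by (simp add: less_eq_vec_def)
        ultimately have "d \<alpha> $ i = 0" using \<beta>(5) 0 by simp
        then show ?thesis using \<alpha>P(2) by (auto simp: less_eq_vec_def axis_def)
      qed
      ultimately show False using \<alpha>P(3) by simp
    qed
    then show ?thesis using \<beta>(5) pre LY by (intro bexI[of _ "L (Suc n)"]) auto
  qed
  ultimately have "boundary_filter Y" unfolding boundary_filter_def by blast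
  moreover have "avoids H Y" using hereditary_prefix[OF H] L(3) by (auto simp: avoids_def Y_def)
  moreover have "w \<in> Y" using prefix_rng[OF L(1), of 0] L(2) by (auto simp: Y_def)
  ultimately show ?thesis by blast
qed

lemma enat_vec_le:
  fixes p q :: "nat ^ 'k" assumes "p \<le> q" "enat_vec q \<le> m" shows "enat_vec p \<le> m"
  unfolding less_eq_vec_def
proof
  fix i
  have "enat (p $ i) \<le> enat (q $ i)" using assms(1) by (simp add: less_eq_vec_def)
  also have "\<dots> \<le> m $ i" using assms(2) by (simp add: less_eq_vec_def enat_vec_def)
  finally show "enat_vec p $ i \<le> m $ i" by (simp add: enat_vec_def)
qed

text \<open>The degree is the supremum of the degrees in the filter. Each \<open>p\<close> below it is the degree of exactly one member
\<open>y(p)\<close>, and \<open>x(p, q)\<close> is the remainder of \<open>y(q)\<close> after \<open>y(p)\<close>.\<close>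

lemma boundary_path_of_filter:
  assumes Y: "boundary_filter Y"
  shows "\<exists>m x. boundary_path \<Lambda> m x \<and> (\<forall>n. enat_vec n \<le> m \<longrightarrow> (\<exists>\<eta> \<in> Y. x (n, n) = s \<eta>))"
proof -
  define m where "m = (\<chi> i. SUP \<eta>\<in>Y. enat (d \<eta> $ i))"
  have ex: "\<exists>\<eta>\<in>Y. d \<eta> = p" if p: "enat_vec p \<le> m" for p
  proof -
    have one: "\<exists>\<eta>\<in>Y. p $ i \<le> d \<eta> $ i" for i
    proof (rule ccontr)
      assume "\<not> ?thesis"
      then have lt: "d \<eta> $ i < p $ i" if "\<eta> \<in> Y" for \<eta> using that by (meson not_le)
      have "p $ i > 0" using lt boundary_filterD(2)[OF Y] by fastforce
      \<comment> \<open>A supremum of integers below \<open>p\<^sub>i\<close> stays below \<open>p\<^sub>i\<close>.\<close>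
      have "m $ i \<le> enat (p $ i - 1)"
        unfolding m_def by (simp, rule SUP_least) (use lt in fastforce)
      moreover have "enat (p $ i) \<le> m $ i" using p by (simp add: enat_vec_def less_eq_vec_def)
      ultimately have "p $ i \<le> p $ i - 1" using order_trans by fastforce
      then show False using \<open>p $ i > 0\<close> by simp
    qed
    have all: "\<exists>\<xi>\<in>Y. \<forall>i\<in>F. p $ i \<le> d \<xi> $ i" if "finite F" for F :: "'k set"
      using that
    proof (induction F rule: finite_induct)
      case empty then show ?case using boundary_filterD(2)[OF Y] by blast
    next
      case (insert i F)
      then obtain \<xi> where \<xi>: "\<xi> \<in> Y" "\<forall>i\<in>F. p $ i \<le> d \<xi> $ i" by blast
      obtain \<eta> where \<eta>: "\<eta> \<in> Y" "p $ i \<le> d \<eta> $ i" using one by blast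
      obtain \<omega> where \<omega>: "\<omega> \<in> Y" "prefix \<xi> \<omega>" "prefix \<eta> \<omega>" using boundary_filterD(4)[OF Y \<xi>(1) \<eta>(1)] by blast
      have "d \<xi> \<le> d \<omega>" "d \<eta> \<le> d \<omega>" using prefixD(4) \<omega> by auto
      then show ?case using \<xi>(2) \<eta>(2) \<omega>(1) by (intro bexI[of _ \<omega>]) (auto simp: less_eq_vec_def intro: order_trans)
    qed
    obtain \<xi> where \<xi>: "\<xi> \<in> Y" "p \<le> d \<xi>" using all[of UNIV] by (auto simp: less_eq_vec_def)
    then obtain \<eta> where "prefix \<eta> \<xi>" "d \<eta> = p" using prefix_exists boundary_filterD(1)[OF Y] by metis
    then show ?thesis using boundary_filterD(3)[OF Y \<xi>(1)] by blast
  qed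
  have pre: "prefix \<eta> \<zeta>" if h: "\<eta> \<in> Y" "\<zeta> \<in> Y" "d \<eta> \<le> d \<zeta>" for \<eta> \<zeta>
  proof -
    obtain \<xi> where "prefix \<eta> \<xi>" "prefix \<zeta> \<xi>" using boundary_filterD(4)[OF Y h(1,2)] by blast
    then show ?thesis using prefix_linear h(3) by blast
  qed
  obtain y where y: "\<And>p. enat_vec p \<le> m \<Longrightarrow> y p \<in> Y" "\<And>p. enat_vec p \<le> m \<Longrightarrow> d (y p) = p"
    using ex by metis
  have yP: "y p \<in> P" if "enat_vec p \<le> m" for p using y(1)[OF that] boundary_filterD(1)[OF Y] by blast
  have "\<exists>\<alpha>. \<alpha> \<in> P \<and> s (y p) = r \<alpha> \<and> y q = y p \<cdot> \<alpha>" if "p \<le> q" "enat_vec p \<le> m" "enat_vec q \<le> m" for p q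
    using pre[OF y(1)[OF that(2)] y(1)[OF that(3)]] y(2)[OF that(2)] y(2)[OF that(3)] that(1)
    by (auto simp: prefix_def)
  then obtain X where X': "\<And>p q. p \<le> q \<Longrightarrow> enat_vec p \<le> m \<Longrightarrow> enat_vec q \<le> m \<Longrightarrow>
      X p q \<in> P \<and> s (y p) = r (X p q) \<and> y q = y p \<cdot> X p q" by metis
  have X: "X p q \<in> P" "r (X p q) = s (y p)" "y p \<cdot> X p q = y q" "enat_vec p \<le> m" "y p \<in> P" "y q \<in> P"
    if "p \<le> q" "enat_vec q \<le> m" for p q
    using X'[OF that(1) enat_vec_le[OF that] that(2)] enat_vec_le[OF that] yP[OF that(2)] yP[OF enat_vec_le[OF that]] by auto
  define x where "x = (\<lambda>(p, q). X p q)"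
  have xpp: "x (p, p) = s (y p)" if p: "enat_vec p \<le> m" for p
  proof -
    note 1 = X[OF order_refl p]
    have "y p \<cdot> X p p = y p \<cdot> s (y p)" using 1 by simp
    then have "X p p = s (y p)" by (rule cancel_left[OF 1(5,1) _ 1(2)[symmetric], rotated 2]) (use 1 in simp_all)
    then show ?thesis by (simp add: x_def)
  qed
  have deg: "d (X p q) = q - p" if pq: "p \<le> q" "enat_vec q \<le> m" for p q
  proof -
    note 1 = X[OF pq]
    have "d (y p \<cdot> X p q) = d (y p) + d (X p q)" by (rule deg_cmp) (use 1 in simp_all)
    then have "q = p + d (X p q)" using 1(3) y(2)[OF pq(2)] y(2)[OF 1(4)] by simp
    then show ?thesis by (metis add_diff_cancel_left')
  qed
  have srcX: "s (X p q) = s (y q)" if pq: "p \<le> q" "enat_vec q \<le> m" for p q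
    using X[OF pq] src_cmp[of "y p" "X p q"] by simp
  have cmp: "X p t = X p q \<cdot> X q t" if pqt: "p \<le> q" "q \<le> t" "enat_vec t \<le> m" for p q t
  proof -
    have q: "enat_vec q \<le> m" using enat_vec_le[OF pqt(2,3)] .
    note 1 = X[OF pqt(1) q] and 2 = X[OF pqt(2,3)] and 3 = X[OF order_trans[OF pqt(1,2)] pqt(3)]
    have sq: "s (X p q) = r (X q t)" using srcX[OF pqt(1) q] 2(2) by simp
    have "y p \<cdot> (X p q \<cdot> X q t) = (y p \<cdot> X p q) \<cdot> X q t"
      by (rule cmp_assoc[symmetric]) (use 1 2 sq in simp_all)
    also have "\<dots> = y p \<cdot> X p t" by (simp only: 1(3) 2(3) 3(3))
    finally show ?thesis
      by (intro cancel_left[of "y p" "X p t" "X p q \<cdot> X q t"]) (use 1(1,2,5) 2(1) 3(1,2) sq in simp_all)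
  qed
  have is_functor: "degree_functor (Omega m) \<Lambda> x"
    unfolding degree_functor_def
  proof (intro conjI ballI impI)
    fix \<eta> assume "\<eta> \<in> paths (Omega m)"
    then obtain p q where pq: "\<eta> = (p, q)" "p \<le> q" "enat_vec q \<le> m" by (auto simp: Omega_def)
    note 1 = X[OF pq(2,3)]
    note p = 1(4)
    show "x \<eta> \<in> P" using 1 pq by (simp add: x_def)
    show "x (rng (Omega m) \<eta>) = r (x \<eta>)" using 1 pq xpp[OF p] by (simp add: Omega_def) (simp add: x_def)
    show "x (src (Omega m) \<eta>) = s (x \<eta>)" using pq xpp[OF pq(3)] srcX[OF pq(2,3)] by (simp add: Omega_def) (simp add: x_def)
    show "d (x \<eta>) = deg (Omega m) \<eta>" using deg[OF pq(2,3)] pq by (simp add: Omega_def x_def)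
  next
    fix \<eta> \<mu> assume "\<eta> \<in> paths (Omega m)" "\<mu> \<in> paths (Omega m)" "src (Omega m) \<eta> = rng (Omega m) \<mu>"
    then obtain p q t where "\<eta> = (p, q)" "\<mu> = (q, t)" "p \<le> q" "q \<le> t" "enat_vec t \<le> m" by (auto simp: Omega_def)
    then show "x (cmp (Omega m) \<eta> \<mu>) = x \<eta> \<cdot> x \<mu>" using cmp[of p q t] by (simp add: Omega_def x_def)
  qed
  have "edges (x (p, p)) i = {}" if p: "enat_vec p \<le> m" and i: "enat (p $ i) = m $ i" for p i
  proof (rule ccontr)
    assume "\<not> ?thesis"
    then obtain \<zeta> where \<zeta>: "\<zeta> \<in> Y" "d (y p) $ i < d \<zeta> $ i"
      using boundary_filterD(5)[OF Y y(1)[OF p], of i] xpp[OF p] by auto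
    have "enat (d \<zeta> $ i) \<le> m $ i" unfolding m_def using \<zeta>(1) by (auto intro: SUP_upper)
    then show False using \<zeta>(2) y(2)[OF p] i by (metis enat_ord_simps(1) not_le)
  qed
  then have "boundary_path \<Lambda> m x" using is_functor by (simp add: boundary_path_def)
  then show ?thesis using xpp y(1) by blast
qed

lemma filter_of_boundary_path:
  assumes x: "boundary_path \<Lambda> m x"
  shows "boundary_filter {x (0, p) | p. enat_vec p \<le> m}"
    and "enat_vec p \<le> m \<Longrightarrow> s (x (0, p)) = x (p, p) \<and> r (x (0, p)) = x (0, 0) \<and> x (p, p) \<in> vertices \<Lambda>"
proof -
  have nonneg [simp]: "0 \<le> p" for p :: "nat ^ 'k" by (simp add: less_eq_vec_def)
  have F: "degree_functor (Omega m) \<Lambda> x" using x by (simp add: boundary_path_def)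
  have xP: "x (p, q) \<in> P \<and> r (x (p, q)) = x (p, p) \<and> s (x (p, q)) = x (q, q) \<and> d (x (p, q)) = q - p"
    if "p \<le> q" "enat_vec q \<le> m" for p q
  proof -
    have "(p, q) \<in> paths (Omega m)" using that by (simp add: Omega_def)
    then have "x (p, q) \<in> P \<and> x (rng (Omega m) (p, q)) = r (x (p, q)) \<and>
        x (src (Omega m) (p, q)) = s (x (p, q)) \<and> d (x (p, q)) = deg (Omega m) (p, q)"
      using F unfolding degree_functor_def by blast
    then show ?thesis by (simp add: Omega_def)
  qed
  have cmp: "x (p, t) = x (p, q) \<cdot> x (q, t)" if pqt: "p \<le> q" "q \<le> t" "enat_vec t \<le> m" for p q t
  proof -
    have "enat_vec q \<le> m"
      using pqt(2,3) by (rule enat_vec_le)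
    then have "(p, q) \<in> paths (Omega m)" "(q, t) \<in> paths (Omega m)" "src (Omega m) (p, q) = rng (Omega m) (q, t)"
      "cmp (Omega m) (p, q) (q, t) = (p, t)"
      using pqt by (auto simp: Omega_def)
    then have "x (cmp (Omega m) (p, q) (q, t)) = x (p, q) \<cdot> x (q, t)"
      using F unfolding degree_functor_def by blast
    then show ?thesis using \<open>cmp (Omega m) (p, q) (q, t) = (p, t)\<close> by simp
  qed
  have le: "enat_vec p \<le> m" if "p \<le> q" "enat_vec q \<le> m" for p q
    using that by (rule enat_vec_le)
  show *: "s (x (0, p)) = x (p, p) \<and> r (x (0, p)) = x (0, 0) \<and> x (p, p) \<in> vertices \<Lambda>" if "enat_vec p \<le> m" for p
    using xP[of 0 p] xP[of p p] that by (simp add: vertices_def deg_paths_def)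
  have pre: "prefix (x (0, p)) (x (0, q))" if "p \<le> q" "enat_vec q \<le> m" for p q
  proof -
    note p = le[OF that]
    show ?thesis
      using cmp[OF nonneg that] xP[OF nonneg p] xP[OF that] prefixI[of "x (0, p)" "x (p, q)"] by simp
  qed
  define Y where "Y = {x (0, p) | p. enat_vec p \<le> m}"
  have "enat_vec 0 \<le> m" by (simp add: less_eq_vec_def enat_vec_def flip: zero_enat_def)
  then have "Y \<noteq> {}" by (auto simp: Y_def)
  moreover have "Y \<subseteq> P" using xP by (auto simp: Y_def)
  moreover have "\<eta> \<in> Y" if h: "\<zeta> \<in> Y" "prefix \<eta> \<zeta>" for \<eta> \<zeta>
  proof -
    obtain q where q: "\<zeta> = x (0, q)" "enat_vec q \<le> m" using h(1) by (auto simp: Y_def)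
    have "d \<eta> \<le> q" using prefixD(4)[OF h(2)] q xP[of 0 q] by simp
    then have "prefix (x (0, d \<eta>)) \<zeta>" "enat_vec (d \<eta>) \<le> m" using pre q le by auto
    moreover have "d (x (0, d \<eta>)) = d \<eta>" using xP[of 0 "d \<eta>"] calculation(2) by simp
    ultimately have "\<eta> = x (0, d \<eta>)" using prefix_unique[OF h(2)] by metis
    then show ?thesis using \<open>enat_vec (d \<eta>) \<le> m\<close> by (auto simp: Y_def)
  qed
  moreover have "\<exists>\<xi>\<in>Y. prefix \<eta> \<xi> \<and> prefix \<zeta> \<xi>" if h: "\<eta> \<in> Y" "\<zeta> \<in> Y" for \<eta> \<zeta>
  proof -
    obtain p q where pq: "\<eta> = x (0, p)" "enat_vec p \<le> m" "\<zeta> = x (0, q)" "enat_vec q \<le> m" using h by (auto simp: Y_def)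
    define j :: "nat ^ 'k" where "j = (\<chi> i. max (p $ i) (q $ i))"
    have "p \<le> j" "q \<le> j" "enat_vec j \<le> m" using pq by (auto simp: less_eq_vec_def enat_vec_def j_def max_def)
    then show ?thesis using pre pq by (auto simp: Y_def intro!: exI[of _ "x (0, j)"])
  qed
  moreover have "\<exists>\<zeta>\<in>Y. prefix \<eta> \<zeta> \<and> d \<eta> $ i < d \<zeta> $ i" if \<eta>: "\<eta> \<in> Y" and i: "edges (s \<eta>) i \<noteq> {}" for \<eta> i
  proof -
    obtain p where p: "\<eta> = x (0, p)" "enat_vec p \<le> m" using \<eta> by (auto simp: Y_def)
    have "enat (p $ i) \<noteq> m $ i" using x i *[OF p(2)] p unfolding boundary_path_def by auto
    moreover have "enat (p $ i) \<le> m $ i" using p(2) by (simp add: less_eq_vec_def enat_vec_def)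
    ultimately have "enat (Suc (p $ i)) \<le> m $ i" by (simp add: Suc_ile_eq)
    then have q: "enat_vec (p + unit_vec i) \<le> m" using p(2) by (auto simp: less_eq_vec_def enat_vec_def axis_def)
    have le': "p \<le> p + unit_vec i" by (simp add: less_eq_vec_def)
    have "d \<eta> $ i < d (x (0, p + unit_vec i)) $ i"
      using xP[OF nonneg p(2)] xP[OF nonneg q] p(1) by simp
    then show ?thesis using pre[OF le' q] p q by (auto simp: Y_def)
  qed
  ultimately have "boundary_filter Y" unfolding boundary_filter_def by blast
  then show "boundary_filter {x (0, p) | p. enat_vec p \<le> m}" by (simp add: Y_def)
qed

end

section \<open>The Cuntz--Krieger family on boundary filters\<close>

context kgraph
begin

definition strip_map :: "'a set \<Rightarrow> 'a \<Rightarrow> 'a set \<Rightarrow> 'a set option" where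
  "strip_map H \<mu> Y = (if boundary_filter Y \<and> avoids H Y \<and> \<mu> \<in> Y then Some (unshift \<mu> Y) else None)"

definition attach_map :: "'a set \<Rightarrow> 'a \<Rightarrow> 'a set \<Rightarrow> 'a set option" where
  "attach_map H \<mu> Y = (if boundary_filter Y \<and> avoids H Y \<and> s \<mu> \<in> Y then Some (shift \<mu> Y) else None)"

lemma avoids_unshift:
  assumes "avoids H Y" "\<mu> \<in> P" shows "avoids H (unshift \<mu> Y)"
  unfolding avoids_def
proof
  fix \<eta> assume "\<eta> \<in> unshift \<mu> Y"
  then have "\<eta> \<in> P" "s \<mu> = r \<eta>" "\<mu> \<cdot> \<eta> \<in> Y" by (simp_all add: unshift_def)
  then show "s \<eta> \<notin> H" using assms src_cmp[of \<mu> \<eta>] unfolding avoids_def by metis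
qed

lemma avoids_shift:
  assumes H: "hereditary H" and Y: "boundary_filter Y" "avoids H Y" and \<mu>: "\<mu> \<in> P" "s \<mu> \<in> Y" shows "avoids H (shift \<mu> Y)"
  unfolding avoids_def
proof (intro ballI notI)
  fix \<alpha> assume "\<alpha> \<in> shift \<mu> Y" and sH: "s \<alpha> \<in> H"
  then obtain \<eta> where \<eta>: "\<eta> \<in> Y" "prefix \<alpha> (\<mu> \<cdot> \<eta>)" by (auto simp: shift_def)
  have "r \<eta> = s \<mu>" "\<eta> \<in> P" using filter_rng_eq[OF Y(1) \<mu>(2) _ \<eta>(1)] \<mu>(1) by simp_all
  then have "s \<eta> \<in> H" using hereditary_prefix[OF H \<eta>(2) sH] \<mu>(1) by simp
  then show False using Y(2) \<eta>(1) by (simp add: avoids_def)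
qed

lemma converse_strip_attach:
  assumes lc: "locally_convex \<Lambda>" and H: "hereditary H" and \<mu>: "\<mu> \<in> P"
  shows "converse_maps (strip_map H \<mu>) (attach_map H \<mu>)"
  unfolding converse_maps_def
proof (intro allI iffI)
  fix Z Y
  assume "strip_map H \<mu> Y = Some Z"
  then have Y: "boundary_filter Y" "avoids H Y" "\<mu> \<in> Y" and Z: "Z = unshift \<mu> Y"
    by (simp_all add: strip_map_def split: if_splits)
  then show "attach_map H \<mu> Z = Some Y"
    using boundary_filter_unshift[OF Y(1,3)] avoids_unshift[OF Y(2) \<mu>] shift_unshift[OF Y(1,3)]
    by (simp add: attach_map_def)
next
  fix Z Y
  assume "attach_map H \<mu> Z = Some Y"
  then have Z: "boundary_filter Z" "avoids H Z" "s \<mu> \<in> Z" and Y: "Y = shift \<mu> Z"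
    by (simp_all add: attach_map_def split: if_splits)
  then show "strip_map H \<mu> Y = Some Z"
    using boundary_filter_shift[OF lc Z(1) \<mu> Z(3)] avoids_shift[OF H Z(1,2) \<mu> Z(3)] unshift_shift[OF Z(1) \<mu> Z(3)]
    by (simp add: strip_map_def)
qed

lemma unshift_vertex:
  assumes Y: "boundary_filter Y" and v: "v \<in> vertices \<Lambda>" "v \<in> Y" shows "unshift v Y = Y"
proof (intro equalityI subsetI)
  fix \<eta> assume "\<eta> \<in> unshift v Y"
  then have "\<eta> \<in> P" "r \<eta> = v" "v \<cdot> \<eta> \<in> Y" using vertexD(3)[OF v(1)] by (simp_all add: unshift_def)
  then show "\<eta> \<in> Y" using cmp_rng[of \<eta>] by simp
next
  fix \<eta> assume \<eta>: "\<eta> \<in> Y"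
  note rng = filter_rng_eq[OF Y v(2,1) \<eta>]
  have "v \<cdot> \<eta> = \<eta>" using cmp_rng[OF rng(2)] rng(1) by simp
  then show "\<eta> \<in> unshift v Y" using rng \<eta> vertexD(3)[OF v(1)] by (simp add: unshift_def)
qed

lemma strip_vertex:
  assumes "v \<in> vertices \<Lambda>"
  shows "strip_map H v Y = (if boundary_filter Y \<and> avoids H Y \<and> v \<in> Y then Some Y else None)"
  using unshift_vertex assms by (auto simp: strip_map_def)

lemma strip_cmp:
  assumes "\<mu> \<in> P" "\<nu> \<in> P" "s \<mu> = r \<nu>"
  shows "strip_map H (\<mu> \<cdot> \<nu>) Y = Option.bind (strip_map H \<mu> Y) (strip_map H \<nu>)"
proof (cases "boundary_filter Y \<and> avoids H Y \<and> \<mu> \<in> Y")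
  case True
  then show ?thesis
    using mem_unshift_cmp[OF _ assms] boundary_filter_unshift(1) avoids_unshift[OF _ assms(1)]
    by (auto simp: strip_map_def)
next
  case False
  then show ?thesis using mem_unshift_cmp(1)[OF _ assms] by (auto simp: strip_map_def)
qed

text \<open>The operator that sends the point mass at \<open>Y\<close> to the point mass at \<open>shift \<mu> Y\<close>; on functions it is composition with
the partial map that removes \<open>\<mu>\<close>.\<close>

definition path_op :: "'a set \<Rightarrow> 'a \<Rightarrow> 'a set op" where
  "path_op H \<mu> = pull_op (strip_map H \<mu>)"

lemma path_op_zero:
  assumes lc: "locally_convex \<Lambda>" and H: "hereditary H" and v: "v \<in> vertices \<Lambda>" "v \<in> H"
  shows "path_op H v = 0"
proof -
  have "strip_map H v Y = None" for Y
  proof -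
    have "v \<notin> Y" if "avoids H Y" using that vertexD(3)[OF v(1)] v(2) unfolding avoids_def by metis
    then show ?thesis by (auto simp: strip_map_def)
  qed
  then show ?thesis unfolding path_op_def
    by (intro op_eqI) (simp add: pull_op_apply[OF converse_strip_attach[OF lc H vertexD(1)[OF v(1)]]])
qed

lemma path_op_nonzero:
  assumes lc: "locally_convex \<Lambda>" and H: "hereditary H" and v: "v \<in> vertices \<Lambda>"
    and Y: "boundary_filter Y" "avoids H Y" "v \<in> Y"
  shows "path_op H v \<noteq> 0"
proof -
  obtain f where f: "ell2_apply f Y = 1" by (rule exE[OF exists_unit_vector[of Y]])
  have "ell2_apply (blinfun_apply (path_op H v) f) Y = 1"
    unfolding path_op_def
    using Y f by (simp add: pull_op_apply[OF converse_strip_attach[OF lc H vertexD(1)[OF v]]] strip_vertex[OF v])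
  then show ?thesis by (metis blinfun.zero_left ell2_apply_simps(1) zero_neq_one)
qed

text \<open>Every relation is a statement about partial maps of boundary filters: removing \<open>\<mu>\<close> and then \<open>\<nu>\<close> is removing
\<open>\<mu>\<nu>\<close>, and the filters with range \<open>v\<close> are partitioned according to their unique member in \<open>\<Lambda>\<^bsup>\<le>n\<^esup>\<close>.\<close>

theorem CK_family_path_op:
  assumes rf: "row_finite \<Lambda>" and lc: "locally_convex \<Lambda>" and H: "hereditary H"
  shows "CK_family \<Lambda> op_algebra (path_op H)"
proof -
  note conv = converse_strip_attach[OF lc H]
  define keep where "keep = (\<lambda>\<eta> Y. if boundary_filter Y \<and> avoids H Y \<and> \<eta> \<in> Y then Some Y else None)"
  have car: "path_op H \<mu> \<in> op_carrier" if "\<mu> \<in> P" for \<mu>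
    using pull_op_carrier[OF conv[OF that]] by (simp add: path_op_def)
  have adj: "op_adj (path_op H \<mu>) = pull_op (attach_map H \<mu>)" if "\<mu> \<in> P" for \<mu>
    using op_adj_pull[OF conv[OF that]] by (simp add: path_op_def)
  have mult: "path_op H \<mu> o\<^sub>L path_op H \<nu> = path_op H (\<mu> \<cdot> \<nu>)" if "\<mu> \<in> P" "\<nu> \<in> P" "s \<mu> = r \<nu>" for \<mu> \<nu>
    unfolding path_op_def
    using that by (intro pull_op_compose[OF conv conv conv] strip_cmp) auto
  have adj_mult: "op_adj (path_op H \<mu>) o\<^sub>L path_op H \<mu> = path_op H (s \<mu>)" if \<mu>: "\<mu> \<in> P" for \<mu>
  proof -
    have "strip_map H (s \<mu>) Y = Option.bind (attach_map H \<mu> Y) (strip_map H \<mu>)" for Y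
    proof (cases "attach_map H \<mu> Y")
      case None
      then show ?thesis by (auto simp: attach_map_def strip_map_def split: if_splits)
    next
      case (Some Z)
      then have "strip_map H \<mu> Z = Some Y" using conv[OF \<mu>] by (simp add: converse_maps_def)
      then show ?thesis using Some \<mu> by (auto simp: attach_map_def strip_vertex split: if_splits)
    qed
    then show ?thesis unfolding adj[OF \<mu>] unfolding path_op_def
      using \<mu> by (intro pull_op_compose[OF converse_maps_sym[OF conv] conv conv]) auto
  qed
  have vertex_adj: "op_adj (path_op H v) = path_op H v" if v: "v \<in> vertices \<Lambda>" for v
  proof -
    have "attach_map H v Y = strip_map H v Y" for Y
    proof -
      have "shift v Y = Y" if "boundary_filter Y" "v \<in> Y"
        using shift_unshift[OF that] unshift_vertex[OF that(1) v that(2)] by simp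
      then show ?thesis using vertexD[OF v] by (auto simp: attach_map_def strip_vertex[OF v])
    qed
    then have "attach_map H v = strip_map H v" by blast
    then show ?thesis using adj[OF vertexD(1)[OF v]] by (simp add: path_op_def)
  qed
  have orth: "path_op H v o\<^sub>L path_op H w = 0" if vw: "v \<in> vertices \<Lambda>" "w \<in> vertices \<Lambda>" "v \<noteq> w" for v w
  proof -
    have "\<not> (v \<in> Y \<and> w \<in> Y)" if "boundary_filter Y" for Y
      using filter_rng[OF that, of v w] vw vertexD by metis
    then show ?thesis unfolding path_op_def
      by (intro op_eqI)
        (auto simp: pull_op_apply[OF conv[OF vertexD(1)[OF vw(1)]]] pull_op_apply[OF conv[OF vertexD(1)[OF vw(2)]]]
          strip_vertex[OF vw(1)] strip_vertex[OF vw(2)])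
  qed
  have keep: "converse_maps (keep \<eta>) (keep \<eta>)" for \<eta>
    by (auto simp: converse_maps_def keep_def)
  have proj: "path_op H \<eta> o\<^sub>L op_adj (path_op H \<eta>) = pull_op (keep \<eta>)" if \<eta>: "\<eta> \<in> P" for \<eta>
  proof -
    have "keep \<eta> Y = Option.bind (strip_map H \<eta> Y) (attach_map H \<eta>)" for Y
    proof (cases "strip_map H \<eta> Y")
      case None
      then show ?thesis by (auto simp: keep_def strip_map_def split: if_splits)
    next
      case (Some Z)
      then have "attach_map H \<eta> Z = Some Y" using conv[OF \<eta>] by (simp add: converse_maps_def)
      then show ?thesis using Some by (auto simp: keep_def strip_map_def split: if_splits)
    qed
    then show ?thesis unfolding adj[OF \<eta>] unfolding path_op_def
      by (intro pull_op_compose[OF conv[OF \<eta>] converse_maps_sym[OF conv[OF \<eta>]] keep])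
  qed
  have sum: "path_op H v = (\<Oplus>\<^bsub>op_algebra\<^esub>\<eta> \<in> from_range \<Lambda> v (le_paths \<Lambda> n). path_op H \<eta> o\<^sub>L op_adj (path_op H \<eta>))"
    if v: "v \<in> vertices \<Lambda>" for v n
  proof -
    let ?F = "from_range \<Lambda> v (le_paths \<Lambda> n)"
    have fin: "finite ?F" by (rule finite_le_paths[OF rf v])
    have FP: "\<eta> \<in> P" "r \<eta> = v" "\<eta> \<in> le_paths \<Lambda> n" if "\<eta> \<in> ?F" for \<eta> using that by (auto simp: from_range_def le_paths_def)
    have "(\<Oplus>\<^bsub>op_algebra\<^esub>\<eta> \<in> ?F. path_op H \<eta> o\<^sub>L op_adj (path_op H \<eta>)) = (\<Sum>\<eta>\<in>?F. path_op H \<eta> o\<^sub>L op_adj (path_op H \<eta>))"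
      using FP by (intro finsum_op fin op_closed op_carrier_adj car)
    also have "\<dots> = path_op H v"
    proof (rule op_eqI)
      fix f Y
      define on where "on = (boundary_filter Y \<and> avoids H Y)"
      have summand: "ell2_apply (blinfun_apply (path_op H \<eta> o\<^sub>L op_adj (path_op H \<eta>)) f) Y =
          (if on \<and> \<eta> \<in> Y then ell2_apply f Y else 0)" if "\<eta> \<in> ?F" for \<eta>
        unfolding proj[OF FP(1)[OF that]] by (simp add: pull_op_apply[OF keep]) (auto simp: keep_def on_def)
      have apply_sum: "ell2_apply (blinfun_apply (sum T G) f) Y = (\<Sum>\<eta>\<in>G. ell2_apply (blinfun_apply (T \<eta>) f) Y)"
        if "finite G" for T :: "'a \<Rightarrow> 'a set op" and G
        using that by (induction G rule: finite_induct) (auto simp: blinfun.add_left)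
      have "ell2_apply (blinfun_apply (\<Sum>\<eta>\<in>?F. path_op H \<eta> o\<^sub>L op_adj (path_op H \<eta>)) f) Y =
          (\<Sum>\<eta>\<in>?F. if on \<and> \<eta> \<in> Y then ell2_apply f Y else 0)"
        unfolding apply_sum[OF fin] by (intro sum.cong refl summand)
      also have "\<dots> = (if on \<and> v \<in> Y then ell2_apply f Y else 0)"
      proof (cases "on \<and> v \<in> Y")
        case True
        then have Y: "boundary_filter Y" "v \<in> Y" by (auto simp: on_def)
        obtain \<eta> where \<eta>: "\<eta> \<in> Y" "\<eta> \<in> le_paths \<Lambda> n" "\<And>\<zeta>. \<zeta> \<in> Y \<Longrightarrow> \<zeta> \<in> le_paths \<Lambda> n \<Longrightarrow> \<zeta> = \<eta>"
          using filter_le_path[OF Y(1)] by blast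
        have "r \<eta> = v" using filter_rng_eq[OF Y v \<eta>(1)] by simp
        then have "\<eta> \<in> ?F" using \<eta>(2) by (simp add: from_range_def)
        moreover have "\<zeta> \<in> Y \<longleftrightarrow> \<zeta> = \<eta>" if "\<zeta> \<in> ?F" for \<zeta> using \<eta> FP(3)[OF that] by blast
        ultimately show ?thesis using True fin by (simp add: sum.delta cong: sum.cong)
      next
        case False
        have "\<not> (on \<and> \<eta> \<in> Y)" if "\<eta> \<in> ?F" for \<eta>
          using False filter_vertex[of Y \<eta> v] FP[OF that] v by (auto simp: on_def)
        then show ?thesis using False by (auto intro!: sum.neutral)
      qed
      also have "\<dots> = ell2_apply (blinfun_apply (path_op H v) f) Y"
        unfolding path_op_def by (auto simp: pull_op_apply[OF conv[OF vertexD(1)[OF v]]] strip_vertex[OF v] on_def)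
      finally show "ell2_apply (blinfun_apply (\<Sum>\<eta>\<in>?F. path_op H \<eta> o\<^sub>L op_adj (path_op H \<eta>)) f) Y =
          ell2_apply (blinfun_apply (path_op H v) f) Y" .
    qed
    finally show ?thesis ..
  qed
  have partial: "path_op H \<eta> o\<^sub>L op_adj (path_op H \<eta>) o\<^sub>L path_op H \<eta> = path_op H \<eta>" if \<eta>: "\<eta> \<in> P" for \<eta>
  proof -
    have "path_op H \<eta> o\<^sub>L op_adj (path_op H \<eta>) o\<^sub>L path_op H \<eta> = path_op H \<eta> o\<^sub>L (op_adj (path_op H \<eta>) o\<^sub>L path_op H \<eta>)"
      by (rule blinfun_eqI) simp
    then show ?thesis using adj_mult[OF \<eta>] mult[of \<eta> "s \<eta>"] \<eta> by simp
  qed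
  have idem: "path_op H v o\<^sub>L path_op H v = path_op H v" if v: "v \<in> vertices \<Lambda>" for v
    using mult[of v v] vertexD[OF v] cmp_src[of v] by simp
  show ?thesis
    unfolding CK_family_def op_algebra_simps
  proof (intro conjI ballI allI impI)
    fix \<eta> \<mu> assume \<eta>: "\<eta> \<in> P"
    show "path_op H \<eta> \<in> op_carrier" by (rule car[OF \<eta>])
    show "path_op H \<eta> o\<^sub>L op_adj (path_op H \<eta>) o\<^sub>L path_op H \<eta> = path_op H \<eta>" by (rule partial[OF \<eta>])
    show "op_adj (path_op H \<eta>) o\<^sub>L path_op H \<eta> = path_op H (s \<eta>)" by (rule adj_mult[OF \<eta>])
    assume "\<mu> \<in> P" "s \<eta> = r \<mu>"
    then show "path_op H \<eta> o\<^sub>L path_op H \<mu> = path_op H (\<eta> \<cdot> \<mu>)" by (rule mult[OF \<eta>])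
  next
    fix v w n assume v: "v \<in> vertices \<Lambda>"
    show "op_adj (path_op H v) = path_op H v" by (rule vertex_adj[OF v])
    show "path_op H v o\<^sub>L path_op H v = path_op H v" by (rule idem[OF v])
    show "path_op H v = (\<Oplus>\<^bsub>op_algebra\<^esub>\<eta> \<in> from_range \<Lambda> v (le_paths \<Lambda> n). path_op H \<eta> o\<^sub>L op_adj (path_op H \<eta>))"
      by (rule sum[OF v])
    assume "w \<in> vertices \<Lambda>" "v \<noteq> w"
    then show "path_op H v o\<^sub>L path_op H w = 0" by (rule orth[OF v])
  qed
qed

end

section \<open>Linear spans\<close>

context cstar
begin

inductive_set lin :: "'b set \<Rightarrow> 'b set" for G where
  lin_zero: "\<zero> \<in> lin G"
| lin_step: "\<lbrakk>g \<in> G; x \<in> lin G\<rbrakk> \<Longrightarrow> c \<odot> g \<oplus> x \<in> lin G"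

lemma lin_closed: "\<lbrakk>x \<in> lin G; G \<subseteq> carrier A\<rbrakk> \<Longrightarrow> x \<in> carrier A"
  by (induction rule: lin.induct) auto

lemma lin_generator: assumes "g \<in> G" "G \<subseteq> carrier A" shows "g \<in> lin G"
proof -
  have "g \<in> carrier A" using assms by blast
  then show ?thesis using lin_step[OF assms(1) lin_zero, of 1] by simp
qed

lemma lin_add:
  assumes G: "G \<subseteq> carrier A" and y: "y \<in> lin G" and x: "x \<in> lin G" shows "x \<oplus> y \<in> lin G"
  using x
proof (induction rule: lin.induct)
  case lin_zero then show ?case using y lin_closed[OF y G] by simp
next
  case (lin_step g x c)
  then have "g \<in> carrier A" "x \<in> carrier A" using G lin_closed by auto
  then show ?case using lin.lin_step[OF lin_step(1,3), of c] lin_closed[OF y G] by (simp add: a_assoc)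
qed

text \<open>The factor \<open>h\<close> allows conjugate linear maps, such as the adjoint.\<close>

lemma lin_linear_image:
  assumes x: "x \<in> lin G" and G: "G \<subseteq> carrier A" "K \<subseteq> carrier A"
    and f: "\<And>g. g \<in> G \<Longrightarrow> f g \<in> lin K"
    and f0: "f \<zero> = \<zero>" and f_step: "\<And>c g x. g \<in> G \<Longrightarrow> x \<in> carrier A \<Longrightarrow> f (c \<odot> g \<oplus> x) = h c \<odot> f g \<oplus> f x"
  shows "f x \<in> lin K"
  using x
proof (induction rule: lin.induct)
  case lin_zero then show ?case by (simp add: f0 lin.lin_zero)
next
  case (lin_step g x c)
  have scale: "c \<odot> y \<in> lin K" if "y \<in> lin K" for c y
    using that
  proof (induction rule: lin.induct)
    case (lin_step k y e)
    then have "k \<in> carrier A" "y \<in> carrier A" using G lin_closed by auto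
    then show ?case using lin.lin_step[OF lin_step(1,3), of "c * e"] by (simp add: scale_add scale_scale)
  qed (simp add: lin.lin_zero)
  show ?case
    using lin_add[OF G(2) lin_step(3) scale[OF f[OF lin_step(1)]]] f_step[OF lin_step(1) lin_closed[OF lin_step(2) G(1)]] by simp
qed

lemma lin_scale: assumes "x \<in> lin G" "G \<subseteq> carrier A" shows "c \<odot> x \<in> lin G"
proof (rule lin_linear_image[OF assms(1) assms(2,2), of _ "\<lambda>d. d"])
  fix g assume "g \<in> G"
  then have "g \<in> carrier A" using assms(2) by blast
  then show "c \<odot> g \<in> lin G" using lin_step[OF \<open>g \<in> G\<close> lin_zero, of c] by simp
next
  fix d g x assume "g \<in> G" "x \<in> carrier A"
  then have "g \<in> carrier A" "x \<in> carrier A" using assms(2) by auto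
  then show "c \<odot> (d \<odot> g \<oplus> x) = d \<odot> (c \<odot> g) \<oplus> c \<odot> x" by (simp add: scale_add scale_scale mult.commute)
qed simp

lemma lin_adj:
  assumes "x \<in> lin G" "G \<subseteq> carrier A" "K \<subseteq> carrier A" "\<And>g. g \<in> G \<Longrightarrow> adj A g \<in> lin K"
  shows "adj A x \<in> lin K"
proof (rule lin_linear_image[OF assms(1-3), of _ cnj])
  fix d g x assume "g \<in> G" "x \<in> carrier A"
  then have "g \<in> carrier A" "x \<in> carrier A" using assms(2) by auto
  then show "adj A (d \<odot> g \<oplus> x) = cnj d \<odot> adj A g \<oplus> adj A x" by (simp add: adj_add adj_smult)
qed (auto simp: adj_zero assms(4))

lemma lin_sandwich:
  assumes "x \<in> lin G" "G \<subseteq> carrier A" "K \<subseteq> carrier A" and ab: "a \<in> carrier A" "b \<in> carrier A"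
    and *: "\<And>g. g \<in> G \<Longrightarrow> a \<otimes> g \<otimes> b \<in> lin K"
  shows "a \<otimes> x \<otimes> b \<in> lin K"
proof (rule lin_linear_image[OF assms(1-3), of _ "\<lambda>d. d"])
  fix d g x assume "g \<in> G" "x \<in> carrier A"
  then have "g \<in> carrier A" "x \<in> carrier A" using assms(2) by auto
  then show "a \<otimes> (d \<odot> g \<oplus> x) \<otimes> b = d \<odot> (a \<otimes> g \<otimes> b) \<oplus> a \<otimes> x \<otimes> b"
    using ab by (simp add: distrib_left distrib_right smult_mult_left smult_mult_right)
qed (use ab * in auto)

lemma lin_mult:
  assumes x: "x \<in> lin G" and y: "y \<in> lin H" and G: "G \<subseteq> carrier A" "H \<subseteq> carrier A" "K \<subseteq> carrier A"
    and *: "\<And>g h. g \<in> G \<Longrightarrow> h \<in> H \<Longrightarrow> g \<otimes> h \<in> lin K"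
  shows "x \<otimes> y \<in> lin K"
proof (rule lin_linear_image[OF x G(1,3), of _ "\<lambda>d. d"])
  note yc = lin_closed[OF y G(2)]
  fix g assume g: "g \<in> G"
  then have gc: "g \<in> carrier A" using G by blast
  show "g \<otimes> y \<in> lin K"
  proof (rule lin_linear_image[OF y G(2,3), of _ "\<lambda>d. d"])
    fix d h x assume "h \<in> H" "x \<in> carrier A"
    then have "h \<in> carrier A" "x \<in> carrier A" using G by auto
    then show "g \<otimes> (d \<odot> h \<oplus> x) = d \<odot> (g \<otimes> h) \<oplus> g \<otimes> x"
      using gc by (simp add: distrib_left smult_mult_right)
  qed (use gc * g in auto)
  fix d x assume "x \<in> carrier A"
  then show "(d \<odot> g \<oplus> x) \<otimes> y = d \<odot> (g \<otimes> y) \<oplus> x \<otimes> y"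
    using gc yc by (simp add: distrib_right smult_mult_left)
qed (use lin_closed[OF y G(2)] in simp)

lemma lin_finsum:
  assumes "G \<subseteq> carrier A" "finite F" "\<And>i. i \<in> F \<Longrightarrow> f i \<in> lin G" shows "finsum A f F \<in> lin G"
  using assms(2,3)
proof (induction F rule: finite_induct)
  case (insert i F)
  then have "f \<in> F \<rightarrow> carrier A" "f i \<in> carrier A" using lin_closed[OF _ assms(1)] by auto
  with insert show ?case using lin_add[OF assms(1)] by (simp add: finsum_insert)
qed (simp add: lin_zero)

lemma lin_lin: assumes "x \<in> lin G" "G \<subseteq> carrier A" "K \<subseteq> carrier A" "\<And>g. g \<in> G \<Longrightarrow> g \<in> lin K" shows "x \<in> lin K"
  by (rule lin_linear_image[OF assms(1-3), of "\<lambda>x. x" "\<lambda>d. d"]) (use assms in auto)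

end

section \<open>Matrix units in a Cuntz--Krieger family\<close>

locale ck_family = kgraph \<Lambda> + cstar A for \<Lambda> :: "('a, 'k::finite) kgraph" and A :: "'b cstar" (structure) +
  fixes t :: "'a \<Rightarrow> 'b"
  assumes rf: "row_finite \<Lambda>" and lc: "locally_convex \<Lambda>" and CK: "CK_family \<Lambda> A t"
begin

lemma t_closed [simp]: "\<mu> \<in> P \<Longrightarrow> t \<mu> \<in> carrier A"
  and t_partial: "\<mu> \<in> P \<Longrightarrow> t \<mu> \<otimes> adj A (t \<mu>) \<otimes> t \<mu> = t \<mu>"
  and t_mult: "\<lbrakk>\<mu> \<in> P; \<nu> \<in> P; s \<mu> = r \<nu>\<rbrakk> \<Longrightarrow> t \<mu> \<otimes> t \<nu> = t (\<mu> \<cdot> \<nu>)"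
  and t_adj_mult: "\<mu> \<in> P \<Longrightarrow> adj A (t \<mu>) \<otimes> t \<mu> = t (s \<mu>)"
  and t_vertex: "v \<in> vertices \<Lambda> \<Longrightarrow> adj A (t v) = t v" "v \<in> vertices \<Lambda> \<Longrightarrow> t v \<otimes> t v = t v"
  and t_vertex_orth: "\<lbrakk>v \<in> vertices \<Lambda>; w \<in> vertices \<Lambda>; v \<noteq> w\<rbrakk> \<Longrightarrow> t v \<otimes> t w = \<zero>"
  and t_sum: "v \<in> vertices \<Lambda> \<Longrightarrow> t v = (\<Oplus>\<eta> \<in> from_range \<Lambda> v (le_paths \<Lambda> n). t \<eta> \<otimes> adj A (t \<eta>))"
  using CK unfolding CK_family_def by auto

lemma t_range: "\<mu> \<in> P \<Longrightarrow> t (r \<mu>) \<otimes> t \<mu> = t \<mu>" and t_source: "\<mu> \<in> P \<Longrightarrow> t \<mu> \<otimes> t (s \<mu>) = t \<mu>"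
  by (simp_all add: t_mult)

lemma nrm_t: assumes "\<mu> \<in> P" shows "nrm A (t \<mu>) \<le> 1"
proof -
  have "(nrm A (t \<mu>))\<^sup>2 = nrm A (t (s \<mu>))" using assms nrm_adj_mult[of "t \<mu>"] by (simp add: t_adj_mult)
  also have "\<dots> \<le> 1" using assms by (intro nrm_projection) (simp_all add: t_vertex)
  finally show ?thesis using assms abs_le_square_iff[of "nrm A (t \<mu>)" 1] by simp
qed

lemma t_adj_partial: assumes "\<mu> \<in> P" shows "adj A (t \<mu>) \<otimes> (t \<mu> \<otimes> adj A (t \<mu>)) = adj A (t \<mu>)"
proof -
  have "adj A (t \<mu> \<otimes> adj A (t \<mu>) \<otimes> t \<mu>) = adj A (t \<mu>)" using t_partial[OF assms] by simp
  then show ?thesis using assms by (simp add: adj_mult)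
qed

text \<open>For a common range \<open>v\<close>, the projections \<open>t\<^sub>\<eta> t\<^sub>\<eta>*\<close> with \<open>\<eta> \<in> v\<Lambda>\<^bsup>\<le>n\<^esup>\<close> add up to the projection \<open>t\<^sub>v\<close>.\<close>

lemma t_orth:
  assumes \<mu>: "\<mu> \<in> le_paths \<Lambda> n" and \<nu>: "\<nu> \<in> le_paths \<Lambda> n" and ne: "\<mu> \<noteq> \<nu>"
  shows "adj A (t \<mu>) \<otimes> t \<nu> = \<zero>"
proof -
  have P: "\<mu> \<in> P" "\<nu> \<in> P" using le_pathsD assms by auto
  show ?thesis
  proof (cases "r \<mu> = r \<nu>")
    case False
    have "adj A (t \<mu>) = adj A (t \<mu>) \<otimes> t (r \<mu>)"
      using P arg_cong[OF t_range[OF P(1)], of "adj A"] by (simp add: adj_mult t_vertex)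
    then have "adj A (t \<mu>) \<otimes> t \<nu> = (adj A (t \<mu>) \<otimes> t (r \<mu>)) \<otimes> (t (r \<nu>) \<otimes> t \<nu>)"
      using t_range[OF P(2)] by simp
    also have "\<dots> = adj A (t \<mu>) \<otimes> (t (r \<mu>) \<otimes> t (r \<nu>)) \<otimes> t \<nu>" using P by (simp add: mult_assoc)
    finally show ?thesis using P False by (simp add: t_vertex_orth)
  next
    case True
    define v where "v = r \<mu>"
    define p where "p = (\<lambda>\<eta>. t \<eta> \<otimes> adj A (t \<eta>))"
    let ?F = "from_range \<Lambda> v (le_paths \<Lambda> n)"
    have v: "v \<in> vertices \<Lambda>" using P by (simp add: v_def)
    have FP: "\<eta> \<in> P" "r \<eta> = v" if "\<eta> \<in> ?F" for \<eta> using that le_pathsD(1) by (auto simp: from_range_def)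
    have "p \<mu> \<otimes> p \<nu> = \<zero>"
    proof (rule projections_orthogonal[where F = ?F and P = "t v"])
      show "finite ?F" by (rule finite_le_paths[OF rf v])
      show "t v = (\<Oplus>\<eta>\<in>?F. p \<eta>)" unfolding p_def by (rule t_sum[OF v])
      show "t v \<otimes> p \<eta> = p \<eta>" if "\<eta> \<in> ?F" for \<eta>
        using FP[OF that] t_range[of \<eta>] vertexD[OF v] by (simp add: p_def flip: mult_assoc)
      show "p \<eta> \<otimes> p \<eta> = p \<eta>" if "\<eta> \<in> ?F" for \<eta>
        using FP[OF that] t_adj_partial[of \<eta>] by (simp add: p_def mult_assoc)
      show "adj A (p \<eta>) = p \<eta>" if "\<eta> \<in> ?F" for \<eta> using FP[OF that] by (simp add: p_def adj_mult)
      show "p \<eta> \<in> carrier A" if "\<eta> \<in> ?F" for \<eta> using FP[OF that] by (simp add: p_def)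
      show "t v \<in> carrier A" "t v \<otimes> t v = t v" using vertexD(1)[OF v] t_vertex(2)[OF v] by simp_all
      show "\<mu> \<in> ?F" "\<nu> \<in> ?F" using \<mu> \<nu> True by (simp_all add: from_range_def v_def)
      show "\<mu> \<noteq> \<nu>" by (rule ne)
    qed
    moreover have "adj A (t \<mu>) \<otimes> t \<nu> = adj A (t \<mu>) \<otimes> (p \<mu> \<otimes> p \<nu>) \<otimes> t \<nu>"
    proof -
      have "adj A (t \<mu>) \<otimes> (p \<mu> \<otimes> p \<nu>) \<otimes> t \<nu> = (adj A (t \<mu>) \<otimes> p \<mu>) \<otimes> (p \<nu> \<otimes> t \<nu>)"
        using P by (simp add: p_def mult_assoc)
      then show ?thesis using P t_adj_partial t_partial by (simp add: p_def)
    qed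
    ultimately show ?thesis using P by simp
  qed
qed

definition E :: "'a \<Rightarrow> 'a \<Rightarrow> 'b" where "E \<mu> \<nu> = t \<mu> \<otimes> adj A (t \<nu>)"

lemma E_closed [simp]: "\<mu> \<in> P \<Longrightarrow> \<nu> \<in> P \<Longrightarrow> E \<mu> \<nu> \<in> carrier A" by (simp add: E_def)

lemma adj_E: "\<mu> \<in> P \<Longrightarrow> \<nu> \<in> P \<Longrightarrow> adj A (E \<mu> \<nu>) = E \<nu> \<mu>" by (simp add: E_def adj_mult)

definition matrix_units :: "'a set \<Rightarrow> 'b set" where
  "matrix_units F = {E \<alpha> \<beta> | \<alpha> \<beta>. \<alpha> \<in> F \<and> \<beta> \<in> F \<and> s \<alpha> = s \<beta>}"

lemma matrix_units_closed: "F \<subseteq> P \<Longrightarrow> matrix_units F \<subseteq> carrier A"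
  by (auto simp: matrix_units_def subset_iff)

lemma matrix_unitsI: "\<lbrakk>\<alpha> \<in> F; \<beta> \<in> F; s \<alpha> = s \<beta>\<rbrakk> \<Longrightarrow> E \<alpha> \<beta> \<in> matrix_units F"
  unfolding matrix_units_def by blast

lemma E_t: assumes "\<alpha> \<in> le_paths \<Lambda> n" "\<beta> \<in> le_paths \<Lambda> n" "\<nu> \<in> le_paths \<Lambda> n" "s \<alpha> = s \<beta>"
  shows "E \<alpha> \<beta> \<otimes> t \<nu> = (if \<beta> = \<nu> then t \<alpha> else \<zero>)"
proof -
  have P: "\<alpha> \<in> P" "\<beta> \<in> P" "\<nu> \<in> P" using assms le_pathsD(1) by auto
  have "E \<alpha> \<beta> \<otimes> t \<nu> = t \<alpha> \<otimes> (adj A (t \<beta>) \<otimes> t \<nu>)" using P by (simp add: E_def mult_assoc)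
  then show ?thesis using assms P t_orth t_source[OF P(1)] by (auto simp: t_adj_mult)
qed

lemma matrix_units_mult:
  assumes F: "F \<subseteq> le_paths \<Lambda> n" and x: "x \<in> lin (matrix_units F)" and y: "y \<in> lin (matrix_units F)"
  shows "x \<otimes> y \<in> lin (matrix_units F)"
proof (rule lin_mult[OF x y])
  have FP: "F \<subseteq> P" using F le_pathsD(1) by blast
  fix g h assume "g \<in> matrix_units F" "h \<in> matrix_units F"
  then obtain \<alpha> \<beta> \<alpha>' \<beta>' where gh: "g = E \<alpha> \<beta>" "\<alpha> \<in> F" "\<beta> \<in> F" "s \<alpha> = s \<beta>" "h = E \<alpha>' \<beta>'" "\<alpha>' \<in> F" "\<beta>' \<in> F" "s \<alpha>' = s \<beta>'"
    unfolding matrix_units_def by blast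
  have P: "\<alpha> \<in> P" "\<beta> \<in> P" "\<alpha>' \<in> P" "\<beta>' \<in> P" using gh FP by auto
  have "g \<otimes> h = (E \<alpha> \<beta> \<otimes> t \<alpha>') \<otimes> adj A (t \<beta>')" using P by (simp add: gh(1,5)) (simp add: E_def mult_assoc)
  also have "\<dots> = (if \<beta> = \<alpha>' then E \<alpha> \<beta>' else \<zero>)"
  proof -
    have L: "\<alpha> \<in> le_paths \<Lambda> n" "\<beta> \<in> le_paths \<Lambda> n" "\<alpha>' \<in> le_paths \<Lambda> n" using gh F by auto
    show ?thesis unfolding E_t[OF L gh(4)] using P by (simp add: E_def)
  qed
  finally have eq: "g \<otimes> h = (if \<beta> = \<alpha>' then E \<alpha> \<beta>' else \<zero>)" .
  show "g \<otimes> h \<in> lin (matrix_units F)"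
  proof (cases "\<beta> = \<alpha>'")
    case True
    then have "E \<alpha> \<beta>' \<in> matrix_units F" using gh by (auto simp: matrix_units_def)
    then show ?thesis using eq True lin_generator[OF _ matrix_units_closed[OF FP]] by simp
  qed (simp add: eq lin_zero)
qed (use F le_pathsD(1) matrix_units_closed in blast)+

text \<open>The scalar is the diagonal entry of \<open>x\<close> at \<open>\<nu>\<close>.\<close>

lemma matrix_units_compress:
  assumes F: "F \<subseteq> le_paths \<Lambda> n" and x: "x \<in> lin (matrix_units F)" and \<nu>: "\<nu> \<in> F"
  shows "\<exists>c. adj A (t \<nu>) \<otimes> x \<otimes> t \<nu> = c \<odot> t (s \<nu>)"
proof -
  have FP: "F \<subseteq> P" using F le_pathsD(1) by blast
  then have \<nu>P: "\<nu> \<in> P" using \<nu> by blast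
  have "adj A (t \<nu>) \<otimes> x \<otimes> t \<nu> \<in> lin {t (s \<nu>)}"
  proof (rule lin_sandwich[OF x matrix_units_closed[OF FP]])
    fix g assume "g \<in> matrix_units F"
    then obtain \<alpha> \<beta> where g: "g = E \<alpha> \<beta>" "\<alpha> \<in> F" "\<beta> \<in> F" "s \<alpha> = s \<beta>" unfolding matrix_units_def by blast
    have P: "\<alpha> \<in> P" "\<beta> \<in> P" using g FP by auto
    have "adj A (t \<nu>) \<otimes> g \<otimes> t \<nu> = adj A (t \<nu>) \<otimes> (E \<alpha> \<beta> \<otimes> t \<nu>)" using P \<nu>P by (simp add: g(1) mult_assoc)
    also have "\<dots> = (if \<beta> = \<nu> \<and> \<alpha> = \<nu> then t (s \<nu>) else \<zero>)"
    proof -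
      have L: "\<alpha> \<in> le_paths \<Lambda> n" "\<beta> \<in> le_paths \<Lambda> n" "\<nu> \<in> le_paths \<Lambda> n" using g \<nu> F by auto
      show ?thesis unfolding E_t[OF L g(4)] using P \<nu>P t_orth[OF L(3,1)] by (auto simp: t_adj_mult)
    qed
    finally show "adj A (t \<nu>) \<otimes> g \<otimes> t \<nu> \<in> lin {t (s \<nu>)}"
      using \<nu>P by (auto intro: lin_zero lin_generator)
  qed (use \<nu>P in auto)
  moreover have "\<exists>c. y = c \<odot> t (s \<nu>)" if "y \<in> lin {t (s \<nu>)}" for y
    using that
  proof (induction rule: lin.induct)
    case lin_zero then show ?case using \<nu>P scale_zero[of "t (s \<nu>)"] by (intro exI[of _ 0]) simp
  next
    case (lin_step g x c)
    then obtain e where "x = e \<odot> t (s \<nu>)" by blast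
    then show ?case using lin_step \<nu>P by (intro exI[of _ "c + e"]) (simp add: add_scale)
  qed
  ultimately show ?thesis by blast
qed

text \<open>The projection \<open>\<Sum> t\<^sub>\<nu> t\<^sub>\<nu>*\<close> over \<open>\<nu> \<in> F\<close> is a unit for the matrix algebra.\<close>

lemma matrix_units_bound:
  assumes F: "F \<subseteq> le_paths \<Lambda> n" "finite F" and x: "x \<in> lin (matrix_units F)"
  shows "nrm A x \<le> (\<Sum>\<nu>\<in>F. nrm A (x \<otimes> t \<nu>))"
proof -
  have FP: "F \<subseteq> P" using F le_pathsD(1) by blast
  note MC = matrix_units_closed[OF FP]
  note xc = lin_closed[OF x MC]
  have EF: "(\<lambda>\<nu>. E \<nu> \<nu>) \<in> F \<rightarrow> carrier A" using FP by auto
  define Q where "Q = (\<Oplus>\<nu>\<in>F. E \<nu> \<nu>)"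
  have Q: "Q \<in> carrier A" unfolding Q_def by (rule finsum_closed[OF EF])
  have "x \<otimes> Q = x"
    using x
  proof (induction rule: lin.induct)
    case lin_zero then show ?case using Q by simp
  next
    case (lin_step g x c)
    then obtain \<alpha> \<beta> where g: "g = E \<alpha> \<beta>" "\<alpha> \<in> F" "\<beta> \<in> F" "s \<alpha> = s \<beta>" unfolding matrix_units_def by blast
    have P: "\<alpha> \<in> P" "\<beta> \<in> P" using g FP by auto
    have summand: "E \<alpha> \<beta> \<otimes> E \<nu> \<nu> = (if \<nu> = \<beta> then E \<alpha> \<beta> else \<zero>)" if "\<nu> \<in> F" for \<nu>
    proof -
      have \<nu>: "\<nu> \<in> P" using that FP by blast
      have "E \<alpha> \<beta> \<otimes> E \<nu> \<nu> = (E \<alpha> \<beta> \<otimes> t \<nu>) \<otimes> adj A (t \<nu>)" using P \<nu> by (simp add: E_def mult_assoc)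
      also have "\<dots> = (if \<nu> = \<beta> then E \<alpha> \<beta> else \<zero>)"
      proof -
        have L: "\<alpha> \<in> le_paths \<Lambda> n" "\<beta> \<in> le_paths \<Lambda> n" "\<nu> \<in> le_paths \<Lambda> n" using g that F by auto
        show ?thesis unfolding E_t[OF L g(4)] using P \<nu> by (auto simp: E_def)
      qed
      finally show ?thesis .
    qed
    have "E \<alpha> \<beta> \<otimes> Q = (\<Oplus>\<nu>\<in>F. E \<alpha> \<beta> \<otimes> E \<nu> \<nu>)" unfolding Q_def using P by (intro finsum_mult_left F(2) EF) auto
    also have "\<dots> = (\<Oplus>\<nu>\<in>F. if \<beta> = \<nu> then E \<alpha> \<beta> else \<zero>)"
      using P summand by (intro finsum_cong') auto
    also have "\<dots> = E \<alpha> \<beta>" using P g F(2) finsum_singleton[of \<beta> F "\<lambda>_. E \<alpha> \<beta>"] by simp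
    finally have "g \<otimes> Q = g" by (simp add: g)
    then show ?case using lin_step(3) P Q lin_closed[OF lin_step(2) MC] by (simp add: g(1) distrib_right smult_mult_left)
  qed
  then have "x = (\<Oplus>\<nu>\<in>F. x \<otimes> E \<nu> \<nu>)" using finsum_mult_left[OF F(2) EF xc] by (simp add: Q_def)
  then have "nrm A x = nrm A (\<Oplus>\<nu>\<in>F. x \<otimes> E \<nu> \<nu>)" by simp
  also have "\<dots> \<le> (\<Sum>\<nu>\<in>F. nrm A (x \<otimes> E \<nu> \<nu>))" using EF xc by (intro nrm_finsum_le F(2)) auto
  also have "\<dots> \<le> (\<Sum>\<nu>\<in>F. nrm A (x \<otimes> t \<nu>))"
  proof (rule sum_mono)
    fix \<nu> assume "\<nu> \<in> F"
    then have \<nu>: "\<nu> \<in> P" using FP by blast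
    have "nrm A (x \<otimes> E \<nu> \<nu>) = nrm A ((x \<otimes> t \<nu>) \<otimes> adj A (t \<nu>))" using \<nu> xc by (simp add: E_def mult_assoc)
    also have "\<dots> \<le> nrm A (x \<otimes> t \<nu>) * nrm A (adj A (t \<nu>))" using \<nu> xc by (intro nrm_mult) auto
    also have "\<dots> \<le> nrm A (x \<otimes> t \<nu>) * 1" using \<nu> xc nrm_t[OF \<nu>] by (intro mult_left_mono) (auto simp: nrm_adj)
    finally show "nrm A (x \<otimes> E \<nu> \<nu>) \<le> nrm A (x \<otimes> t \<nu>)" by simp
  qed
  finally show ?thesis .
qed

text \<open>If \<open>c\<close> shrank every column \<open>y t\<^sub>\<nu>\<close> by the factor \<open>\<delta>\<close>, then \<open>c\<^sup>N\<close> would shrink the \<open>|F|\<close> columns \<open>t\<^sub>\<nu>\<close> by \<open>\<delta>\<^sup>N\<close>, and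
\<open>\<parallel>c\<parallel>\<^sup>N = \<parallel>c\<^sup>N\<parallel> \<le> |F| \<delta>\<^sup>N\<close> for all \<open>N = 2\<^sup>k\<close>, which contradicts \<open>\<delta> < \<parallel>c\<parallel>\<close>.\<close>

lemma near_maximal_vector:
  assumes F: "F \<subseteq> le_paths \<Lambda> n" "finite F" and c: "c \<in> lin (matrix_units F)" "adj A c = c"
    and \<delta>: "0 < \<delta>" "\<delta> < nrm A c"
  shows "\<exists>\<nu>\<in>F. \<exists>y \<in> lin (matrix_units F). \<delta> * nrm A (y \<otimes> t \<nu>) < nrm A (c \<otimes> (y \<otimes> t \<nu>))"
proof (rule ccontr)
  assume "\<not> ?thesis"
  then have le: "nrm A (c \<otimes> (y \<otimes> t \<nu>)) \<le> \<delta> * nrm A (y \<otimes> t \<nu>)" if "\<nu> \<in> F" "y \<in> lin (matrix_units F)" for \<nu> y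
    using that by (meson not_le)
  have FP: "F \<subseteq> P" using F le_pathsD(1) by blast
  note MC = matrix_units_closed[OF FP]
  note cc = lin_closed[OF c(1) MC]
  have pw: "iterated_square c k \<in> lin (matrix_units F)" for k
    by (induction k) (simp_all add: c matrix_units_mult[OF F(1)])
  have main: "nrm A (iterated_square c k \<otimes> (y \<otimes> t \<nu>)) \<le> \<delta> ^ (2 ^ k) * nrm A (y \<otimes> t \<nu>)"
    if "\<nu> \<in> F" "y \<in> lin (matrix_units F)" for k \<nu> y
    using that(2)
  proof (induction k arbitrary: y)
    case 0 then show ?case using le[OF that(1)] by simp
  next
    case (Suc k)
    have \<nu>: "\<nu> \<in> P" using that FP by blast
    have y: "y \<in> carrier A" using lin_closed[OF Suc(2) MC] .
    have pc: "iterated_square c k \<in> carrier A" using lin_closed[OF pw MC] .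
    have "iterated_square c (Suc k) \<otimes> (y \<otimes> t \<nu>) = iterated_square c k \<otimes> ((iterated_square c k \<otimes> y) \<otimes> t \<nu>)" using pc y \<nu> by (simp add: mult_assoc)
    then have "nrm A (iterated_square c (Suc k) \<otimes> (y \<otimes> t \<nu>)) \<le> \<delta> ^ (2 ^ k) * nrm A ((iterated_square c k \<otimes> y) \<otimes> t \<nu>)"
      using Suc(1)[OF matrix_units_mult[OF F(1) pw Suc(2)]] by simp
    also have "\<dots> \<le> \<delta> ^ (2 ^ k) * (\<delta> ^ (2 ^ k) * nrm A (y \<otimes> t \<nu>))"
      using Suc(1)[OF Suc(2)] pc y \<nu> \<delta> by (intro mult_left_mono) (simp_all add: mult_assoc)
    also have "\<dots> = \<delta> ^ (2 ^ Suc k) * nrm A (y \<otimes> t \<nu>)" by (simp add: mult_2 power_add)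
    finally show ?case .
  qed
  have bound: "nrm A c ^ (2 ^ k) \<le> card F * \<delta> ^ (2 ^ k)" for k
  proof -
    have "nrm A c ^ (2 ^ k) = nrm A (iterated_square c k)" using iterated_square_self_adjoint[OF cc c(2)] by simp
    also have "\<dots> \<le> (\<Sum>\<nu>\<in>F. nrm A (iterated_square c k \<otimes> t \<nu>))" by (rule matrix_units_bound[OF F pw])
    also have "\<dots> \<le> (\<Sum>\<nu>\<in>F. \<delta> ^ (2 ^ k))"
    proof (rule sum_mono)
      fix \<nu> assume \<nu>: "\<nu> \<in> F"
      then have \<nu>P: "\<nu> \<in> P" using FP by blast
      have "E \<nu> \<nu> \<in> lin (matrix_units F)" using \<nu> by (intro lin_generator MC) (auto simp: matrix_units_def)
      from main[OF \<nu> this, of k] have "nrm A (iterated_square c k \<otimes> t \<nu>) \<le> \<delta> ^ (2 ^ k) * nrm A (t \<nu>)"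
        using t_partial[OF \<nu>P] by (simp add: E_def)
      also have "\<dots> \<le> \<delta> ^ (2 ^ k) * 1" using nrm_t[OF \<nu>P] \<delta> by (intro mult_left_mono) auto
      finally show "nrm A (iterated_square c k \<otimes> t \<nu>) \<le> \<delta> ^ (2 ^ k)" by simp
    qed
    finally show ?thesis by simp
  qed
  define q where "q = nrm A c / \<delta>"
  have q: "q > 1" using \<delta> by (simp add: q_def)
  obtain k where k: "real (card F) < q ^ k" using real_arch_pow[OF q] by blast
  have "k \<le> 2 ^ k" by (simp add: less_imp_le)
  then have "q ^ k \<le> q ^ (2 ^ k)" using q by (intro power_increasing) auto
  also have "\<dots> \<le> real (card F)" using bound[of k] \<delta> by (simp add: q_def power_divide field_simps)
  finally show False using k by simp
qed

text \<open>Let \<open>\<rho> = \<parallel>a\<parallel>\<close>, so \<open>\<parallel>c\<parallel> \<ge> 4\<rho>/5\<close>, and choose a column \<open>u\<close> with \<open>\<parallel>cu\<parallel> > 3\<rho>/4 \<parallel>u\<parallel>\<close>. The element \<open>u* c\<^sup>2 u\<close> is a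
multiple of a vertex projection with norm \<open>\<parallel>cu\<parallel>\<^sup>2 > 9\<rho>\<^sup>2/16 \<parallel>u\<parallel>\<^sup>2\<close>, whereas its distance to \<open>u* a\<^sup>2 u\<close> is at most
\<open>\<parallel>c\<^sup>2 - a\<^sup>2\<parallel> \<parallel>u\<parallel>\<^sup>2 \<le> 11\<rho>\<^sup>2/25 \<parallel>u\<parallel>\<^sup>2\<close>.\<close>

lemma vertex_in_ideal_of_approximation:
  assumes I: "cstar_ideal A I" and a: "a \<in> I" "adj A a = a" "a \<noteq> \<zero>"
    and F: "F \<subseteq> le_paths \<Lambda> n" "finite F" and c: "c \<in> lin (matrix_units F)" "adj A c = c"
    and near: "nrm A (a \<ominus> c) \<le> nrm A a / 5"
  shows "\<exists>w \<in> vertices \<Lambda>. t w \<in> I"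
proof -
  define \<rho> where "\<rho> = nrm A a"
  have ac: "a \<in> carrier A" using a ideal_closed(1)[OF I] by blast
  have \<rho>: "\<rho> > 0" using ac a nrm_eq_0[of a] nrm_nonneg[of a] by (simp add: \<rho>_def less_le)
  have FP: "F \<subseteq> P" using F le_pathsD(1) by blast
  note MC = matrix_units_closed[OF FP]
  note cc = lin_closed[OF c(1) MC]
  have nc: "nrm A c \<le> 6/5 * \<rho>" "4/5 * \<rho> \<le> nrm A c"
    using nrm_le_diff[of c a] nrm_le_diff[of a c] near ac cc nrm_minus_commute[of a c] by (simp_all add: \<rho>_def)
  obtain \<nu> y where \<nu>: "\<nu> \<in> F" and y: "y \<in> lin (matrix_units F)"
    and big: "3/4 * \<rho> * nrm A (y \<otimes> t \<nu>) < nrm A (c \<otimes> (y \<otimes> t \<nu>))"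
    using near_maximal_vector[OF F c, of "3/4 * \<rho>"] \<rho> nc(2) by auto
  have \<nu>P: "\<nu> \<in> P" using \<nu> FP by blast
  have yc: "y \<in> carrier A" using lin_closed[OF y MC] .
  define u where "u = y \<otimes> t \<nu>"
  have u: "u \<in> carrier A" using yc \<nu>P by (simp add: u_def)
  define w where "w = s \<nu>"
  have w: "w \<in> vertices \<Lambda>" using \<nu>P by (simp add: w_def)
  have tw: "t w \<in> carrier A" using vertexD(1)[OF w] by simp
  have uw: "u \<otimes> t w = u" using yc \<nu>P t_source[OF \<nu>P] by (simp add: u_def w_def mult_assoc)
  have wu: "t w \<otimes> adj A u = adj A u" using arg_cong[OF uw, of "adj A"] u tw t_vertex[OF w] by (simp add: adj_mult)
  have "adj A y \<in> lin (matrix_units F)"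
  proof (rule lin_adj[OF y MC MC])
    fix g assume "g \<in> matrix_units F"
    then obtain \<alpha> \<beta> where "g = E \<alpha> \<beta>" "\<alpha> \<in> F" "\<beta> \<in> F" "s \<alpha> = s \<beta>" unfolding matrix_units_def by blast
    then have "adj A g = E \<beta> \<alpha>" "E \<beta> \<alpha> \<in> matrix_units F"
      using FP adj_E[of \<alpha> \<beta>] matrix_unitsI[of \<beta> F \<alpha>] by auto
    then show "adj A g \<in> lin (matrix_units F)" using lin_generator[OF _ MC] by simp
  qed
  then have "adj A y \<otimes> ((c \<otimes> c) \<otimes> y) \<in> lin (matrix_units F)"
    by (intro matrix_units_mult[OF F(1)] c y)
  then obtain l where "adj A (t \<nu>) \<otimes> (adj A y \<otimes> ((c \<otimes> c) \<otimes> y)) \<otimes> t \<nu> = l \<odot> t w"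
    using matrix_units_compress[OF F(1) _ \<nu>] by (auto simp: w_def)
  then have l: "adj A u \<otimes> (c \<otimes> c) \<otimes> u = l \<odot> t w" using yc \<nu>P cc by (simp add: u_def adj_mult mult_assoc)
  define x where "x = adj A u \<otimes> (a \<otimes> a) \<otimes> u"
  have x: "x \<in> I" unfolding x_def using u ac a(1) by (intro ideal_closed(5,6)[OF I]) auto
  have xc: "x \<in> carrier A" using u ac by (simp add: x_def)
  have nl: "nrm A (l \<odot> t w) = (nrm A (c \<otimes> u))\<^sup>2"
  proof -
    have "adj A (c \<otimes> u) \<otimes> (c \<otimes> u) = l \<odot> t w" using l u cc c(2) by (simp add: adj_mult mult_assoc)
    then show ?thesis using nrm_adj_mult[of "c \<otimes> u"] u cc by simp
  qed
  have "l \<odot> t w \<ominus> x = adj A u \<otimes> (c \<otimes> c \<ominus> a \<otimes> a) \<otimes> u"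
    using u cc ac by (simp add: x_def mult_minus_left mult_minus_right flip: l)
  then have "nrm A (l \<odot> t w \<ominus> x) \<le> nrm A (adj A u) * nrm A (c \<otimes> c \<ominus> a \<otimes> a) * nrm A u"
    using nrm_mult[of "adj A u \<otimes> (c \<otimes> c \<ominus> a \<otimes> a)" u] nrm_mult[of "adj A u" "c \<otimes> c \<ominus> a \<otimes> a"] u cc ac
    by (smt (verit) mult_right_mono nrm_nonneg adj_closed mult_closed minus_closed)
  also have "\<dots> \<le> nrm A u * (11/25 * \<rho>\<^sup>2) * nrm A u"
  proof -
    have "nrm A (c \<otimes> c \<ominus> a \<otimes> a) \<le> nrm A c * nrm A (c \<ominus> a) + nrm A (c \<ominus> a) * nrm A a"
      using minus_mult_mult[OF cc cc ac ac] nrm_add[of "c \<otimes> (c \<ominus> a)" "(c \<ominus> a) \<otimes> a"]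
        nrm_mult[of c "c \<ominus> a"] nrm_mult[of "c \<ominus> a" a] cc ac by simp
    also have "\<dots> \<le> (6/5 * \<rho>) * (\<rho> / 5) + \<rho> / 5 * \<rho>"
      using nc near cc ac \<rho> nrm_minus_commute[of a c] by (intro add_mono mult_mono) (auto simp: \<rho>_def)
    also have "\<dots> = 11/25 * \<rho>\<^sup>2" by (simp add: power2_eq_square)
    finally show ?thesis using u cc ac by (intro mult_mono) (auto simp: nrm_adj)
  qed
  also have "\<dots> \<le> (3/4 * \<rho> * nrm A u)\<^sup>2"
  proof -
    have "nrm A u * (11/25 * \<rho>\<^sup>2) * nrm A u = 11/25 * (\<rho> * nrm A u)\<^sup>2" "(3/4 * \<rho> * nrm A u)\<^sup>2 = 9/16 * (\<rho> * nrm A u)\<^sup>2"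
      by (simp_all add: power2_eq_square)
    moreover have "0 \<le> (\<rho> * nrm A u)\<^sup>2" by simp
    ultimately show ?thesis by linarith
  qed
  also have "\<dots> < (nrm A (c \<otimes> u))\<^sup>2"
    using big \<rho> u by (intro power_strict_mono) (auto simp: u_def)
  finally have lt: "nrm A (l \<odot> t w \<ominus> x) < nrm A (l \<odot> t w)" using nl by simp
  show ?thesis
  proof (cases "t w = \<zero>")
    case True
    then show ?thesis using w ideal_closed(2)[OF I] by (intro bexI[of _ w]) simp_all
  next
    case False
    then have n1: "nrm A (t w) = 1" using nrm_projection(2)[OF tw] t_vertex[OF w] by simp
    have l0: "l \<noteq> 0"
    proof
      assume "l = 0"
      then have "nrm A (l \<odot> t w) = 0" using tw by (simp add: scale_zero)
      moreover have "0 \<le> nrm A (l \<odot> t w \<ominus> x)" using xc tw by simp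
      ultimately show False using lt by linarith
    qed
    have "t w \<ominus> (1 / l) \<odot> x = (1 / l) \<odot> (l \<odot> t w \<ominus> x)"
      using l0 tw xc by (simp add: scale_minus_right scale_scale)
    then have "nrm A (t w \<ominus> (1 / l) \<odot> x) = nrm A (l \<odot> t w \<ominus> x) / cmod l"
      using tw xc by (simp add: nrm_smult norm_divide)
    also have "\<dots> < 1" using lt n1 tw l0 by (simp add: nrm_smult)
    finally have "nrm A (t w \<ominus> (1 / l) \<odot> x) < 1" .
    moreover have "t w \<otimes> x = x" using wu u tw ac by (simp add: x_def flip: mult_assoc)
    moreover have "x \<otimes> t w = x" using uw u tw ac by (simp add: x_def mult_assoc)
    ultimately have "t w \<in> I"
      using projection_in_ideal[OF I ideal_closed(4)[OF I x, of "1 / l"] tw] t_vertex[OF w] tw xc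
      by (simp add: smult_mult_left smult_mult_right)
    then show ?thesis using w by blast
  qed
qed

end

section \<open>The dense span and the core\<close>

context ck_family
begin

lemma t_split: assumes "\<mu> \<in> P" "\<nu> \<in> P" "s \<mu> = r \<nu>" shows "t (\<mu> \<cdot> \<nu>) = t \<mu> \<otimes> t \<nu>"
  using t_mult[OF assms] by simp

lemma from_range_le_pathsD: "\<eta> \<in> from_range \<Lambda> v (le_paths \<Lambda> n) \<Longrightarrow> \<eta> \<in> P \<and> r \<eta> = v \<and> \<eta> \<in> le_paths \<Lambda> n"
  using le_pathsD(1) by (auto simp: from_range_def)

text \<open>Let \<open>n\<close> be the supremum of the two degrees. Expanding \<open>t\<^bsub>s(\<nu>)\<^esub>\<close> and \<open>t\<^bsub>s(\<alpha>)\<^esub>\<close> on the two sides by paths that lengthen \<open>\<nu>\<close> and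
\<open>\<alpha>\<close> to elements of \<open>\<Lambda>\<^bsup>\<le>n\<^esup>\<close> leaves terms \<open>t\<^sub>\<eta> t\<^bsub>\<nu>\<eta>\<^esub>* t\<^bsub>\<alpha>\<zeta>\<^esub> t\<^sub>\<zeta>*\<close>, which vanish unless \<open>\<nu>\<eta> = \<alpha>\<zeta>\<close>.\<close>

lemma adj_t_mult_t:
  assumes \<nu>: "\<nu> \<in> P" and \<alpha>: "\<alpha> \<in> P"
  shows "adj A (t \<nu>) \<otimes> t \<alpha> \<in> lin {E \<eta> \<zeta> | \<eta> \<zeta>. \<eta> \<in> P \<and> \<zeta> \<in> P \<and> s \<eta> = s \<zeta> \<and> r \<eta> = s \<nu> \<and> r \<zeta> = s \<alpha>}"
    (is "_ \<in> lin ?K")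
proof -
  have K: "?K \<subseteq> carrier A" by auto
  define n :: "nat ^ 'k" where "n = (\<chi> i. max (d \<nu> $ i) (d \<alpha> $ i))"
  have n: "d \<nu> \<le> n" "d \<alpha> \<le> n" by (simp_all add: n_def less_eq_vec_def)
  define G1 where "G1 = from_range \<Lambda> (s \<nu>) (le_paths \<Lambda> (n - d \<nu>))"
  define G2 where "G2 = from_range \<Lambda> (s \<alpha>) (le_paths \<Lambda> (n - d \<alpha>))"
  have G1: "finite G1" "\<And>\<eta>. \<eta> \<in> G1 \<Longrightarrow> \<eta> \<in> P \<and> r \<eta> = s \<nu> \<and> \<eta> \<in> le_paths \<Lambda> (n - d \<nu>)"
    using finite_le_paths[OF rf] \<nu> from_range_le_pathsD unfolding G1_def by auto
  have G2: "finite G2" "\<And>\<eta>. \<eta> \<in> G2 \<Longrightarrow> \<eta> \<in> P \<and> r \<eta> = s \<alpha> \<and> \<eta> \<in> le_paths \<Lambda> (n - d \<alpha>)"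
    using finite_le_paths[OF rf] \<alpha> from_range_le_pathsD unfolding G2_def by auto
  have E1: "E \<eta> \<eta> \<in> carrier A" if "\<eta> \<in> G1" for \<eta> using G1(2)[OF that] by simp
  have E2: "E \<eta> \<eta> \<in> carrier A" if "\<eta> \<in> G2" for \<eta> using G2(2)[OF that] by simp
  define X where "X = adj A (t \<nu>) \<otimes> t \<alpha>"
  have X: "X \<in> carrier A" using \<nu> \<alpha> by (simp add: X_def)
  have "t (s \<nu>) \<otimes> adj A (t \<nu>) = adj A (t \<nu>)"
    using arg_cong[OF t_source[OF \<nu>], of "adj A"] \<nu> by (simp add: adj_mult t_vertex)
  then have X1: "t (s \<nu>) \<otimes> X = X" using \<nu> \<alpha> by (simp add: X_def flip: mult_assoc)
  have X2: "X \<otimes> t (s \<alpha>) = X" using \<nu> \<alpha> t_source[OF \<alpha>] by (simp add: X_def mult_assoc)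
  have t1: "t (s \<nu>) = (\<Oplus>\<eta>\<in>G1. E \<eta> \<eta>)" using t_sum[of "s \<nu>" "n - d \<nu>"] \<nu> by (simp add: G1_def E_def)
  have t2: "t (s \<alpha>) = (\<Oplus>\<eta>\<in>G2. E \<eta> \<eta>)" using t_sum[of "s \<alpha>" "n - d \<alpha>"] \<alpha> by (simp add: G2_def E_def)
  have "(\<Oplus>\<eta>\<in>G1. E \<eta> \<eta> \<otimes> X) = t (s \<nu>) \<otimes> X"
    unfolding t1 using E1 by (intro finsum_mult_right[symmetric] G1(1) X) auto
  then have "X = (\<Oplus>\<eta>\<in>G1. E \<eta> \<eta> \<otimes> X)" using X1 by simp
  moreover have "(\<Oplus>\<eta>\<in>G1. E \<eta> \<eta> \<otimes> X) \<in> lin ?K"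
  proof (rule lin_finsum[OF K G1(1)])
    fix \<eta> assume \<eta>: "\<eta> \<in> G1"
    note \<eta>P = G1(2)[OF \<eta>]
    have "(\<Oplus>\<zeta>\<in>G2. (E \<eta> \<eta> \<otimes> X) \<otimes> E \<zeta> \<zeta>) = (E \<eta> \<eta> \<otimes> X) \<otimes> t (s \<alpha>)"
      unfolding t2 using E2 \<eta>P X by (intro finsum_mult_left[symmetric] G2(1)) auto
    also have "\<dots> = E \<eta> \<eta> \<otimes> X" using X2 X \<alpha> \<eta>P by (simp add: mult_assoc)
    finally have eq: "E \<eta> \<eta> \<otimes> X = (\<Oplus>\<zeta>\<in>G2. (E \<eta> \<eta> \<otimes> X) \<otimes> E \<zeta> \<zeta>)" by simp
    have "(\<Oplus>\<zeta>\<in>G2. (E \<eta> \<eta> \<otimes> X) \<otimes> E \<zeta> \<zeta>) \<in> lin ?K"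
    proof (rule lin_finsum[OF K G2(1)])
      fix \<zeta> assume \<zeta>: "\<zeta> \<in> G2"
      note \<zeta>P = G2(2)[OF \<zeta>]
      have L: "\<nu> \<cdot> \<eta> \<in> le_paths \<Lambda> n" "\<alpha> \<cdot> \<zeta> \<in> le_paths \<Lambda> n"
        using le_paths_cmp[OF \<nu> n(1)] le_paths_cmp[OF \<alpha> n(2)] \<eta>P \<zeta>P by auto
      have "(E \<eta> \<eta> \<otimes> X) \<otimes> E \<zeta> \<zeta> = t \<eta> \<otimes> (adj A (t (\<nu> \<cdot> \<eta>)) \<otimes> t (\<alpha> \<cdot> \<zeta>)) \<otimes> adj A (t \<zeta>)"
        using \<eta>P \<zeta>P \<nu> \<alpha> by (simp add: E_def X_def t_split adj_mult mult_assoc)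
      also have "\<dots> = (if \<nu> \<cdot> \<eta> = \<alpha> \<cdot> \<zeta> then E \<eta> \<zeta> else \<zero>)"
      proof (cases "\<nu> \<cdot> \<eta> = \<alpha> \<cdot> \<zeta>")
        case True
        have "adj A (t (\<nu> \<cdot> \<eta>)) \<otimes> t (\<alpha> \<cdot> \<zeta>) = t (s \<eta>)"
          using \<eta>P \<nu> t_adj_mult[of "\<nu> \<cdot> \<eta>"] by (simp flip: True)
        then show ?thesis using True \<eta>P \<zeta>P t_source[of \<eta>] by (simp add: E_def)
      next
        case False
        then show ?thesis using t_orth[OF L False] \<eta>P \<zeta>P by simp
      qed
      finally have eq: "(E \<eta> \<eta> \<otimes> X) \<otimes> E \<zeta> \<zeta> = (if \<nu> \<cdot> \<eta> = \<alpha> \<cdot> \<zeta> then E \<eta> \<zeta> else \<zero>)" .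
      show "(E \<eta> \<eta> \<otimes> X) \<otimes> E \<zeta> \<zeta> \<in> lin ?K"
      proof (cases "\<nu> \<cdot> \<eta> = \<alpha> \<cdot> \<zeta>")
        case True
        have "s (\<nu> \<cdot> \<eta>) = s \<eta>" "s (\<alpha> \<cdot> \<zeta>) = s \<zeta>" using \<eta>P \<zeta>P \<nu> \<alpha> by simp_all
        then have "s \<eta> = s \<zeta>" using True by simp
        then have "E \<eta> \<zeta> \<in> ?K" using \<eta>P \<zeta>P by blast
        then show ?thesis using eq True lin_generator[OF _ K] by simp
      qed (simp add: eq lin_zero)
    qed
    then show "E \<eta> \<eta> \<otimes> X \<in> lin ?K" using eq by simp
  qed
  ultimately show ?thesis by (simp add: X_def)
qed

abbreviation span :: "'b set" where "span \<equiv> lin (matrix_units P)"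

lemma all_units_closed: "matrix_units P \<subseteq> carrier A" by (rule matrix_units_closed) simp

lemma span_mult: assumes "x \<in> span" "y \<in> span" shows "x \<otimes> y \<in> span"
proof (rule lin_mult[OF assms all_units_closed all_units_closed all_units_closed])
  fix g h assume "g \<in> matrix_units P" "h \<in> matrix_units P"
  then obtain \<mu> \<nu> \<alpha> \<beta> where gh: "g = E \<mu> \<nu>" "\<mu> \<in> P" "\<nu> \<in> P" "s \<mu> = s \<nu>" "h = E \<alpha> \<beta>" "\<alpha> \<in> P" "\<beta> \<in> P" "s \<alpha> = s \<beta>"
    unfolding matrix_units_def by blast
  have "g \<otimes> h = t \<mu> \<otimes> (adj A (t \<nu>) \<otimes> t \<alpha>) \<otimes> adj A (t \<beta>)" using gh by (simp add: E_def mult_assoc)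
  also have "\<dots> \<in> span"
  proof (rule lin_sandwich[OF adj_t_mult_t[OF gh(3,6)] _ all_units_closed])
    fix g assume "g \<in> {E \<eta> \<zeta> |\<eta> \<zeta>. \<eta> \<in> P \<and> \<zeta> \<in> P \<and> s \<eta> = s \<zeta> \<and> r \<eta> = s \<nu> \<and> r \<zeta> = s \<alpha>}"
    then obtain \<eta> \<zeta> where g: "g = E \<eta> \<zeta>" "\<eta> \<in> P" "\<zeta> \<in> P" "s \<eta> = s \<zeta>" "r \<eta> = s \<nu>" "r \<zeta> = s \<alpha>" by blast
    have "t \<mu> \<otimes> g \<otimes> adj A (t \<beta>) = E (\<mu> \<cdot> \<eta>) (\<beta> \<cdot> \<zeta>)"
      using g gh(2-4,6-8) by (simp add: E_def t_split adj_mult mult_assoc)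
    moreover have "E (\<mu> \<cdot> \<eta>) (\<beta> \<cdot> \<zeta>) \<in> matrix_units P" using g gh(2-4,6-8) by (intro matrix_unitsI) auto
    ultimately show "t \<mu> \<otimes> g \<otimes> adj A (t \<beta>) \<in> span" using lin_generator[OF _ all_units_closed] by simp
  qed (use gh in auto)
  finally show "g \<otimes> h \<in> span" .
qed

lemma span_adj: assumes "x \<in> span" shows "adj A x \<in> span"
proof (rule lin_adj[OF assms all_units_closed all_units_closed])
  fix g assume "g \<in> matrix_units P"
  then obtain \<alpha> \<beta> where "g = E \<alpha> \<beta>" "\<alpha> \<in> P" "\<beta> \<in> P" "s \<alpha> = s \<beta>" unfolding matrix_units_def by blast
  then have "adj A g = E \<beta> \<alpha>" "E \<beta> \<alpha> \<in> matrix_units P"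
    using adj_E[of \<alpha> \<beta>] matrix_unitsI[of \<beta> P \<alpha>] by auto
  then show "adj A g \<in> span" using lin_generator[OF _ all_units_closed] by simp
qed

lemma span_dense:
  assumes gen: "\<And>S. cstar_subalgebra A S \<Longrightarrow> t ` P \<subseteq> S \<Longrightarrow> S = carrier A"
    and a: "a \<in> carrier A" and e: "e > 0"
  shows "\<exists>b \<in> span. nrm A (a \<ominus> b) < e"
proof -
  have DC: "span \<subseteq> carrier A" using lin_closed[OF _ all_units_closed] by blast
  have "t \<mu> \<in> span" if "\<mu> \<in> P" for \<mu>
  proof -
    have "t \<mu> = E \<mu> (s \<mu>)" using that t_source[OF that] by (simp add: E_def t_vertex)
    then show ?thesis using lin_generator[OF matrix_unitsI all_units_closed, of \<mu> "s \<mu>"] that by simp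
  qed
  moreover have "span \<subseteq> cstar_topology A closure_of span"
    by (rule closure_of_subset) (use DC in \<open>simp add: Metric_space.topspace_mtopology[OF Metric_space]\<close>)
  ultimately have "t ` P \<subseteq> cstar_topology A closure_of span" by blast
  moreover have "cstar_subalgebra A (cstar_topology A closure_of span)"
    by (rule cstar_subalgebra_closure[OF DC lin_zero lin_add[OF all_units_closed] lin_scale[OF _ all_units_closed] span_mult span_adj])
  ultimately have "cstar_topology A closure_of span = carrier A" using gen by blast
  then show ?thesis using a e closure_iff[OF DC, of a] by blast
qed

definition core_units :: "'b set" where
  "core_units = {E \<mu> \<nu> | \<mu> \<nu>. \<mu> \<in> P \<and> \<nu> \<in> P \<and> s \<mu> = s \<nu> \<and> d \<mu> = d \<nu>}"

lemma core_units_closed: "core_units \<subseteq> carrier A" by (auto simp: core_units_def)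

lemma core_adj: assumes "x \<in> lin core_units" shows "adj A x \<in> lin core_units"
proof (rule lin_adj[OF assms core_units_closed core_units_closed])
  fix g assume "g \<in> core_units"
  then obtain \<alpha> \<beta> where g: "g = E \<alpha> \<beta>" "\<alpha> \<in> P" "\<beta> \<in> P" "s \<alpha> = s \<beta>" "d \<alpha> = d \<beta>" unfolding core_units_def by blast
  then have "E \<beta> \<alpha> \<in> core_units" unfolding core_units_def by (intro CollectI exI[of _ \<beta>] exI[of _ \<alpha>]) simp
  then show "adj A g \<in> lin core_units" using lin_generator[OF _ core_units_closed] g adj_E by simp
qed

text \<open>Insert \<open>t\<^bsub>s(\<mu>)\<^esub> = \<Sum> t\<^sub>\<eta> t\<^sub>\<eta>*\<close> over \<open>\<eta> \<in> s(\<mu>)\<Lambda>\<^bsup>\<le>n-d(\<mu>)\<^esup>\<close>; equality of the degrees of \<open>\<mu>\<close> and \<open>\<nu>\<close> puts both \<open>\<mu>\<eta>\<close> and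
\<open>\<nu>\<eta>\<close> into \<open>\<Lambda>\<^bsup>\<le>n\<^esup>\<close>.\<close>

lemma E_refine:
  assumes \<mu>: "\<mu> \<in> P" and \<nu>: "\<nu> \<in> P" and eq: "s \<mu> = s \<nu>" "d \<mu> = d \<nu>" and n: "d \<mu> \<le> n"
  shows "\<exists>F. finite F \<and> F \<subseteq> le_paths \<Lambda> n \<and> E \<mu> \<nu> \<in> lin (matrix_units F)"
proof -
  define G where "G = from_range \<Lambda> (s \<mu>) (le_paths \<Lambda> (n - d \<mu>))"
  have G: "finite G" "\<And>\<eta>. \<eta> \<in> G \<Longrightarrow> \<eta> \<in> P \<and> r \<eta> = s \<mu> \<and> \<eta> \<in> le_paths \<Lambda> (n - d \<mu>)"
    using finite_le_paths[OF rf] \<mu> from_range_le_pathsD unfolding G_def by auto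
  define F where "F = (\<lambda>\<eta>. \<mu> \<cdot> \<eta>) ` G \<union> (\<lambda>\<eta>. \<nu> \<cdot> \<eta>) ` G"
  have F: "finite F" "F \<subseteq> le_paths \<Lambda> n"
    using G le_paths_cmp[OF \<mu> n] le_paths_cmp[OF \<nu>, of n] n eq by (auto simp: F_def)
  have FP: "F \<subseteq> P" using F(2) le_pathsD(1) by blast
  have EG: "E \<eta> \<eta> \<in> carrier A" if "\<eta> \<in> G" for \<eta> using G(2)[OF that] by simp
  have sumG: "(\<Oplus>\<eta>\<in>G. E \<eta> \<eta>) \<in> carrier A" using EG by (intro finsum_closed) auto
  have t1: "t (s \<mu>) = (\<Oplus>\<eta>\<in>G. E \<eta> \<eta>)" using t_sum[of "s \<mu>" "n - d \<mu>"] \<mu> by (simp add: G_def E_def)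
  have "E \<mu> \<nu> = t \<mu> \<otimes> t (s \<mu>) \<otimes> adj A (t \<nu>)" using t_source[OF \<mu>] by (simp add: E_def)
  also have "\<dots> = (\<Oplus>\<eta>\<in>G. t \<mu> \<otimes> E \<eta> \<eta>) \<otimes> adj A (t \<nu>)"
    unfolding t1 using EG \<mu> by (subst finsum_mult_left[OF G(1)]) auto
  also have "\<dots> = (\<Oplus>\<eta>\<in>G. t \<mu> \<otimes> E \<eta> \<eta> \<otimes> adj A (t \<nu>))"
    using EG \<mu> \<nu> by (intro finsum_mult_right[OF G(1)]) auto
  also have "\<dots> \<in> lin (matrix_units F)"
  proof (rule lin_finsum[OF matrix_units_closed[OF FP] G(1)])
    fix \<eta> assume \<eta>: "\<eta> \<in> G"
    note \<eta>P = G(2)[OF \<eta>]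
    have "t \<mu> \<otimes> E \<eta> \<eta> \<otimes> adj A (t \<nu>) = E (\<mu> \<cdot> \<eta>) (\<nu> \<cdot> \<eta>)"
      using \<eta>P \<mu> \<nu> eq by (simp add: E_def t_split adj_mult mult_assoc)
    moreover have "E (\<mu> \<cdot> \<eta>) (\<nu> \<cdot> \<eta>) \<in> matrix_units F"
      using \<eta> \<eta>P \<mu> \<nu> eq by (intro matrix_unitsI) (auto simp: F_def)
    ultimately show "t \<mu> \<otimes> E \<eta> \<eta> \<otimes> adj A (t \<nu>) \<in> lin (matrix_units F)"
      using lin_generator[OF _ matrix_units_closed[OF FP]] by simp
  qed
  finally show ?thesis using F by blast
qed

text \<open>The induction proves this for all large \<open>n\<close>, so that finitely many terms can be refined to the same \<open>n\<close>.\<close>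

lemma core_in_matrix_algebra:
  assumes "x \<in> lin core_units"
  shows "\<exists>n F. finite F \<and> F \<subseteq> le_paths \<Lambda> n \<and> x \<in> lin (matrix_units F)"
proof -
  have "\<exists>N. \<forall>n\<ge>N. \<exists>F. finite F \<and> F \<subseteq> le_paths \<Lambda> n \<and> x \<in> lin (matrix_units F)"
    using assms
  proof (induction rule: lin.induct)
    case lin_zero
    show ?case by (intro exI[of _ 0] allI impI exI[of _ "{}"]) (simp add: lin.lin_zero)
  next
    case (lin_step g x c)
    then obtain N where N: "\<And>n. n \<ge> N \<Longrightarrow> \<exists>F. finite F \<and> F \<subseteq> le_paths \<Lambda> n \<and> x \<in> lin (matrix_units F)" by blast
    obtain \<mu> \<nu> where g: "g = E \<mu> \<nu>" "\<mu> \<in> P" "\<nu> \<in> P" "s \<mu> = s \<nu>" "d \<mu> = d \<nu>"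
      using lin_step(1) unfolding core_units_def by blast
    show ?case
    proof (intro exI[of _ "N + d \<mu>"] allI impI)
      fix n assume n: "n \<ge> N + d \<mu>"
      have "N \<le> N + d \<mu>" "d \<mu> \<le> N + d \<mu>" by (simp_all add: less_eq_vec_def)
      then have n': "N \<le> n" "d \<mu> \<le> n" using n by (auto intro: order_trans)
      obtain F where F: "finite F" "F \<subseteq> le_paths \<Lambda> n" "x \<in> lin (matrix_units F)" using N[OF n'(1)] by blast
      obtain G where G: "finite G" "G \<subseteq> le_paths \<Lambda> n" "E \<mu> \<nu> \<in> lin (matrix_units G)"
        using E_refine[OF g(2-5) n'(2)] by blast
      have FG: "F \<subseteq> P" "G \<subseteq> P" using F(2) G(2) le_pathsD(1) by blast+
      have U: "matrix_units (F \<union> G) \<subseteq> carrier A" using FG by (intro matrix_units_closed) auto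
      have "matrix_units F \<subseteq> matrix_units (F \<union> G)" "matrix_units G \<subseteq> matrix_units (F \<union> G)"
        unfolding matrix_units_def by blast+
      then have "x \<in> lin (matrix_units (F \<union> G))" "E \<mu> \<nu> \<in> lin (matrix_units (F \<union> G))"
        using lin_lin[OF F(3) matrix_units_closed[OF FG(1)] U] lin_lin[OF G(3) matrix_units_closed[OF FG(2)] U]
          lin_generator[OF _ U] by blast+
      then have "c \<odot> g \<oplus> x \<in> lin (matrix_units (F \<union> G))"
        using lin_add[OF U] lin_scale[OF _ U] g(1) by simp
      then show "\<exists>F. finite F \<and> F \<subseteq> le_paths \<Lambda> n \<and> c \<odot> g \<oplus> x \<in> lin (matrix_units F)"
        using F G by (intro exI[of _ "F \<union> G"]) simp
    qed
  qed
  then show ?thesis by blast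
qed

section \<open>The gauge action\<close>

text \<open>Elements of the span as lists of terms, so that the unbalanced terms can be removed by induction on the length.\<close>

fun combination :: "(complex \<times> 'a \<times> 'a) list \<Rightarrow> 'b" where
  "combination [] = \<zero>"
| "combination ((c, \<mu>, \<nu>) # xs) = c \<odot> E \<mu> \<nu> \<oplus> combination xs"

definition well_formed :: "(complex \<times> 'a \<times> 'a) list \<Rightarrow> bool" where
  "well_formed xs \<longleftrightarrow> (\<forall>(c, \<mu>, \<nu>) \<in> set xs. \<mu> \<in> P \<and> \<nu> \<in> P \<and> s \<mu> = s \<nu>)"

lemma combination_closed: "well_formed xs \<Longrightarrow> combination xs \<in> carrier A"
  by (induction xs rule: combination.induct) (auto simp: well_formed_def)

lemma span_combination: assumes "x \<in> span" shows "\<exists>xs. well_formed xs \<and> x = combination xs"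
  using assms
proof (induction rule: lin.induct)
  case lin_zero then show ?case by (intro exI[of _ "[]"]) (simp add: well_formed_def)
next
  case (lin_step g x c)
  then obtain xs where "well_formed xs" "x = combination xs" by blast
  moreover obtain \<mu> \<nu> where "g = E \<mu> \<nu>" "\<mu> \<in> P" "\<nu> \<in> P" "s \<mu> = s \<nu>" using lin_step(1) unfolding matrix_units_def by blast
  ultimately show ?case by (intro exI[of _ "(c, \<mu>, \<nu>) # xs"]) (simp add: well_formed_def)
qed

context
  fixes \<gamma> :: "complex ^ 'k \<Rightarrow> 'b \<Rightarrow> 'b"
  assumes gauge: "gauge_action \<Lambda> A t \<gamma>"
begin

lemma gauge_hom: assumes "z \<in> torus" shows "cstar_hom A A (\<gamma> z)"
  using gauge assms by (simp add: gauge_action_def)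

lemma gauge_simps:
  assumes z: "z \<in> torus"
  shows "x \<in> carrier A \<Longrightarrow> \<gamma> z x \<in> carrier A" "x \<in> carrier A \<Longrightarrow> y \<in> carrier A \<Longrightarrow> \<gamma> z (x \<oplus> y) = \<gamma> z x \<oplus> \<gamma> z y"
    "x \<in> carrier A \<Longrightarrow> \<gamma> z (c \<odot> x) = c \<odot> \<gamma> z x" "x \<in> carrier A \<Longrightarrow> y \<in> carrier A \<Longrightarrow> \<gamma> z (x \<otimes> y) = \<gamma> z x \<otimes> \<gamma> z y"
    "x \<in> carrier A \<Longrightarrow> \<gamma> z (adj A x) = adj A (\<gamma> z x)"
  using gauge_hom[OF z] by (simp_all add: cstar_hom_def)

lemma gauge_minus: "\<lbrakk>z \<in> torus; x \<in> carrier A; y \<in> carrier A\<rbrakk> \<Longrightarrow> \<gamma> z (x \<ominus> y) = \<gamma> z x \<ominus> \<gamma> z y"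
  by (simp add: minus_eq_scale gauge_simps)

lemma gauge_contractive: "\<lbrakk>z \<in> torus; x \<in> carrier A\<rbrakk> \<Longrightarrow> nrm A (\<gamma> z x) \<le> nrm A x"
  using cstar_hom_contractive[OF cstar_algebra_axioms cstar_algebra_axioms gauge_hom] by blast

definition gauge_weight :: "complex ^ 'k \<Rightarrow> 'a \<Rightarrow> 'a \<Rightarrow> complex" where
  "gauge_weight z \<mu> \<nu> = torus_power z (d \<mu>) * cnj (torus_power z (d \<nu>))"

lemma gauge_E: assumes "z \<in> torus" "\<mu> \<in> P" "\<nu> \<in> P" shows "\<gamma> z (E \<mu> \<nu>) = gauge_weight z \<mu> \<nu> \<odot> E \<mu> \<nu>"
proof -
  have "\<gamma> z (t \<eta>) = torus_power z (d \<eta>) \<odot> t \<eta>" if "\<eta> \<in> P" for \<eta>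
    using gauge assms that by (simp add: gauge_action_def)
  then show ?thesis using assms
    by (simp add: E_def gauge_simps adj_smult smult_mult_left smult_mult_right scale_scale gauge_weight_def mult.commute)
qed

lemma torus_power_unit: assumes "z \<in> torus" shows "torus_power z n * cnj (torus_power z n) = 1"
proof -
  have "cmod (torus_power z n) = 1" using assms by (simp add: torus_power_def torus_def norm_power flip: prod_norm)
  then show ?thesis by (simp add: complex_norm_square[symmetric])
qed

lemma gauge_core: assumes z: "z \<in> torus" and x: "x \<in> lin core_units" shows "\<gamma> z x = x"
  using x
proof (induction rule: lin.induct)
  case lin_zero then show ?case using gauge_simps(3)[OF z, of "\<zero>" 0] gauge_simps(1)[OF z, of "\<zero>"] by (simp add: scale_zero)
next
  case (lin_step g x c)
  obtain \<mu> \<nu> where g: "g = E \<mu> \<nu>" "\<mu> \<in> P" "\<nu> \<in> P" "d \<mu> = d \<nu>" using lin_step(1) unfolding core_units_def by blast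
  have "\<gamma> z g = g" using gauge_E[OF z g(2,3)] g torus_power_unit[OF z] by (simp add: gauge_weight_def)
  then show ?case using lin_step(3) lin_closed[OF lin_step(2) core_units_closed] g z by (simp add: gauge_simps)
qed

lemma gauge_combination: "z \<in> torus \<Longrightarrow> well_formed xs \<Longrightarrow> \<gamma> z (combination xs) = combination (map (\<lambda>(c, \<mu>, \<nu>). (gauge_weight z \<mu> \<nu> * c, \<mu>, \<nu>)) xs)"
proof (induction xs rule: combination.induct)
  case 1 then show ?case using gauge_core[OF _ lin_zero] by simp
next
  case (2 c \<mu> \<nu> xs)
  then have "\<mu> \<in> P" "\<nu> \<in> P" "well_formed xs" by (auto simp: well_formed_def)
  then show ?case using 2 combination_closed[of xs] by (simp add: gauge_simps gauge_E scale_scale mult.commute)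
qed

lemma combination_average:
  "well_formed xs \<Longrightarrow> (1/2) \<odot> (combination xs \<oplus> combination (map (\<lambda>(c, \<mu>, \<nu>). (f \<mu> \<nu> * c, \<mu>, \<nu>)) xs)) =
    combination (map (\<lambda>(c, \<mu>, \<nu>). ((1 + f \<mu> \<nu>) / 2 * c, \<mu>, \<nu>)) xs)"
proof (induction xs rule: combination.induct)
  case (2 c \<mu> \<nu> xs)
  let ?f = "map (\<lambda>(c, \<mu>, \<nu>). (f \<mu> \<nu> * c, \<mu>, \<nu>)) xs"
  have c: "\<mu> \<in> P" "\<nu> \<in> P" "well_formed xs" "well_formed ?f" using 2 by (auto simp: well_formed_def)
  note v = combination_closed[OF c(3)] combination_closed[OF c(4)]
  have "(1/2) \<odot> ((c \<odot> E \<mu> \<nu> \<oplus> combination xs) \<oplus> ((f \<mu> \<nu> * c) \<odot> E \<mu> \<nu> \<oplus> combination ?f)) =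
      (1/2) \<odot> ((c \<odot> E \<mu> \<nu> \<oplus> (f \<mu> \<nu> * c) \<odot> E \<mu> \<nu>) \<oplus> (combination xs \<oplus> combination ?f))"
    using c v by (simp add: a_ac)
  also have "\<dots> = (1/2) \<odot> (c \<odot> E \<mu> \<nu> \<oplus> (f \<mu> \<nu> * c) \<odot> E \<mu> \<nu>) \<oplus> (1/2) \<odot> (combination xs \<oplus> combination ?f)"
    using c v by (intro scale_add) auto
  also have "(1/2) \<odot> (c \<odot> E \<mu> \<nu> \<oplus> (f \<mu> \<nu> * c) \<odot> E \<mu> \<nu>) = ((1 + f \<mu> \<nu>) / 2 * c) \<odot> E \<mu> \<nu>"
    using c by (simp add: scale_scale algebra_simps add_divide_distrib flip: add_scale)
  finally show ?case using 2(1)[OF c(3)] by simp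
qed simp

text \<open>In a coordinate \<open>i\<close> where the degrees differ take \<open>z\<^sub>i = exp(\<i>\<pi>/(d(\<mu>)\<^sub>i - d(\<nu>)\<^sub>i))\<close>, and \<open>1\<close> in the others.\<close>

lemma exists_separating_character:
  assumes "d \<mu> \<noteq> d \<nu>" shows "\<exists>z \<in> torus. gauge_weight z \<mu> \<nu> = - 1"
proof -
  obtain i where i: "d \<mu> $ i \<noteq> d \<nu> $ i" using assms by (auto simp: vec_eq_iff)
  define \<theta> where "\<theta> = pi / (real (d \<mu> $ i) - real (d \<nu> $ i))"
  define z :: "complex ^ 'k" where "z = (\<chi> j. if j = i then cis \<theta> else 1)"
  have tp: "torus_power z n = cis (real (n $ i) * \<theta>)" for n
  proof -
    have "torus_power z n = (\<Prod>j\<in>UNIV. if j = i then cis \<theta> ^ n $ i else 1)"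
      unfolding torus_power_def by (intro prod.cong) (auto simp: z_def)
    then show ?thesis using Complex.DeMoivre[of \<theta> "n $ i"] by simp
  qed
  have "gauge_weight z \<mu> \<nu> = cis (real (d \<mu> $ i) * \<theta> - real (d \<nu> $ i) * \<theta>)"
    by (simp add: gauge_weight_def tp cis_cnj cis_mult)
  also have "real (d \<mu> $ i) * \<theta> - real (d \<nu> $ i) * \<theta> = (real (d \<mu> $ i) - real (d \<nu> $ i)) * \<theta>"
    by (simp add: left_diff_distrib)
  also have "\<dots> = pi" using i by (simp add: \<theta>_def)
  finally have "gauge_weight z \<mu> \<nu> = - 1" by simp
  moreover have "z \<in> torus" by (simp add: torus_def z_def)
  ultimately show ?thesis by blast
qed

text \<open>A balanced term joins \<open>b0\<close>. For an unbalanced one, averaging \<open>b\<close> with \<open>\<gamma>\<^sub>z b\<close>, where \<open>\<gamma>\<^sub>z\<close> reverses its sign, removes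
it, fixes \<open>b0\<close>, rescales the other terms, and does not increase the distance to \<open>a = \<gamma>\<^sub>z a\<close>.\<close>

lemma core_approximation:
  assumes a: "a \<in> fixed_algebra A \<gamma>"
  shows "b0 \<in> lin core_units \<Longrightarrow> well_formed xs \<Longrightarrow> \<exists>b \<in> lin core_units. nrm A (a \<ominus> b) \<le> nrm A (a \<ominus> (b0 \<oplus> combination xs))"
proof (induction "length xs" arbitrary: b0 xs)
  case 0
  then show ?case using lin_closed[OF 0(2) core_units_closed] by (intro bexI[of _ b0]) simp_all
next
  case (Suc l)
  then obtain c \<mu> \<nu> ys where xs: "xs = (c, \<mu>, \<nu>) # ys" by (cases xs) auto
  have t: "\<mu> \<in> P" "\<nu> \<in> P" "s \<mu> = s \<nu>" "well_formed ys" using Suc(4) by (auto simp: xs well_formed_def)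
  have fixed: "\<gamma> z a = a" if "z \<in> torus" for z using a that by (auto simp: fixed_algebra_def)
  have ac: "a \<in> carrier A" using a by (auto simp: fixed_algebra_def)
  note b0 = lin_closed[OF Suc(3) core_units_closed] and yc = combination_closed[OF t(4)] and xc = combination_closed[OF Suc(4)]
  show ?case
  proof (cases "d \<mu> = d \<nu>")
    case True
    then have "E \<mu> \<nu> \<in> core_units" unfolding core_units_def using t by blast
    then have "c \<odot> E \<mu> \<nu> \<oplus> b0 \<in> lin core_units" using Suc(3) by (rule lin_step)
    then obtain b where b: "b \<in> lin core_units" "nrm A (a \<ominus> b) \<le> nrm A (a \<ominus> ((c \<odot> E \<mu> \<nu> \<oplus> b0) \<oplus> combination ys))"
      using Suc(1)[of ys] Suc(2) t(4) xs by auto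
    moreover have "(c \<odot> E \<mu> \<nu> \<oplus> b0) \<oplus> combination ys = b0 \<oplus> combination xs" using t b0 yc by (simp add: xs a_ac)
    ultimately show ?thesis by auto
  next
    case False
    then obtain z where z: "z \<in> torus" "gauge_weight z \<mu> \<nu> = - 1" using exists_separating_character by blast
    define b where "b = b0 \<oplus> combination xs"
    have bc: "b \<in> carrier A" using b0 xc by (simp add: b_def)
    define ys' where "ys' = map (\<lambda>(c, \<mu>, \<nu>). ((1 + gauge_weight z \<mu> \<nu>) / 2 * c, \<mu>, \<nu>)) ys"
    have ys': "well_formed ys'" "length ys' = l" using t(4) Suc(2) xs by (auto simp: ys'_def well_formed_def)
    note y'c = combination_closed[OF ys'(1)]
    have gx: "\<gamma> z (combination xs) \<in> carrier A" using gauge_simps(1)[OF z(1) xc] .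
    have avg: "(1/2) \<odot> (combination xs \<oplus> \<gamma> z (combination xs)) = combination ys'"
      unfolding gauge_combination[OF z(1) Suc(4)] combination_average[OF Suc(4)]
      using z(2) t y'c unfolding ys'_def by (simp add: xs scale_zero)
    have "(1/2) \<odot> (b \<oplus> \<gamma> z b) = b0 \<oplus> combination ys'"
    proof -
      have "b \<oplus> \<gamma> z b = (b0 \<oplus> b0) \<oplus> (combination xs \<oplus> \<gamma> z (combination xs))"
        using b0 xc gx gauge_core[OF z(1) Suc(3)] by (simp add: b_def gauge_simps z(1) a_ac)
      then show ?thesis using b0 xc gx by (simp add: double scale_add scale_scale flip: avg)
    qed
    then have mid: "2 \<odot> (b0 \<oplus> combination ys') = b \<oplus> \<gamma> z b"
      using bc gauge_simps(1)[OF z(1) bc] by (metis (no_types, lifting) a_closed scale_scale scale_one nonzero_mult_div_cancel_left zero_neq_numeral times_divide_eq_right mult.right_neutral)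
    have gb: "\<gamma> z b \<in> carrier A" using gauge_simps(1)[OF z(1) bc] .
    have "nrm A (a \<ominus> (b0 \<oplus> combination ys')) \<le> (nrm A (a \<ominus> b) + nrm A (a \<ominus> \<gamma> z b)) / 2"
    proof (rule nrm_midpoint)
      have "2 \<odot> (a \<ominus> (b0 \<oplus> combination ys')) = (a \<oplus> a) \<ominus> (b \<oplus> \<gamma> z b)"
        using ac b0 y'c by (simp only: double scale_minus_right a_closed mid)
      then show "2 \<odot> (a \<ominus> (b0 \<oplus> combination ys')) = (a \<ominus> b) \<oplus> (a \<ominus> \<gamma> z b)"
        using minus_add_add[OF ac ac bc gb] by simp
    qed (use ac b0 y'c bc gb in auto)
    also have "nrm A (a \<ominus> \<gamma> z b) = nrm A (\<gamma> z (a \<ominus> b))" using gauge_minus[OF z(1) ac bc] fixed[OF z(1)] by simp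
    also have "\<dots> \<le> nrm A (a \<ominus> b)" using gauge_contractive[OF z(1)] ac bc by simp
    finally have le: "nrm A (a \<ominus> (b0 \<oplus> combination ys')) \<le> nrm A (a \<ominus> b)" by simp
    obtain b' where "b' \<in> lin core_units" "nrm A (a \<ominus> b') \<le> nrm A (a \<ominus> (b0 \<oplus> combination ys'))"
      using Suc(1)[OF ys'(2)[symmetric] Suc(3) ys'(1)] by blast
    then show ?thesis using le unfolding b_def by (intro bexI[of _ b']) simp_all
  qed
qed

text \<open>Pass from \<open>a\<close> to the self-adjoint \<open>a*a\<close>, and from its approximant in the core to the real part of that.\<close>

lemma vertex_in_ideal:
  assumes gen: "\<And>S. cstar_subalgebra A S \<Longrightarrow> t ` P \<subseteq> S \<Longrightarrow> S = carrier A"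
    and I: "cstar_ideal A I" and a: "a \<in> I" "a \<in> fixed_algebra A \<gamma>" "a \<noteq> \<zero>"
  shows "\<exists>w \<in> vertices \<Lambda>. t w \<in> I"
proof -
  have ac: "a \<in> carrier A" using a(2) by (simp add: fixed_algebra_def)
  define h where "h = adj A a \<otimes> a"
  have hc: "h \<in> carrier A" using ac by (simp add: h_def)
  have h: "h \<in> I" "adj A h = h" "h \<noteq> \<zero>"
    using a ac ideal_closed(5)[OF I a(1)] nrm_adj_mult[OF ac] nrm_eq_0[OF ac] nrm_eq_0[OF hc]
    by (auto simp: h_def adj_mult)
  have hf: "h \<in> fixed_algebra A \<gamma>"
    using a(2) ac hc by (auto simp: fixed_algebra_def h_def gauge_simps)
  have pos: "nrm A h / 5 > 0" using h(3) hc nrm_eq_0[OF hc] nrm_nonneg[OF hc] by linarith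
  obtain b where b: "b \<in> span" "nrm A (h \<ominus> b) < nrm A h / 5" using span_dense[OF gen hc pos] by blast
  obtain xs where xs: "well_formed xs" "b = combination xs" using span_combination[OF b(1)] by blast
  obtain b' where b': "b' \<in> lin core_units" "nrm A (h \<ominus> b') \<le> nrm A (h \<ominus> (\<zero> \<oplus> combination xs))"
    using core_approximation[OF hf lin_zero xs(1)] by blast
  have b'c: "b' \<in> carrier A" using lin_closed[OF b'(1) core_units_closed] .
  have near: "nrm A (h \<ominus> b') < nrm A h / 5" using b'(2) b(2) combination_closed[OF xs(1)] xs(2) by simp
  define c where "c = (1/2) \<odot> (b' \<oplus> adj A b')"
  have c: "c \<in> lin core_units" "adj A c = c" and cc: "c \<in> carrier A"
    using lin_scale[OF lin_add[OF core_units_closed core_adj[OF b'(1)] b'(1)] core_units_closed] b'c by (auto simp: c_def adj_add adj_smult a_comm)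
  have "nrm A (h \<ominus> c) \<le> (nrm A (h \<ominus> b') + nrm A (h \<ominus> adj A b')) / 2"
  proof (rule nrm_midpoint)
    have "2 \<odot> (h \<ominus> c) = (h \<oplus> h) \<ominus> (b' \<oplus> adj A b')"
      using hc cc b'c by (simp add: double scale_minus_right) (simp add: c_def scale_scale)
    then show "2 \<odot> (h \<ominus> c) = (h \<ominus> b') \<oplus> (h \<ominus> adj A b')"
      using minus_add_add[OF hc hc b'c adj_closed[OF b'c]] by simp
  qed (use hc cc b'c in auto)
  moreover have "nrm A (h \<ominus> adj A b') = nrm A (h \<ominus> b')"
    using nrm_adj[of "h \<ominus> b'"] hc b'c h(2) by (simp add: adj_minus)
  ultimately have near': "nrm A (h \<ominus> c) \<le> nrm A h / 5" using near by simp
  obtain n F where F: "finite F" "F \<subseteq> le_paths \<Lambda> n" "c \<in> lin (matrix_units F)"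
    using core_in_matrix_algebra[OF c(1)] by blast
  show ?thesis by (rule vertex_in_ideal_of_approximation[OF I h F(2,1,3) c(2) near'])
qed

end

section \<open>Vertex projections in ideals, and cofinality\<close>

text \<open>The elements of \<open>I\<close> whose adjoint is in \<open>I\<close> too form a C*-subalgebra, and it contains each \<open>t\<^sub>\<mu> = t\<^sub>\<mu> t\<^bsub>s(\<mu>)\<^esub>\<close>.\<close>

lemma ideal_of_all_vertices:
  assumes gen: "\<And>S. cstar_subalgebra A S \<Longrightarrow> t ` P \<subseteq> S \<Longrightarrow> S = carrier A"
    and I: "cstar_ideal A I" and all: "\<And>v. v \<in> vertices \<Lambda> \<Longrightarrow> t v \<in> I"
  shows "I = carrier A"
proof -
  define J where "J = {x \<in> I. adj A x \<in> I}"
  note i = ideal_closed[OF I]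
  have Ic: "x \<in> carrier A" if "x \<in> I" for x using that i(1) by blast
  have "cstar_subalgebra A J"
    unfolding cstar_subalgebra_def closed_subspace_def closed_iff_sequentially_closed
  proof (intro conjI ballI allI impI)
    show "J \<subseteq> carrier A" using i(1) by (auto simp: J_def)
    show "\<zero> \<in> J" using i(2) by (simp add: J_def adj_zero)
    fix x assume x: "x \<in> J"
    show "c \<odot> x \<in> J" for c using x i(4) Ic by (simp add: J_def adj_smult)
    show "adj A x \<in> J" using x Ic by (simp add: J_def)
    fix y assume y: "y \<in> J"
    show "x \<oplus> y \<in> J" using x y i(3) Ic by (simp add: J_def adj_add)
    show "x \<otimes> y \<in> J" using x y i(5) Ic by (simp add: J_def adj_mult)
  next
    fix Y y assume "(\<forall>n. Y n \<in> J) \<and> tends Y y"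
    then have Y: "\<And>n. Y n \<in> I" "\<And>n. adj A (Y n) \<in> I" "tends Y y" by (auto simp: J_def)
    then show "y \<in> J" using i(8)[OF Y(1,3)] i(8)[OF Y(2) tends_adj[OF Y(3)]] by (simp add: J_def)
  qed (use i(1) in \<open>auto simp: J_def\<close>)
  moreover have "t ` P \<subseteq> J"
  proof
    fix x assume "x \<in> t ` P"
    then obtain \<mu> where \<mu>: "\<mu> \<in> P" "x = t \<mu>" by blast
    have "t (s \<mu>) \<in> I" using all \<mu> by simp
    then have "t \<mu> \<otimes> t (s \<mu>) \<in> I" "t (s \<mu>) \<otimes> adj A (t \<mu>) \<in> I" using i(5,6) \<mu> by auto
    moreover have "t (s \<mu>) \<otimes> adj A (t \<mu>) = adj A (t \<mu>)"
      using arg_cong[OF t_source[OF \<mu>(1)], of "adj A"] \<mu> by (simp add: adj_mult t_vertex)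
    ultimately show "x \<in> J" using \<mu> t_source[OF \<mu>(1)] by (simp add: J_def)
  qed
  ultimately have "J = carrier A" by (rule gen)
  then show ?thesis using i(1) by (auto simp: J_def)
qed

text \<open>The set of vertices with projection in \<open>I\<close> is hereditary as \<open>t\<^bsub>s(\<eta>)\<^esub> = t\<^sub>\<eta>* t\<^bsub>r(\<eta>)\<^esub> t\<^sub>\<eta>\<close>, and saturated by the relation for \<open>t\<^sub>u\<close> and
\<open>n = (1, ..., 1)\<close>.\<close>

lemma cofinal_ideal:
  assumes gen: "\<And>S. cstar_subalgebra A S \<Longrightarrow> t ` P \<subseteq> S \<Longrightarrow> S = carrier A"
    and cof: "cofinal_kgraph \<Lambda>" and I: "cstar_ideal A I" and v: "v \<in> vertices \<Lambda>" "t v \<in> I"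
  shows "I = carrier A"
proof -
  note i = ideal_closed[OF I]
  define H where "H = {w \<in> vertices \<Lambda>. t w \<in> I}"
  have H: "hereditary H"
    unfolding hereditary_def
  proof (intro ballI impI)
    fix \<eta> assume \<eta>: "\<eta> \<in> P" "r \<eta> \<in> H"
    have "adj A (t \<eta>) \<otimes> (t (r \<eta>) \<otimes> t \<eta>) \<in> I" using \<eta> i(5,6) by (simp add: H_def)
    then show "s \<eta> \<in> H" using \<eta> by (simp add: t_range t_adj_mult H_def)
  qed
  have ext: "\<exists>\<alpha> \<in> le_paths \<Lambda> 1. r \<alpha> = u \<and> s \<alpha> \<notin> H" if u: "u \<in> vertices \<Lambda>" "u \<notin> H" for u
  proof (rule ccontr)
    assume no: "\<not> ?thesis"
    let ?F = "from_range \<Lambda> u (le_paths \<Lambda> 1)"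
    have pI: "t \<eta> \<otimes> adj A (t \<eta>) \<in> I" if \<eta>: "\<eta> \<in> ?F" for \<eta>
    proof -
      have \<eta>P: "\<eta> \<in> P" "r \<eta> = u" "\<eta> \<in> le_paths \<Lambda> 1" using from_range_le_pathsD[OF \<eta>] by auto
      then have "t (s \<eta>) \<in> I" using no by (auto simp: H_def)
      then have "t \<eta> \<otimes> t (s \<eta>) \<otimes> adj A (t \<eta>) \<in> I" using \<eta>P i(5,6) by simp
      then show ?thesis using t_source[OF \<eta>P(1)] by simp
    qed
    have sumI: "finsum A f F \<in> I" if F: "finite F" "\<And>\<eta>. \<eta> \<in> F \<Longrightarrow> f \<eta> \<in> I" for f and F :: "'a set"
      using F
    proof (induction F rule: finite_induct)
      case (insert \<eta> F)
      then have "f \<in> F \<rightarrow> carrier A" "f \<eta> \<in> carrier A" using i(1) by auto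
      with insert i(3) show ?case by (simp add: finsum_insert)
    qed (simp add: i(2))
    have "(\<Oplus>\<eta>\<in>?F. t \<eta> \<otimes> adj A (t \<eta>)) \<in> I" by (rule sumI[OF finite_le_paths[OF rf u(1)] pI])
    then have "t u \<in> I" using t_sum[OF u(1), of 1] by simp
    then show False using u by (simp add: H_def)
  qed
  have "w \<in> H" if w: "w \<in> vertices \<Lambda>" for w
  proof (rule ccontr)
    assume "w \<notin> H"
    then obtain Y where Y: "boundary_filter Y" "avoids H Y" using exists_avoiding_filter[OF lc H w _ ext] by blast
    obtain m x where x: "boundary_path \<Lambda> m x" "\<And>n. enat_vec n \<le> m \<Longrightarrow> \<exists>\<eta> \<in> Y. x (n, n) = s \<eta>"
      using boundary_path_of_filter[OF Y(1)] by blast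
    obtain n where n: "enat_vec n \<le> m" "from_range \<Lambda> v P \<inter> to_source \<Lambda> P (x (n, n)) \<noteq> {}"
      using cof x(1) v(1) unfolding cofinal_kgraph_def by blast
    obtain \<mu> where \<mu>: "\<mu> \<in> P" "r \<mu> = v" "s \<mu> = x (n, n)" using n(2) by (auto simp: from_range_def to_source_def)
    have "r \<mu> \<in> H" using \<mu>(2) v by (simp add: H_def)
    then have "s \<mu> \<in> H" using H \<mu>(1) unfolding hereditary_def by blast
    moreover obtain \<eta> where "\<eta> \<in> Y" "x (n, n) = s \<eta>" using x(2)[OF n(1)] by blast
    ultimately show False using Y(2) \<mu>(3) by (auto simp: avoids_def)
  qed
  then show ?thesis by (intro ideal_of_all_vertices[OF gen I]) (auto simp: H_def)
qed

end

text \<open>Every vertex is the range of a boundary path, so no vertex projection vanishes in the universal algebra.\<close>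

lemma (in kgraph) exists_filter_at_vertex:
  assumes "locally_convex \<Lambda>" "v \<in> vertices \<Lambda>"
  shows "\<exists>Y. boundary_filter Y \<and> avoids {} Y \<and> v \<in> Y"
proof (rule exists_avoiding_filter[OF assms(1) _ assms(2)])
  fix u assume u: "u \<in> vertices \<Lambda>" "u \<notin> {}"
  have "d u \<le> 1" using vertexD(4)[OF u(1)] by (simp add: less_eq_vec_def)
  then obtain \<eta> where "prefix u \<eta>" "\<eta> \<in> le_paths \<Lambda> 1" using le_paths_extend[OF vertexD(1)[OF u(1)]] by blast
  then show "\<exists>\<alpha>\<in>le_paths \<Lambda> 1. r \<alpha> = u \<and> s \<alpha> \<notin> {}"
    using prefixD(3)[of u \<eta>] vertexD(2)[OF u(1)] by (intro bexI[of _ \<eta>]) simp_all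
qed (simp_all add: hereditary_def)

text \<open>The boundary path that violates cofinality avoids the set \<open>H\<close> of vertices that do not connect to it, so the
projection of its range survives in the representation on the boundary filters that avoid \<open>H\<close>.\<close>

lemma proper_ideal_of_not_cofinal:
  fixes \<Lambda> :: "('a, 'k::finite) kgraph" and B :: "'b cstar"
  assumes \<Lambda>: "kgraph \<Lambda>" and rf: "row_finite \<Lambda>" and lc: "locally_convex \<Lambda>"
    and B: "universal_CK_algebra \<Lambda> B t" and not_cofinal: "\<not> cofinal_kgraph \<Lambda>"
  shows "\<exists>I. cstar_ideal B I \<and> I \<noteq> carrier B \<and> (\<exists>v \<in> vertices \<Lambda>. t v \<in> I \<and> t v \<noteq> \<zero>\<^bsub>B\<^esub>)"
proof -
  interpret kgraph \<Lambda> by (rule \<Lambda>)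
  have Bc: "cstar_algebra B" and CK: "CK_family \<Lambda> B t" using B by (auto simp: universal_CK_algebra_def)
  have tc: "t v \<in> carrier B" if "v \<in> vertices \<Lambda>" for v using CK that vertexD(1) by (auto simp: CK_family_def)
  have rep: "\<exists>\<pi>. cstar_hom B op_algebra \<pi> \<and> (\<forall>\<eta> \<in> P. \<pi> (t \<eta>) = path_op H \<eta>)" if "hereditary H" for H
    by (rule universal_CK_algebra_hom[OF \<Lambda> B cstar_algebra_op CK_family_path_op[OF rf lc that]])
  have hom0: "\<pi> \<zero>\<^bsub>B\<^esub> = 0" if "cstar_hom B op_algebra \<pi>" for \<pi> :: "'b \<Rightarrow> 'a set op"
    using kernel_ideal[OF Bc cstar_algebra_op that] by (auto simp: cstar_ideal_def closed_subspace_def)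
  obtain m x v where x: "boundary_path \<Lambda> m x" and v: "v \<in> vertices \<Lambda>"
    and no: "\<And>n. enat_vec n \<le> m \<Longrightarrow> from_range \<Lambda> v P \<inter> to_source \<Lambda> P (x (n, n)) = {}"
    using not_cofinal unfolding cofinal_kgraph_def by blast
  define H where "H = {w \<in> vertices \<Lambda>. \<forall>n. enat_vec n \<le> m \<longrightarrow> from_range \<Lambda> w P \<inter> to_source \<Lambda> P (x (n, n)) = {}}"
  have H: "hereditary H"
    unfolding hereditary_def
  proof (intro ballI impI)
    fix \<eta> assume \<eta>: "\<eta> \<in> P" "r \<eta> \<in> H"
    have False if n: "enat_vec n \<le> m" and \<mu>: "\<mu> \<in> P" "r \<mu> = s \<eta>" "s \<mu> = x (n, n)" for n \<mu>
    proof -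
      have "\<eta> \<cdot> \<mu> \<in> from_range \<Lambda> (r \<eta>) P \<inter> to_source \<Lambda> P (x (n, n))"
        using \<eta>(1) \<mu> by (simp add: from_range_def to_source_def)
      then show False using \<eta>(2) n by (auto simp: H_def)
    qed
    then show "s \<eta> \<in> H" using \<eta>(1) by (auto simp: H_def from_range_def to_source_def)
  qed
  define Y where "Y = {x (0, p) | p. enat_vec p \<le> m}"
  note xs = filter_of_boundary_path[OF x]
  have Y: "boundary_filter Y" using xs(1) by (simp add: Y_def)
  have avoid: "avoids H Y"
    unfolding avoids_def
  proof
    fix \<eta> assume "\<eta> \<in> Y"
    then obtain p where p: "\<eta> = x (0, p)" "enat_vec p \<le> m" by (auto simp: Y_def)
    have s: "s \<eta> = x (p, p)" "x (p, p) \<in> vertices \<Lambda>" using xs(2)[OF p(2)] p(1) by auto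
    then have "x (p, p) \<in> from_range \<Lambda> (s \<eta>) P \<inter> to_source \<Lambda> P (x (p, p))"
      using vertexD[OF s(2)] by (simp add: from_range_def to_source_def)
    then show "s \<eta> \<notin> H" using p(2) by (auto simp: H_def)
  qed
  obtain \<eta> where \<eta>: "\<eta> \<in> Y" using boundary_filterD(2)[OF Y] by blast
  have \<eta>P: "\<eta> \<in> P" using boundary_filterD(1)[OF Y \<eta>] .
  define w where "w = r \<eta>"
  have w: "w \<in> vertices \<Lambda>" "w \<in> Y" using \<eta>P filter_vertex[OF Y \<eta>, of w] by (simp_all add: w_def)
  obtain \<pi> where \<pi>: "cstar_hom B op_algebra \<pi>" "\<forall>\<eta> \<in> P. \<pi> (t \<eta>) = path_op H \<eta>" using rep[OF H] by blast
  define I where "I = {b \<in> carrier B. \<pi> b = 0}"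
  have "cstar_ideal B I" using kernel_ideal[OF Bc cstar_algebra_op \<pi>(1)] by (simp add: I_def)
  moreover have "t w \<notin> I"
    using path_op_nonzero[OF lc H w(1) Y avoid w(2)] \<pi>(2) vertexD(1)[OF w(1)] by (simp add: I_def)
  then have "I \<noteq> carrier B" using tc[OF w(1)] by blast
  moreover have "t v \<in> I"
  proof -
    have "v \<in> H" using v no by (simp add: H_def)
    then show ?thesis using path_op_zero[OF lc H v] \<pi>(2) vertexD(1)[OF v] tc[OF v] by (simp add: I_def)
  qed
  moreover have "t v \<noteq> \<zero>\<^bsub>B\<^esub>"
  proof
    assume 0: "t v = \<zero>\<^bsub>B\<^esub>"
    have H0: "hereditary {}" by (simp add: hereditary_def)
    obtain Z where Z: "boundary_filter Z" "avoids {} Z" "v \<in> Z" using exists_filter_at_vertex[OF lc v] by blast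
    obtain \<pi>0 where \<pi>0: "cstar_hom B op_algebra \<pi>0" "\<forall>\<eta> \<in> P. \<pi>0 (t \<eta>) = path_op {} \<eta>" using rep[OF H0] by blast
    have "\<pi>0 (t v) = 0" using hom0[OF \<pi>0(1)] 0 by simp
    then show False using path_op_nonzero[OF lc H0 v Z] \<pi>0(2) vertexD(1)[OF v] by simp
  qed
  ultimately show ?thesis using v by blast
qed

theorem proposition4p2:
  fixes \<Lambda> :: "('a, 'k::finite) kgraph"
    and B :: "'b cstar"
    and s :: "'a \<Rightarrow> 'b"
    and \<gamma> :: "complex ^ 'k \<Rightarrow> 'b \<Rightarrow> 'b"
  assumes "kgraph \<Lambda>"
    and "row_finite \<Lambda>"
    and "locally_convex \<Lambda>"
    and "universal_CK_algebra \<Lambda> B s"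
    and "gauge_action \<Lambda> B s \<gamma>"
  shows "(cofinal_kgraph \<Lambda> \<longleftrightarrow>
      (\<forall>I. cstar_ideal B I \<and> (\<exists>v \<in> vertices \<Lambda>. s v \<in> I) \<longrightarrow> I = carrier B)) \<and>
    (cofinal_kgraph \<Lambda> \<longleftrightarrow>
      (\<forall>I. cstar_ideal B I \<and> I \<inter> fixed_algebra B \<gamma> \<noteq> {\<zero>\<^bsub>B\<^esub>} \<longrightarrow> I = carrier B))"
proof -
  have B: "cstar_algebra B" "CK_family \<Lambda> B s"
    and gen: "\<And>S. cstar_subalgebra B S \<Longrightarrow> s ` paths \<Lambda> \<subseteq> S \<Longrightarrow> S = carrier B"
    using assms(4) by (auto simp: universal_CK_algebra_def)
  interpret ck_family \<Lambda> B s
    by (intro ck_family.intro cstar.intro ck_family_axioms.intro) (use assms B in auto)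
  have zero_fixed: "\<zero>\<^bsub>B\<^esub> \<in> fixed_algebra B \<gamma>"
    using gauge_core[OF assms(5) _ lin_zero] by (simp add: fixed_algebra_def)
  have vertex_fixed: "s v \<in> fixed_algebra B \<gamma>" if v: "v \<in> vertices \<Lambda>" for v
  proof -
    have "torus_power z 0 = 1" for z :: "complex ^ 'k" by (simp add: torus_power_def)
    then have "\<gamma> z (s v) = s v" if "z \<in> torus" for z
      using assms(5) that vertexD[OF v] by (simp add: gauge_action_def)
    then show ?thesis using vertexD(1)[OF v] by (simp add: fixed_algebra_def)
  qed
  have 12: "I = carrier B" if "cofinal_kgraph \<Lambda>" "cstar_ideal B I" "v \<in> vertices \<Lambda>" "s v \<in> I" for I v
    using cofinal_ideal[OF gen that] .
  have 13: "I = carrier B" if cof: "cofinal_kgraph \<Lambda>" and I: "cstar_ideal B I" and ne: "I \<inter> fixed_algebra B \<gamma> \<noteq> {\<zero>\<^bsub>B\<^esub>}" for I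
  proof -
    have "\<zero>\<^bsub>B\<^esub> \<in> I" using ideal_closed(2)[OF I] .
    then obtain a where "a \<in> I" "a \<in> fixed_algebra B \<gamma>" "a \<noteq> \<zero>\<^bsub>B\<^esub>" using ne zero_fixed by blast
    then obtain w where "w \<in> vertices \<Lambda>" "s w \<in> I" using vertex_in_ideal[OF assms(5) gen I] by blast
    then show ?thesis using 12[OF cof I] by blast
  qed
  have not: "\<exists>I. cstar_ideal B I \<and> I \<noteq> carrier B \<and> (\<exists>v \<in> vertices \<Lambda>. s v \<in> I \<and> s v \<noteq> \<zero>\<^bsub>B\<^esub>)"
    if "\<not> cofinal_kgraph \<Lambda>"
    by (rule proper_ideal_of_not_cofinal[OF assms(1-4) that])
  show ?thesis
  proof (intro conjI iffI)
    assume "cofinal_kgraph \<Lambda>"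
    then show "\<forall>I. cstar_ideal B I \<and> (\<exists>v \<in> vertices \<Lambda>. s v \<in> I) \<longrightarrow> I = carrier B" using 12 by blast
  next
    assume "\<forall>I. cstar_ideal B I \<and> (\<exists>v \<in> vertices \<Lambda>. s v \<in> I) \<longrightarrow> I = carrier B"
    then show "cofinal_kgraph \<Lambda>" using not by blast
  next
    assume "cofinal_kgraph \<Lambda>"
    then show "\<forall>I. cstar_ideal B I \<and> I \<inter> fixed_algebra B \<gamma> \<noteq> {\<zero>\<^bsub>B\<^esub>} \<longrightarrow> I = carrier B" using 13 by blast
  next
    assume all: "\<forall>I. cstar_ideal B I \<and> I \<inter> fixed_algebra B \<gamma> \<noteq> {\<zero>\<^bsub>B\<^esub>} \<longrightarrow> I = carrier B"
    show "cofinal_kgraph \<Lambda>"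
    proof (rule ccontr)
      assume "\<not> cofinal_kgraph \<Lambda>"
      then obtain I v where I: "cstar_ideal B I" "I \<noteq> carrier B" "v \<in> vertices \<Lambda>" "s v \<in> I" "s v \<noteq> \<zero>\<^bsub>B\<^esub>"
        using not by blast
      then have "I \<inter> fixed_algebra B \<gamma> \<noteq> {\<zero>\<^bsub>B\<^esub>}" using vertex_fixed by blast
      then show False using all I(1,2) by blast
    qed
  qed
qed

end
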